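(* For all integers $a,r\ge 2$, as $n\to\infty$ (with $a,r$ fixed), $$\left|\mathcal{F}\left(n,\ 2r,\ (a-1)\binom{2r}{2}+\mathrm{ex}(2r,K_{r+1})-1\right)\right|=\left(a^{\frac{1-x_{\star}(r,1)}{r-1}}(a+1)^{\frac{r-2+x_{\star}(r,1)}{r-1}}\right)^{(1+o(1))\binom n2},$$ where $$x_{\star}(r,1):=\frac{\log\left(\frac{a+1}{a}\right)}{\log\left(\frac{(a+1)^r}{(a-1)^{r-1}a}\right)}.$$
   Context: A multigraph is a pair $G=(V,w)$ with $V$ a finite set and $w:V^{(2)}\to\mathbb{Z}_{\ge 0}$, where $V^{(2)}$ is the set of 2-element subsets of $V$. For integers $s\ge 2$, $q\ge 0$, $G$ is an $(s,q)$-graph if $\sum_{xy\in X^{(2)}}w(xy)\le q$ for every $s$-element subset $X\subseteq V$. $\mathcal{F}(n,s,q)$ is the set of all $(s,q)$-graphs on the (labelled) vertex set $[n]=\{1,\dots,n\}$. The Turán number $\mathrm{ex}(n,K_{r+1})$ is the maximum number of edges in a $K_{r+1}$-free (ordinary, simple) graph on $n$ vertices. *)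

theory Defs
  imports Complex_Main "HOL-Library.FuncSet" "HOL-Library.Ramsey"
begin

definition sq_graph :: "nat \<Rightarrow> nat \<Rightarrow> 'a set \<Rightarrow> ('a set \<Rightarrow> nat) \<Rightarrow> bool" where
  "sq_graph s q V w \<longleftrightarrow> (\<forall>X \<in> nsets V s. (\<Sum>e \<in> nsets X 2. w e) \<le> q)"

(* Weight functions are taken extensional on the 2-subsets of the vertex set (fixed to undefined
   elsewhere), so that distinct elements are distinct labelled multigraphs. *)
definition sq_graphs :: "nat \<Rightarrow> nat \<Rightarrow> nat \<Rightarrow> (nat set \<Rightarrow> nat) set" where
  "sq_graphs n s q = {w \<in> nsets {1..n} 2 \<rightarrow>\<^sub>E UNIV. sq_graph s q {1..n} w}"

(* For s > n \<ge> 2 the (s,q)-condition is vacuous and sq_graphs n s q is infinite (so its card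
   is 0); this concerns only finitely many n. *)
lemma finite_sq_graphs:
  assumes "2 \<le> s" "s \<le> n"
  shows "finite (sq_graphs n s q)"
proof (rule finite_subset)
  show "sq_graphs n s q \<subseteq> nsets {1..n} 2 \<rightarrow>\<^sub>E {..q}"
  proof
    fix w assume w: "w \<in> sq_graphs n s q"
    have "w e \<le> q" if e: "e \<in> nsets {1..n} 2" for e
    proof -
      have "e \<subseteq> {1..n}" "card e = 2" "finite e" using e by (auto simp: nsets_def)
      then obtain X where X: "e \<subseteq> X" "X \<subseteq> {1..n}" "card X = s"
        using assms exists_subset_between[of e s "{1..n}"] by auto
      then have fX: "finite X" using finite_subset by blast
      then have "e \<in> nsets X 2" using X \<open>card e = 2\<close> \<open>finite e\<close> by (auto simp: nsets_def)
      then have "w e \<le> (\<Sum>e \<in> nsets X 2. w e)"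
        using fX finite_imp_finite_nsets by (intro member_le_sum) auto
      also have "\<dots> \<le> q"
        using w X fX by (auto simp: sq_graphs_def sq_graph_def nsets_def)
      finally show ?thesis .
    qed
    then show "w \<in> nsets {1..n} 2 \<rightarrow>\<^sub>E {..q}"
      using w by (auto simp: sq_graphs_def PiE_iff)
  qed
  show "finite (nsets {1..n} 2 \<rightarrow>\<^sub>E {..q})"
    by (intro finite_PiE finite_imp_finite_nsets) auto
qed

definition clique_free :: "nat \<Rightarrow> 'a set \<Rightarrow> 'a set set \<Rightarrow> bool" where
  "clique_free k V E \<longleftrightarrow> \<not> (\<exists>K \<in> nsets V k. clique K E)"

(* turan_number n k is ex(n, K_k). A simple graph on {1..n} is identified with its edge set. *)
definition turan_number :: "nat \<Rightarrow> nat \<Rightarrow> nat" where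
  "turan_number n k = Max {card E | E. E \<subseteq> nsets {1..n} 2 \<and> clique_free k {1..n} E}"

(* The maximum ranges over a finite nonempty set for k \<ge> 2; no graph is K_0-free, and none with
   a vertex is K_1-free. *)
lemma turan_number_attained:
  assumes "2 \<le> k"
  shows "\<exists>E \<subseteq> nsets {1..n} 2. clique_free k {1..n} E \<and> card E = turan_number n k"
    and "\<And>E. E \<subseteq> nsets {1..n} 2 \<Longrightarrow> clique_free k {1..n} E \<Longrightarrow> card E \<le> turan_number n k"
proof -
  let ?S = "{card E | E. E \<subseteq> nsets {1..n} 2 \<and> clique_free k {1..n} E}"
  have "?S \<subseteq> card ` Pow (nsets {1..n} 2)" by auto
  then have fin: "finite ?S"
    by (rule finite_subset) (auto intro: finite_imp_finite_nsets)
  have "clique_free k {1..n} {}"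
    unfolding clique_free_def
  proof
    assume "\<exists>K \<in> nsets {1..n} k. clique K ({} :: nat set set)"
    then obtain K where K: "card K = k" "clique K ({} :: nat set set)"
      by (auto simp: nsets_def)
    from K(2) have "\<forall>v\<in>K. \<forall>w\<in>K. v = w" by (auto simp: clique_def)
    then have "card K \<le> 1" by (metis card.infinite card_le_Suc0_iff_eq One_nat_def zero_le)
    with K(1) assms show False by simp
  qed
  then have "?S \<noteq> {}" by blast
  from Max_in[OF fin this] 
  show "\<exists>E \<subseteq> nsets {1..n} 2. clique_free k {1..n} E \<and> card E = turan_number n k"
    unfolding turan_number_def by (smt (verit) mem_Collect_eq)
  show "card E \<le> turan_number n k" if "E \<subseteq> nsets {1..n} 2" "clique_free k {1..n} E" for E
    unfolding turan_number_def using that by (intro Max_ge[OF fin]) blast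
qed

(* x_star a r is x_*(r,1), whose dependence on a the notation suppresses. *)
definition x_star :: "nat \<Rightarrow> nat \<Rightarrow> real" where
  "x_star a r = ln ((real a + 1) / real a)
     / ln ((real a + 1) ^ r / ((real a - 1) ^ (r - 1) * real a))"

end

theory Submission
  imports Defs "HOL-Library.Disjoint_Sets" "HOL-Combinatorics.Permutations"
begin

text \<open>
Put $d(e) = w(e) - (a-1)$. Since $ex(2r,K_{r+1}) = 2r(r-1)$, the graphs to be counted are those in
which $d$ sums to less than $2r(r-1)$ over every set of $2r$ vertices.

\<^bold>\<open>Lower bound.\<close> Split the vertices into classes $0,\dots,r-1$ and allow $d \le 1$ across classes,
$d \le 0$ inside the classes $1,\dots,r-1$ and $d \le -1$ inside class $0$. Only balanced sets of $2r$
vertices have $2r(r-1)$ pairs across classes, and these lose one inside class $0$; so every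
multigraph below these caps counts. If class $0$ has the proportion \<open>x_star\<close> and the others are equal,
then all vertices have the same mean logarithm of choices per pair, namely \<open>growth a r\<close>, the
logarithm of the base in the theorem (\<open>card_sq_graphs_ge\<close>).

\<^bold>\<open>The largest product.\<close> Conversely the sum of $\ln(w(e)+1)$ over the pairs of $m$ vertices is at
most \<open>growth a r\<close> times $m(m-1)/2$ plus $O(m)$ (\<open>log_product_bound\<close>). Delete vertices of small
logarithmic degree one at a time. If there is none, then for every weighting of a bounded vertex set
$S$ some vertex outside does better against $S$ than the average \<open>growth a r\<close>. Rescale logarithms to a
cost: $0$ for $d=1$, $1$ for $d=0$, at least \<open>\<gamma> = log_ratio a\<close> for $d<0$. Feeding in suitable weightings
one finds a vertex $u$ and $r-1$ pairs such that $d=0$ inside the pairs and $d=1$ otherwise. Testing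
such a structure by the proportions of the extremal pattern yields a vertex that can be attached
in only one way (\<open>star_branch\<close>); testing the result yields a vertex that turns one pair into a
triple (\<open>star_grow\<close>). This step is always possible, so the structure would grow for ever. All that
matters about $a$ is that \<open>\<gamma>\<close> lies between $1$ and $3$.

\<^bold>\<open>From products to numbers.\<close> An entropy argument replaces graph regularity or containers. Choose
$w$ uniformly from the family. The entropy of the weight of a pair $e$, given all other weights on
$T \cup e$, depends only on the size of $T$ and decreases with it, so for some bounded $t$
it hardly changes between $t$ and $t+m$; and multiplied by the number of pairs, it bounds the
logarithm of the number of graphs up to a small error (\<open>ln_card_le_pair_entropy\<close>). Given the weights at a set $T$ of this size, the weights among $m$ further
vertices are then nearly independent. Let each of these pairs take its largest value that is not
too unlikely. By near independence these values occur together in one graph of the family for most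
outcomes on $T$, so the sum of their logarithms is controlled by the largest product, and it nearly
bounds the sum of the entropies (\<open>entropy_sum_le\<close>).
\<close>

section \<open>Sums over pairs\<close>

lemma sq_graph_le:
  assumes "sq_graph s q V w" "2 \<le> s" "finite V" "s \<le> card V" "e \<in> nsets V 2"
  shows "w e \<le> q"
proof -
  have e: "e \<subseteq> V" "card e = 2" "finite e" using assms(5) by (auto simp: nsets_def)
  then obtain X where X: "e \<subseteq> X" "X \<subseteq> V" "card X = s"
    using assms exists_subset_between[of e s V] by auto
  then have fX: "finite X" using assms(3) finite_subset by blast
  then have "e \<in> nsets X 2" using X e by (auto simp: nsets_def)
  then have "w e \<le> (\<Sum>e\<in>nsets X 2. w e)"
    using fX finite_imp_finite_nsets by (intro member_le_sum) auto
  also have "\<dots> \<le> q" using assms(1) X fX by (auto simp: sq_graph_def nsets_def)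
  finally show ?thesis .
qed

lemma sq_graph_mono: "sq_graph s q V w \<Longrightarrow> U \<subseteq> V \<Longrightarrow> sq_graph s q U w"
  unfolding sq_graph_def using nsets_mono[of U V s] by blast

lemma sum_nsets_insert:
  assumes "finite S" "v \<notin> S"
  shows "(\<Sum>e\<in>nsets (insert v S) 2. f e) = (\<Sum>e\<in>nsets S 2. f e) + (\<Sum>x\<in>S. f {v, x})"
proof -
  have eq: "nsets (insert v S) 2 = nsets S 2 \<union> (\<lambda>x. {v, x}) ` S"
  proof (intro equalityI subsetI)
    fix e assume e: "e \<in> nsets (insert v S) 2"
    show "e \<in> nsets S 2 \<union> (\<lambda>x. {v, x}) ` S"
    proof (cases "v \<in> e")
      case True
      with e obtain z where "e = {v, z}" "z \<noteq> v"
        unfolding nsets_def by (auto simp: card_2_iff)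
      then show ?thesis using e by (auto simp: nsets_def)
    next
      case False
      then show ?thesis using e by (auto simp: nsets_def)
    qed
  next
    fix e assume "e \<in> nsets S 2 \<union> (\<lambda>x. {v, x}) ` S"
    then show "e \<in> nsets (insert v S) 2" using assms
      by (auto simp: nsets_def card_insert_if)
  qed
  have inj: "inj_on (\<lambda>x. {v, x}) S" using assms by (auto simp: inj_on_def doubleton_eq_iff)
  have "(\<Sum>e\<in>nsets (insert v S) 2. f e)
      = (\<Sum>e\<in>nsets S 2. f e) + (\<Sum>e\<in>(\<lambda>x. {v, x}) ` S. f e)"
    unfolding eq using assms by (intro sum.union_disjoint) (auto simp: finite_imp_finite_nsets nsets_def)
  then show ?thesis by (simp add: sum.reindex[OF inj])
qed

lemma card_nsets2: "finite S \<Longrightarrow> card (nsets S 2) = card S choose 2"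
  by (simp add: card_nsets)

section \<open>Excess graphs with large logarithmic degrees\<close>

text \<open>
The situation to be refuted in the extremal problem, with the logarithms replaced by a cost. The
condition \<open>extend\<close> says that no weighting of a small vertex set is expensive for all outside
vertices; large logarithmic degrees give it by averaging. Its total weight is the inverse of
\<open>x_star\<close>, so that a part of weight $1$ and $r-1$ parts of weight \<open>\<gamma>\<close> carry the proportions of the
extremal pattern. Pairs with \<open>d = 1\<close> are called red below.
\<close>
locale dense_excess =
  fixes V :: "'a set" and d :: "'a set \<Rightarrow> int" and cost :: "'a set \<Rightarrow> real"
    and r :: nat and \<gamma> :: real
  assumes r2: "2 \<le> r" and finV: "finite V" and V_ne: "V \<noteq> {}"
    and gamma: "1 \<le> \<gamma>" "\<gamma> \<le> 3"
    and sparse: "\<And>X. X \<in> nsets V (2 * r) \<Longrightarrow> (\<Sum>e\<in>nsets X 2. d e) < 2 * int r * (int r - 1)"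
    and cost1: "\<And>e. e \<in> nsets V 2 \<Longrightarrow> d e = 1 \<Longrightarrow> cost e = 0"
    and cost0: "\<And>e. e \<in> nsets V 2 \<Longrightarrow> d e = 0 \<Longrightarrow> cost e = 1"
    and cost_neg: "\<And>e. e \<in> nsets V 2 \<Longrightarrow> d e < 0 \<Longrightarrow> cost e \<ge> \<gamma>"
    and cost_lin: "\<And>e. e \<in> nsets V 2 \<Longrightarrow> cost e \<ge> 1 - real_of_int (d e)"
    and extend: "\<And>S c. S \<subseteq> V \<Longrightarrow> card S \<le> 3 * r \<Longrightarrow> (\<And>x. x \<in> S \<Longrightarrow> 0 \<le> c x)
      \<Longrightarrow> (\<Sum>x\<in>S. c x) = 1 + (real r - 1) * \<gamma>
      \<Longrightarrow> \<exists>v\<in>V - S. (\<Sum>x\<in>S. c x * cost {v, x}) < \<gamma>"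
begin

lemma pair_in: "x \<in> V \<Longrightarrow> z \<in> V \<Longrightarrow> x \<noteq> z \<Longrightarrow> {x, z} \<in> nsets V 2"
  by (auto simp: nsets_def)

text \<open>
Under uniform weights the total cost of the new vertex is less than $1$, $2$ or $3$, according to
the size of \<open>S\<close>, and \<open>cost_lin\<close> with integrality turns this into a bound for the sum of \<open>d\<close>. For fewer than
$2r-1$ vertices the bound is the increment of the number of edges of the $r$-partite Turan graph;
for $2r-1$ vertices it is one less.
\<close>
lemma extend_uniform:
  assumes S: "S \<subseteq> V" "S \<noteq> {}" and k: "card S \<le> 2 * r - 1"
  obtains v where "v \<in> V - S"
    "(\<Sum>x\<in>S. d {v, x}) \<ge> int (card S) - (if card S < r then 0 else if card S \<le> 2 * r - 2 then 1 else 2)"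
proof -
  let ?k = "real (card S)"
  let ?t = "1 + (real r - 1) * \<gamma>"
  have finS: "finite S" using S finV finite_subset by blast
  have kpos: "?k > 0" using S finS by (simp add: card_gt_0_iff)
  have tpos: "?t > 0" using r2 gamma by (intro add_pos_nonneg) auto
  have "\<exists>v\<in>V - S. (\<Sum>x\<in>S. (?t / ?k) * cost {v, x}) < \<gamma>"
    using k tpos kpos S by (intro extend) auto
  then obtain v where v: "v \<in> V - S" "(\<Sum>x\<in>S. (?t / ?k) * cost {v, x}) < \<gamma>" by blast
  have "?k - real_of_int (\<Sum>x\<in>S. d {v, x}) = (\<Sum>x\<in>S. 1 - real_of_int (d {v, x}))"
    by (simp add: sum_subtractf)
  also have "\<dots> \<le> (\<Sum>x\<in>S. cost {v, x})"
    using v S by (intro sum_mono cost_lin pair_in) auto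
  finally have "?t * (?k - real_of_int (\<Sum>x\<in>S. d {v, x})) \<le> ?t * (\<Sum>x\<in>S. cost {v, x})"
    using tpos by (simp add: mult_left_mono)
  also have "\<dots> < \<gamma> * ?k"
  proof -
    have "(?t / ?k) * (\<Sum>x\<in>S. cost {v, x}) < \<gamma>"
      using v(2) by (simp only: sum_distrib_left)
    then show ?thesis using kpos by (simp only: times_divide_eq_left pos_divide_less_eq)
  qed
  finally have *: "?t * (?k - real_of_int (\<Sum>x\<in>S. d {v, x})) < \<gamma> * ?k" .
  define D where "D = (\<Sum>x\<in>S. d {v, x})"
  define j :: int where "j = (if card S < r then 0 else if card S \<le> 2 * r - 2 then 1 else 2)"
  have "D \<ge> int (card S) - j"
  proof (rule ccontr)
    assume "\<not> ?thesis"
    then have "int (card S) - D \<ge> j + 1" by simp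
    then have "?k - real_of_int D \<ge> j + 1" by linarith
    then have "?t * (j + 1) \<le> ?t * (?k - real_of_int D)"
      using tpos by (intro mult_left_mono) auto
    with * have lt: "?t * (j + 1) < \<gamma> * ?k" unfolding D_def by linarith
    have "?k \<le> (real r - 1) * (real_of_int j + 1)"
    proof -
      have "?k \<le> real r - 1" if "card S < r"
        using that by linarith
      moreover have "?k \<le> (real r - 1) * 2" if "card S \<le> 2 * r - 2"
      proof -
        from that r2 have "card S + 2 \<le> 2 * r" by linarith
        then have "real (card S + 2) \<le> real (2 * r)" by (simp only: of_nat_le_iff)
        then show ?thesis by simp
      qed
      moreover have "?k \<le> (real r - 1) * 3"
      proof -
        from k r2 have "card S + 3 \<le> 3 * r" by linarith
        then have "real (card S + 3) \<le> real (3 * r)" by (simp only: of_nat_le_iff)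
        then show ?thesis by simp
      qed
      ultimately show ?thesis unfolding j_def by auto
    qed
    then have "\<gamma> * ?k \<le> \<gamma> * ((real r - 1) * (real_of_int j + 1))"
      using gamma by (intro mult_left_mono) auto
    also have "\<dots> \<le> ?t * (real_of_int j + 1)"
      unfolding j_def by (auto simp: algebra_simps)
    finally show False using lt by simp
  qed
  then show ?thesis using that[OF v(1)] unfolding D_def j_def by auto
qed

text \<open>
The bound is the number of edges of the $r$-partite Turan graph. A set above it can be extended one
vertex at a time without losing the surplus until it has $2r-1$ vertices; the last step costs
one unit and ends in a set of $2r$ vertices with sum at least $2r(r-1)$.
\<close>
lemma sum_le_turan:
  assumes "X \<subseteq> V" "card X < 2 * r"
  shows "(\<Sum>e\<in>nsets X 2. d e) \<le> int (card X choose 2) - int (card X - r)"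
proof (rule ccontr)
  assume neg: "\<not> ?thesis"
  define heavy where "heavy k \<longleftrightarrow>
    (\<exists>X\<subseteq>V. card X = k \<and> (\<Sum>e\<in>nsets X 2. d e) > int (k choose 2) - int (k - r))" for k
  have grow: "\<exists>Y\<subseteq>V. card Y = Suc k \<and>
      (\<Sum>e\<in>nsets Y 2. d e) > int (Suc k choose 2) - int (Suc k - r) - (if k = 2 * r - 1 then 1 else 0)"
    if h: "heavy k" "0 < k" "k < 2 * r" for k
  proof -
    from h obtain X where X: "X \<subseteq> V" "card X = k"
      "(\<Sum>e\<in>nsets X 2. d e) > int (k choose 2) - int (k - r)" unfolding heavy_def by blast
    have finX: "finite X" using X finV finite_subset by blast
    have "X \<noteq> {}" using X h by auto
    then obtain v where v: "v \<in> V - X" "(\<Sum>x\<in>X. d {v, x}) \<ge> int k -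
        (if k < r then 0 else if k \<le> 2 * r - 2 then 1 else 2)"
    proof -
      have "card X \<le> 2 * r - 1" using X h by simp
      from extend_uniform[OF X(1) \<open>X \<noteq> {}\<close> this] that X(2) show thesis by blast
    qed
    have "(\<Sum>e\<in>nsets (insert v X) 2. d e) = (\<Sum>e\<in>nsets X 2. d e) + (\<Sum>x\<in>X. d {v, x})"
      using finX v by (intro sum_nsets_insert) auto
    moreover have "int (Suc k choose 2) = int (k choose 2) + int k"
      by (simp add: numeral_2_eq_2)
    ultimately have "(\<Sum>e\<in>nsets (insert v X) 2. d e)
        > int (Suc k choose 2) - int (Suc k - r) - (if k = 2 * r - 1 then 1 else 0)"
      using X(3) v(2) h(3) by (auto split: if_splits)
    moreover have "card (insert v X) = Suc k" using v finX X by auto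
    ultimately show ?thesis using v X by (intro exI[of _ "insert v X"]) auto
  qed
  have base: "heavy (card X)" using neg assms unfolding heavy_def by (intro exI[of _ X]) auto
  have pos: "0 < card X"
  proof (rule ccontr)
    assume "\<not> ?thesis"
    then have "card X = 0" by simp
    then have "X = {}" using assms finV finite_subset by fastforce
    moreover have "nsets ({} :: 'a set) 2 = {}" by (auto simp: nsets_def)
    ultimately show False using neg by simp
  qed
  have "heavy k" if "card X \<le> k" "k < 2 * r" for k
    using that
  proof (induction k rule: dec_induct)
    case (step k)
    then have h: "heavy k" "0 < k" "k < 2 * r" "k \<noteq> 2 * r - 1" using pos by auto
    from grow[OF h(1-3)] h(4) have "\<exists>Y\<subseteq>V. card Y = Suc k \<and> (\<Sum>e\<in>nsets Y 2. d e) > int (Suc k choose 2) - int (Suc k - r)"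
      by simp
    then show ?case unfolding heavy_def by blast
  qed (use base in auto)
  then have "heavy (2 * r - 1)" using assms r2 by simp
  from grow[OF this] r2 obtain Y where Y: "Y \<subseteq> V" "card Y = 2 * r"
    "(\<Sum>e\<in>nsets Y 2. d e) > int (2 * r choose 2) - int r - 1" by auto
  have "int (2 * r choose 2) = int r * (2 * int r - 1)"
    using r2 by (simp add: choose_two of_nat_diff)
  then have "(\<Sum>e\<in>nsets Y 2. d e) \<ge> 2 * int r * (int r - 1)"
    using Y(3) by (simp add: algebra_simps)
  moreover have "Y \<in> nsets V (2 * r)" using Y finV finite_subset by (auto simp: nsets_def)
  note sparse[OF this]
  ultimately show False by simp
qed

lemma excess_le_1:
  assumes e: "e \<in> nsets V 2"
  shows "d e \<le> 1"
proof -
  have ce: "card e = 2" "e \<subseteq> V" "finite e" using e by (auto simp: nsets_def)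
  have "nsets e 2 = {e}"
  proof (intro equalityI subsetI)
    fix x assume "x \<in> nsets e 2"
    then have "x \<subseteq> e" "card x = card e" using ce by (auto simp: nsets_def)
    then show "x \<in> {e}" using card_subset_eq[OF ce(3)] by blast
  qed (use ce in \<open>simp add: nsets_def\<close>)
  moreover have "(\<Sum>e\<in>nsets e 2. d e) \<le> int (card e choose 2) - int (card e - r)"
    using ce r2 by (intro sum_le_turan) auto
  ultimately show ?thesis using ce r2 by simp
qed

lemma no_red_clique:
  assumes K: "K \<subseteq> V" "card K = Suc r" "\<And>e. e \<in> nsets K 2 \<Longrightarrow> d e = 1"
  shows False
proof -
  have "(\<Sum>e\<in>nsets K 2. d e) = int (Suc r choose 2)"
    using K card_nsets2[of K] finite_subset[OF K(1) finV] by simp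
  moreover have "(\<Sum>e\<in>nsets K 2. d e) \<le> int (card K choose 2) - int (card K - r)"
    using K r2 by (intro sum_le_turan) auto
  ultimately show False using K by simp
qed

lemma cost_nonneg: "e \<in> nsets V 2 \<Longrightarrow> 0 \<le> cost e"
  and cost_ge_1: "e \<in> nsets V 2 \<Longrightarrow> d e \<noteq> 1 \<Longrightarrow> 1 \<le> cost e"
proof -
  assume e: "e \<in> nsets V 2"
  consider "d e = 1" | "d e = 0" | "d e < 0" using excess_le_1[OF e] by linarith
  then show "0 \<le> cost e" using cost1[OF e] cost0[OF e] cost_neg[OF e] gamma by cases auto
next
  assume e: "e \<in> nsets V 2" "d e \<noteq> 1"
  then consider "d e = 0" | "d e < 0" using excess_le_1[OF e(1)] by linarith
  then show "1 \<le> cost e" using cost0[OF e(1)] cost_neg[OF e(1)] gamma by cases auto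
qed

text \<open>
The parts of a complete multipartite pattern, as a set of sets: \<open>d\<close> vanishes inside the parts and
all pairs between different parts are red.
\<close>
definition config :: "'a set set \<Rightarrow> bool" where
  "config \<P> \<longleftrightarrow> finite \<P> \<and> {} \<notin> \<P> \<and> \<Union>\<P> \<subseteq> V \<and> disjoint \<P> \<and>
    (\<forall>A\<in>\<P>. \<forall>x\<in>A. \<forall>z\<in>A. x \<noteq> z \<longrightarrow> d {x, z} = 0) \<and>
    (\<forall>A\<in>\<P>. \<forall>B\<in>\<P>. A \<noteq> B \<longrightarrow> (\<forall>x\<in>A. \<forall>z\<in>B. d {x, z} = 1))"

lemma configI:
  assumes "finite \<P>" "{} \<notin> \<P>" "\<Union>\<P> \<subseteq> V" "disjoint \<P>"
    "\<And>A x z. A \<in> \<P> \<Longrightarrow> x \<in> A \<Longrightarrow> z \<in> A \<Longrightarrow> x \<noteq> z \<Longrightarrow> d {x, z} = 0"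
    "\<And>A B x z. A \<in> \<P> \<Longrightarrow> B \<in> \<P> \<Longrightarrow> A \<noteq> B \<Longrightarrow> x \<in> A \<Longrightarrow> z \<in> B \<Longrightarrow> d {x, z} = 1"
  shows "config \<P>"
  unfolding config_def by (intro conjI ballI impI) (fact assms)+

lemma configD:
  assumes "config \<P>"
  shows config_finite: "finite \<P>" and config_Union: "\<Union>\<P> \<subseteq> V" and config_disjoint: "disjoint \<P>"
    and config_empty: "{} \<notin> \<P>"
  using assms unfolding config_def by simp_all

lemma config_Int: "config \<P> \<Longrightarrow> A \<in> \<P> \<Longrightarrow> B \<in> \<P> \<Longrightarrow> A \<noteq> B \<Longrightarrow> A \<inter> B = {}"
  by (drule config_disjoint) (simp add: pairwise_def disjnt_def)

lemma config_red: "config \<P> \<Longrightarrow> A \<in> \<P> \<Longrightarrow> B \<in> \<P> \<Longrightarrow> A \<noteq> B \<Longrightarrow> x \<in> A \<Longrightarrow> z \<in> B \<Longrightarrow> d {x, z} = 1"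
  by (simp add: config_def)

lemma config_zero: "config \<P> \<Longrightarrow> A \<in> \<P> \<Longrightarrow> x \<in> A \<Longrightarrow> z \<in> A \<Longrightarrow> x \<noteq> z \<Longrightarrow> d {x, z} = 0"
  by (simp add: config_def)

lemma config_subset:
  assumes c: "config \<P>" and sub: "\<Q> \<subseteq> \<P>"
  shows "config \<Q>"
proof (rule configI)
  show "finite \<Q>" "{} \<notin> \<Q>" using configD[OF c] sub finite_subset by auto
  show "\<Union>\<Q> \<subseteq> V" using config_Union[OF c] sub by auto
  show "disjoint \<Q>" using config_disjoint[OF c] sub by (rule pairwise_subset)
next
  fix A x z assume "A \<in> \<Q>" "x \<in> A" "z \<in> A" "x \<noteq> z"
  then show "d {x, z} = 0" using sub by (intro config_zero[OF c, of A]) (auto dest: subsetD)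
next
  fix A B x z assume "A \<in> \<Q>" "B \<in> \<Q>" "A \<noteq> B" "x \<in> A" "z \<in> B"
  then show "d {x, z} = 1" using sub by (intro config_red[OF c, of A B]) (auto dest: subsetD)
qed

lemma config_insert:
  assumes c: "config \<P>" and A: "A \<noteq> {}" "A \<subseteq> V" "\<And>B. B \<in> \<P> \<Longrightarrow> A \<inter> B = {}"
    and zero: "\<And>x z. x \<in> A \<Longrightarrow> z \<in> A \<Longrightarrow> x \<noteq> z \<Longrightarrow> d {x, z} = 0"
    and red: "\<And>x z B. x \<in> A \<Longrightarrow> B \<in> \<P> \<Longrightarrow> z \<in> B \<Longrightarrow> d {x, z} = 1"
  shows "config (insert A \<P>)"
proof (rule configI)
  show "disjoint (insert A \<P>)" using config_disjoint[OF c] A(3)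
    by (auto simp: pairwise_insert disjnt_def)
  show "finite (insert A \<P>)" "{} \<notin> insert A \<P>" "\<Union>(insert A \<P>) \<subseteq> V"
    using configD[OF c] A by auto
next
  fix C x z assume "C \<in> insert A \<P>" "x \<in> C" "z \<in> C" "x \<noteq> z"
  then show "d {x, z} = 0"
    using zero[of x z] config_zero[OF c, of C x z] by (cases "C = A") auto
next
  fix C B x z assume *: "C \<in> insert A \<P>" "B \<in> insert A \<P>" "C \<noteq> B" "x \<in> C" "z \<in> B"
  show "d {x, z} = 1"
  proof (cases "C = A \<or> B = A")
    case True
    then show ?thesis
    proof
      assume "C = A" then show ?thesis using * red[of x B z] by auto
    next
      assume "B = A"
      then have "d {z, x} = 1" using * red[of z C x] by auto
      then show ?thesis by (simp add: insert_commute)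
    qed
  next
    case False
    then show ?thesis using * config_red[OF c, of C B x z] by auto
  qed
qed

lemma config_part_card:
  assumes "config \<P>" "A \<in> \<P>"
  shows "0 < card A \<and> finite A \<and> A \<subseteq> V"
proof -
  have "A \<subseteq> V" "A \<noteq> {}" using assms unfolding config_def by auto
  then show ?thesis using finite_subset[OF _ finV] by (simp add: card_gt_0_iff)
qed

text \<open>
One suitable vertex from each part would complete the red clique \<open>K\<close> to one with $r+1$ vertices.
\<close>
lemma red_transversal_false:
  assumes "config \<P>" "K \<subseteq> V" "K \<inter> \<Union>\<P> = {}" "card K + card \<P> = Suc r"
    "\<And>e. e \<in> nsets K 2 \<Longrightarrow> d e = 1"
    "\<And>A. A \<in> \<P> \<Longrightarrow> \<exists>x\<in>A. \<forall>v\<in>K. d {v, x} = 1"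
  shows False
proof -
  from assms(6) obtain f where f: "\<And>A. A \<in> \<P> \<Longrightarrow> f A \<in> A" "\<And>A v. A \<in> \<P> \<Longrightarrow> v \<in> K \<Longrightarrow> d {v, f A} = 1"
    by metis
  have fin: "finite \<P>" "finite K" using assms finV finite_subset config_finite by auto
  have inj: "inj_on f \<P>"
  proof (rule inj_onI)
    fix A B assume AB: "A \<in> \<P>" "B \<in> \<P>" "f A = f B"
    show "A = B"
    proof (rule ccontr)
      assume "A \<noteq> B"
      then have "A \<inter> B = {}" using config_Int[OF assms(1)] AB by blast
      then show False using f(1)[OF AB(1)] f(1)[OF AB(2)] AB(3) by auto
    qed
  qed
  have sub: "f ` \<P> \<subseteq> \<Union>\<P>" using f(1) by auto
  have disj: "K \<inter> f ` \<P> = {}" using sub assms(3) by blast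
  have 1: "card (K \<union> f ` \<P>) = Suc r"
    using card_Un_disjoint[OF fin(2) _ disj] fin card_image[OF inj] assms(4) by simp
  have 2: "K \<union> f ` \<P> \<subseteq> V" using assms(2) sub config_Union[OF assms(1)] by blast
  have "d e = 1" if e: "e \<in> nsets (K \<union> f ` \<P>) 2" for e
  proof -
    from e obtain x z where xz: "e = {x, z}" "x \<noteq> z" "x \<in> K \<union> f ` \<P>" "z \<in> K \<union> f ` \<P>"
      unfolding nsets_def by (auto simp: card_2_iff)
    show ?thesis
    proof (cases "x \<in> K"; cases "z \<in> K")
      assume "x \<in> K" "z \<in> K"
      then have "e \<in> nsets K 2" using xz fin by (auto simp: nsets_def)
      then show ?thesis by (rule assms(5))
    next
      assume "x \<in> K" "z \<notin> K" then show ?thesis using xz f(2) by auto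
    next
      assume "x \<notin> K" "z \<in> K" then show ?thesis using xz f(2) by (auto simp: insert_commute)
    next
      assume "x \<notin> K" "z \<notin> K"
      then obtain A B where AB: "A \<in> \<P>" "B \<in> \<P>" "x = f A" "z = f B" using xz by auto
      then have "A \<noteq> B" using xz by auto
      then show ?thesis using AB config_red[OF assms(1) AB(1,2)] f(1) xz by auto
    qed
  qed
  then show False by (rule no_red_clique[OF 2 1])
qed

lemma nonred_part:
  assumes "config \<P>" "card \<P> = r" "v \<in> V - \<Union>\<P>"
  shows "\<exists>A\<in>\<P>. \<forall>x\<in>A. d {v, x} \<noteq> 1"
proof (rule ccontr)
  assume "\<not> ?thesis"
  then have ex: "\<And>A. A \<in> \<P> \<Longrightarrow> \<exists>x\<in>A. d {v, x} = 1" by simp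
  have "nsets {v} 2 = {}" by (rule nsets_eq_empty) simp_all
  then show False
    by (intro red_transversal_false[of \<P> "{v}"]) (use assms ex in auto)
qed

text \<open>
Two vertices from each part together with \<open>p\<close> and \<open>q\<close> would form $r$ pairs with \<open>d = 0\<close> inside the pairs
and \<open>d = 1\<close> elsewhere, whose total is exactly the forbidden value $2r(r-1)$.
\<close>
lemma doubled_config_false:
  assumes R: "config R" "card R = r - 1" and pq: "p \<in> V - \<Union>R" "q \<in> V - \<Union>R" "p \<noteq> q" "d {p, q} = 0"
    and two: "\<And>A. A \<in> R \<Longrightarrow> \<exists>x\<in>A. \<exists>z\<in>A. x \<noteq> z \<and> d {p, x} = 1 \<and> d {p, z} = 1 \<and> d {q, x} = 1 \<and> d {q, z} = 1"
  shows False
proof -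
  have "\<exists>Y\<subseteq>A. card Y = 2 \<and> (\<forall>x\<in>Y. d {p, x} = 1 \<and> d {q, x} = 1)" if A: "A \<in> R" for A
  proof -
    from two[OF A] obtain x z where "x \<in> A" "z \<in> A" "x \<noteq> z" "d {p, x} = 1" "d {p, z} = 1" "d {q, x} = 1" "d {q, z} = 1"
      by blast
    then show ?thesis by (intro exI[of _ "{x, z}"]) auto
  qed
  then obtain Y where Y: "\<And>A. A \<in> R \<Longrightarrow> Y A \<subseteq> A" "\<And>A. A \<in> R \<Longrightarrow> card (Y A) = 2"
    "\<And>A x. A \<in> R \<Longrightarrow> x \<in> Y A \<Longrightarrow> d {p, x} = 1 \<and> d {q, x} = 1" by metis
  have Yne: "Y A \<noteq> {}" if "A \<in> R" for A using Y(2)[OF that] by auto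
  have disjR: "A \<inter> B = {}" if "A \<in> R" "B \<in> R" "A \<noteq> B" for A B
    using config_Int[OF R(1)] that by blast
  have inj: "inj_on Y R"
  proof (rule inj_onI)
    fix A B assume AB: "A \<in> R" "B \<in> R" "Y A = Y B"
    then show "A = B" using Y(1)[of A] Y(1)[of B] Yne[of A] disjR[of A B] by blast
  qed
  have UY: "\<Union>(Y ` R) \<subseteq> \<Union>R" using Y(1) by blast
  have cYR: "config (Y ` R)"
  proof (rule configI)
    show "disjoint (Y ` R)"
      unfolding pairwise_image disjnt_def pairwise_def using disjR Y(1) by blast
    show "finite (Y ` R)" "{} \<notin> Y ` R" "\<Union>(Y ` R) \<subseteq> V"
      using R(1) Yne UY config_Union[OF R(1)] config_finite[OF R(1)] by auto
  next
    fix A x z assume "A \<in> Y ` R" "x \<in> A" "z \<in> A" "x \<noteq> z"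
    then obtain A' where "A' \<in> R" "x \<in> A'" "z \<in> A'" using Y(1) by blast
    then show "d {x, z} = 0" using config_zero[OF R(1)] \<open>x \<noteq> z\<close> by simp
  next
    fix A B x z assume *: "A \<in> Y ` R" "B \<in> Y ` R" "A \<noteq> B" "x \<in> A" "z \<in> B"
    then obtain A' B' where "A' \<in> R" "B' \<in> R" "A' \<noteq> B'" "x \<in> A'" "z \<in> B'" using Y(1) by blast
    then show "d {x, z} = 1" using config_red[OF R(1)] by simp
  qed
  define \<Q> where "\<Q> = insert {p, q} (Y ` R)"
  have pqY: "{p, q} \<inter> B = {}" if "B \<in> Y ` R" for B using pq UY that by blast
  have cQ: "config \<Q>" unfolding \<Q>_def
  proof (rule config_insert[OF cYR])
    show "{p, q} \<noteq> {}" "{p, q} \<subseteq> V" using pq by auto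
  qed (use pqY pq Y(3) in \<open>auto simp: insert_commute\<close>)
  have "{p, q} \<notin> Y ` R" using pqY by blast
  then have cardQ: "card \<Q> = r"
    unfolding \<Q>_def using R r2 card_image[OF inj] by (simp add: config_def)
  have card2: "card B = 2" if "B \<in> \<Q>" for B
    using that Y(2) pq unfolding \<Q>_def by auto
  have finB: "finite B" if "B \<in> \<Q>" for B
    using config_part_card[OF cQ that] by simp
  define X where "X = \<Union>\<Q>"
  have XV: "X \<subseteq> V" using config_Union[OF cQ] unfolding X_def .
  have finX: "finite X" using XV finV finite_subset by blast
  have "card X = sum card \<Q>" unfolding X_def
    using config_disjoint[OF cQ] finB by (intro card_Union_disjoint) auto
  then have cardX: "card X = 2 * r" using card2 cardQ by simp
  have Qsub: "\<Q> \<subseteq> nsets X 2" using card2 finB unfolding X_def nsets_def by auto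
  have d1: "d e = 1 - (if e \<in> \<Q> then 1 else 0)" if e: "e \<in> nsets X 2" for e
  proof -
    from e obtain x z where xz: "e = {x, z}" "x \<noteq> z" "x \<in> X" "z \<in> X"
      unfolding nsets_def by (auto simp: card_2_iff)
    then obtain A B where AB: "A \<in> \<Q>" "B \<in> \<Q>" "x \<in> A" "z \<in> B" unfolding X_def by auto
    show ?thesis
    proof (cases "A = B")
      case True
      then have "e \<subseteq> A" using xz AB by auto
      moreover have "card e = card A" using card2[OF AB(1)] e by (simp add: nsets_def)
      ultimately have "e = A" using card_subset_eq[OF finB[OF AB(1)]] by blast
      then show ?thesis using config_zero[OF cQ AB(1)] AB xz True by auto
    next
      case False
      then have "A \<inter> B = {}" using config_Int[OF cQ AB(1,2)] by blast
      have "e \<notin> \<Q>"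
      proof
        assume "e \<in> \<Q>"
        moreover have "e \<inter> A \<noteq> {}" "e \<inter> B \<noteq> {}" using xz AB by auto
        ultimately have "e = A" "e = B" using config_Int[OF cQ] AB by blast+
        then show False using False by simp
      qed
      then show ?thesis using config_red[OF cQ AB(1,2) False AB(3,4)] xz by simp
    qed
  qed
  have "(\<Sum>e\<in>nsets X 2. d e) = (\<Sum>e\<in>nsets X 2. 1 - (if e \<in> \<Q> then 1 else 0))"
    by (rule sum.cong[OF refl d1])
  also have "\<dots> = int (2 * r choose 2) - int r"
    using finX cardX cardQ Qsub
    by (simp add: sum_subtractf card_nsets2 finite_imp_finite_nsets sum.If_cases Int_absorb1)
  also have "int (2 * r choose 2) = int r * (2 * int r - 1)"
    using r2 by (simp add: choose_two of_nat_diff)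
  finally have "(\<Sum>e\<in>nsets X 2. d e) = 2 * int r * (int r - 1)" by (simp add: algebra_simps)
  moreover have "X \<in> nsets V (2 * r)" using XV finX cardX by (simp add: nsets_def)
  note sparse[OF this]
  ultimately show False by simp
qed

definition mean_cost :: "'a \<Rightarrow> 'a set \<Rightarrow> real" where
  "mean_cost v A = (\<Sum>x\<in>A. cost {v, x}) / card A"

text \<open>
All weightings in the main argument have this shape: weight $1$ spread over one set and weight \<open>\<gamma>\<close>
spread over each of $r-1$ other sets.
\<close>
lemma extend_family:
  assumes A0: "A0 \<subseteq> V" "A0 \<noteq> {}" and R: "finite R" "card R = r - 1" "{} \<notin> R" "\<Union>R \<subseteq> V"
    and A0R: "A0 \<notin> R" and card: "card (A0 \<union> \<Union>R) \<le> 3 * r"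
  shows "\<exists>v\<in>V - (A0 \<union> \<Union>R). mean_cost v A0 + \<gamma> * (\<Sum>A\<in>R. mean_cost v A) < \<gamma>"
proof -
  define S where "S = A0 \<union> \<Union>R"
  define \<omega> where "\<omega> A = (if A = A0 then 1 else \<gamma>)" for A
  define c where "c x = (\<Sum>A\<in>insert A0 R. if x \<in> A then \<omega> A / card A else 0)" for x
  have S: "S \<subseteq> V" "finite S" using A0 R finV finite_subset unfolding S_def by auto
  have \<omega>0: "\<omega> A \<ge> 0" for A using gamma unfolding \<omega>_def by auto
  have main: "(\<Sum>x\<in>S. c x * f x) = (\<Sum>A\<in>insert A0 R. \<omega> A * ((\<Sum>x\<in>A. f x) / card A))" for f :: "'a \<Rightarrow> real"
  proof -
    have "(\<Sum>x\<in>S. c x * f x) = (\<Sum>x\<in>S. \<Sum>A\<in>insert A0 R. (if x \<in> A then \<omega> A / card A * f x else 0))"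
      unfolding c_def by (simp add: sum_distrib_right if_distrib[of "\<lambda>t. t * _"] cong: if_cong)
    also have "\<dots> = (\<Sum>A\<in>insert A0 R. \<Sum>x\<in>S. (if x \<in> A then \<omega> A / card A * f x else 0))"
      by (rule sum.swap)
    also have "\<dots> = (\<Sum>A\<in>insert A0 R. \<omega> A * ((\<Sum>x\<in>A. f x) / card A))"
    proof (rule sum.cong[OF refl])
      fix A assume "A \<in> insert A0 R"
      then have "A \<subseteq> S" unfolding S_def by auto
      then have "S \<inter> {x. x \<in> A} = A" by auto
      then show "(\<Sum>x\<in>S. (if x \<in> A then \<omega> A / card A * f x else 0)) = \<omega> A * ((\<Sum>x\<in>A. f x) / card A)"
        using S(2) by (simp add: sum.If_cases sum_distrib_left sum_divide_distrib)
    qed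
    finally show ?thesis .
  qed
  have split: "(\<Sum>A\<in>insert A0 R. \<omega> A * g A) = g A0 + \<gamma> * (\<Sum>A\<in>R. g A)" for g :: "'a set \<Rightarrow> real"
  proof -
    have "(\<Sum>A\<in>R. \<omega> A * g A) = (\<Sum>A\<in>R. \<gamma> * g A)"
      using A0R by (intro sum.cong) (auto simp: \<omega>_def)
    then show ?thesis using R A0R by (simp add: \<omega>_def sum_distrib_left)
  qed
  have one: "(\<Sum>x\<in>A. (1::real)) / card A = 1" if "A \<in> insert A0 R" for A
  proof -
    have "A \<noteq> {}" "A \<subseteq> V" using that A0 R by auto
    then have "card A > 0" using finite_subset[OF _ finV] by (simp add: card_gt_0_iff)
    then show ?thesis by simp
  qed
  have "(\<Sum>x\<in>S. c x) = (\<Sum>A\<in>insert A0 R. \<omega> A * ((\<Sum>x\<in>A. 1) / card A))" using main[of "\<lambda>_. 1"] by simp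
  also have "\<dots> = (\<Sum>A\<in>insert A0 R. \<omega> A * 1)" by (intro sum.cong refl) (use one in auto)
  also have "\<dots> = 1 + (real r - 1) * \<gamma>" using split[of "\<lambda>_. 1"] R(2) r2 by (simp add: of_nat_diff)
  finally have tot: "(\<Sum>x\<in>S. c x) = 1 + (real r - 1) * \<gamma>" .
  have "c x \<ge> 0" for x unfolding c_def by (intro sum_nonneg) (use \<omega>0 in auto)
  from extend[OF S(1) _ this tot] card obtain v where v: "v \<in> V - S" "(\<Sum>x\<in>S. c x * cost {v, x}) < \<gamma>"
    unfolding S_def by blast
  have "(\<Sum>x\<in>S. c x * cost {v, x}) = mean_cost v A0 + \<gamma> * (\<Sum>A\<in>R. mean_cost v A)"
    unfolding main mean_cost_def by (rule split)
  then show ?thesis using v unfolding S_def by auto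
qed

lemma mean_cost_nonneg:
  assumes "v \<in> V - A" "A \<subseteq> V"
  shows "0 \<le> mean_cost v A"
  unfolding mean_cost_def using assms by (intro divide_nonneg_nonneg sum_nonneg cost_nonneg pair_in) auto

lemma mean_cost_ge:
  assumes "v \<in> V - A" "A \<subseteq> V" "B \<subseteq> A" "\<And>x. x \<in> B \<Longrightarrow> t x \<le> cost {v, x}"
  shows "(\<Sum>x\<in>B. t x) / card A \<le> mean_cost v A"
proof -
  have finA: "finite A" using assms finV finite_subset by blast
  have "(\<Sum>x\<in>B. t x) \<le> (\<Sum>x\<in>B. cost {v, x})" by (intro sum_mono assms(4))
  also have "\<dots> \<le> (\<Sum>x\<in>A. cost {v, x})"
    using assms finA by (intro sum_mono2) (auto intro!: cost_nonneg pair_in)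
  finally show ?thesis unfolding mean_cost_def by (simp add: divide_right_mono)
qed

lemma mean_cost_nonred:
  assumes "v \<in> V - A" "A \<subseteq> V" "B \<subseteq> A" "\<And>x. x \<in> B \<Longrightarrow> d {v, x} \<noteq> 1"
  shows "card B / card A \<le> mean_cost v A"
proof -
  have "(\<Sum>x\<in>B. (1::real)) / card A \<le> mean_cost v A"
    using assms by (intro mean_cost_ge cost_ge_1 pair_in) auto
  then show ?thesis by simp
qed

lemma ex_red_clique: "k \<le> r \<Longrightarrow> \<exists>K\<subseteq>V. card K = k \<and> (\<forall>e\<in>nsets K 2. d e = 1)"
proof (induction k)
  case 0
  have "nsets ({} :: 'a set) 2 = {}" by (rule nsets_eq_empty) simp_all
  then show ?case by (intro exI[of _ "{}"]) auto
next
  case (Suc k)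
  then obtain K where K: "K \<subseteq> V" "card K = k" "\<forall>e\<in>nsets K 2. d e = 1" by auto
  have finK: "finite K" using K finV finite_subset by blast
  obtain v where v: "v \<in> V - K" "(\<Sum>x\<in>K. d {v, x}) \<ge> int (card K)"
  proof (cases "K = {}")
    case True
    then show thesis using V_ne that by auto
  next
    case False
    have "card K \<le> 2 * r - 1" using K Suc.prems by simp
    from extend_uniform[OF K(1) False this] that K(2) Suc.prems show thesis by auto
  qed
  have le: "d {v, x} \<le> 1" if "x \<in> K" for x using v K that by (intro excess_le_1 pair_in) auto
  have "d {v, x} = 1" if x: "x \<in> K" for x
  proof (rule ccontr)
    assume "d {v, x} \<noteq> 1"
    then have "d {v, x} < 1" using le[OF x] by simp
    then have "(\<Sum>x\<in>K. d {v, x}) < (\<Sum>x\<in>K. 1)"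
      using le x finK by (intro sum_strict_mono_ex1) auto
    then show False using v(2) by simp
  qed
  moreover have "e \<in> nsets K 2 \<or> (\<exists>x\<in>K. e = {v, x})" if "e \<in> nsets (insert v K) 2" for e
    using that v unfolding nsets_def by (auto simp: card_2_iff)
  ultimately have "\<forall>e\<in>nsets (insert v K) 2. d e = 1" using K(3) by blast
  then show ?case using K v finK by (intro exI[of _ "insert v K"]) auto
qed

lemma config_card_Union:
  assumes "config \<P>"
  shows "card (\<Union>\<P>) = (\<Sum>A\<in>\<P>. card A)"
  using config_disjoint[OF assms] config_part_card[OF assms] by (intro card_Union_disjoint) auto

text \<open>
A new vertex supplied by \<open>extend_uniform\<close> misses a single unit of \<open>d\<close>. It cannot be red to a
vertex of every part, so the unit is lost on a whole part; this part is a single vertex, and the two form a pair.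
\<close>
lemma ex_pair_config:
  assumes "r \<le> k" "k < 2 * r"
  shows "\<exists>\<P>. config \<P> \<and> card \<P> = r \<and> card (\<Union>\<P>) = k \<and> (\<forall>A\<in>\<P>. card A \<le> 2)"
  using assms
proof (induction k rule: dec_induct)
  case base
  obtain K where K: "K \<subseteq> V" "card K = r" "\<forall>e\<in>nsets K 2. d e = 1" using ex_red_clique by blast
  have finK: "finite K" using K finV finite_subset by blast
  let ?P = "(\<lambda>x. {x}) ` K"
  have "config ?P"
  proof (rule configI)
    fix A B x z assume "A \<in> ?P" "B \<in> ?P" "A \<noteq> B" "x \<in> A" "z \<in> B"
    then have "{x, z} \<in> nsets K 2" by (auto simp: nsets_def card_insert_if)
    then show "d {x, z} = 1" using K by blast
  qed (use K finK in \<open>auto simp: pairwise_def disjnt_def\<close>)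
  moreover have "card ?P = r" using K by (simp add: card_image inj_on_def)
  ultimately show ?case using K by (intro exI[of _ ?P]) auto
next
  case (step k)
  then obtain \<P> where P: "config \<P>" "card \<P> = r" "card (\<Union>\<P>) = k" "\<forall>A\<in>\<P>. card A \<le> 2" by auto
  let ?S = "\<Union>\<P>"
  have SV: "?S \<subseteq> V" by (rule config_Union[OF P(1)])
  have finS: "finite ?S" using SV finV finite_subset by blast
  have "card ?S > 0" using P(3) step.hyps r2 by simp
  then have Sne: "?S \<noteq> {}" by (metis card.empty less_irrefl)
  have "card ?S \<le> 2 * r - 1" using P step by simp
  then obtain v where v: "v \<in> V - ?S" "(\<Sum>x\<in>?S. d {v, x}) \<ge> int k - 1"
  proof -
    have "\<not> card ?S < r" "card ?S \<le> 2 * r - 2" using P(3) step by auto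
    with extend_uniform[OF SV Sne \<open>card ?S \<le> 2 * r - 1\<close>] that P(3) show thesis by auto
  qed
  have le: "d {v, x} \<le> 1" if "x \<in> ?S" for x using v SV that by (intro excess_le_1 pair_in) auto
  obtain A where A: "A \<in> \<P>" "\<forall>x\<in>A. d {v, x} \<noteq> 1" using nonred_part[OF P(1,2) v(1)] by blast
  obtain s where s: "s \<in> A" using A config_part_card[OF P(1) A(1)] by (metis card_gt_0_iff ex_in_conv)
  have sS: "s \<in> ?S" using s A by auto
  have one: "(\<Sum>x\<in>?S. 1 - d {v, x}) \<le> 1" using v(2) P(3) by (simp add: sum_subtractf)
  have pos: "0 \<le> 1 - d {v, x}" if "x \<in> ?S" for x using le[OF that] by simp
  \<comment> \<open>All terms are nonnegative integers with sum at most 1, and the one at s is positive.\<close>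
  have le1: "1 - d {v, s} + (1 - d {v, x}) \<le> 1" if x: "x \<in> ?S" "x \<noteq> s" for x
  proof -
    have "(\<Sum>x\<in>{s, x}. 1 - d {v, x}) \<le> (\<Sum>x\<in>?S. 1 - d {v, x})"
      using x sS finS pos by (intro sum_mono2) auto
    then show ?thesis using one x by simp
  qed
  have ds1: "1 - d {v, s} \<ge> 1" using A(2) s le[OF sS] by fastforce
  have red: "d {v, x} = 1" if "x \<in> ?S" "x \<noteq> s" for x using le1[OF that] ds1 pos[OF that(1)] by linarith
  have "(\<Sum>x\<in>{s}. 1 - d {v, x}) \<le> (\<Sum>x\<in>?S. 1 - d {v, x})"
    using sS finS pos by (intro sum_mono2) auto
  then have ds: "d {v, s} = 0" using ds1 one by simp
  have As: "A = {s}"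
  proof -
    have "x = s" if "x \<in> A" for x using red[of x] A that by blast
    then show ?thesis using s by blast
  qed
  let ?P = "insert {v, s} (\<P> - {A})"
  have cfg: "config ?P"
  proof (rule config_insert)
    show "config (\<P> - {A})" by (rule config_subset[OF P(1)]) auto
    show "{v, s} \<noteq> {}" "{v, s} \<subseteq> V" using v sS SV by auto
    show "{v, s} \<inter> B = {}" if "B \<in> \<P> - {A}" for B
      using that v config_Int[OF P(1) A(1), of B] s by auto
    show "d {x, z} = 0" if "x \<in> {v, s}" "z \<in> {v, s}" "x \<noteq> z" for x z
      using that ds by (auto simp: insert_commute)
    show "d {x, z} = 1" if "x \<in> {v, s}" "B \<in> \<P> - {A}" "z \<in> B" for x z B
    proof (cases "x = v")
      case True
      have "z \<noteq> s" using that config_Int[OF P(1) A(1), of B] s by auto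
      then show ?thesis using True red[of z] that by auto
    next
      case False
      then show ?thesis using that config_red[OF P(1) A(1), of B s z] s by auto
    qed
  qed
  have vP: "{v, s} \<notin> \<P> - {A}" using v by auto
  have "v \<noteq> s" using v sS by auto
  have "card ?P = r" using vP P A config_finite[OF P(1)] r2 by simp
  moreover have "\<Union>?P = insert v ?S" using A As by auto
  then have "card (\<Union>?P) = Suc k" using v finS P by auto
  ultimately show ?case using cfg P(4) \<open>v \<noteq> s\<close>
    by (intro exI[of _ ?P]) (auto simp: card_insert_if)
qed

text \<open>
The structure that is grown: a single vertex \<open>u\<close>, in the role of class $0$ of the extremal pattern,
and a pair or a triple for each of the other classes.
\<close>
definition star_config :: "'a \<Rightarrow> 'a set set \<Rightarrow> bool" where
  "star_config u R \<longleftrightarrow> config (insert {u} R) \<and> {u} \<notin> R \<and> card R = r - 1 \<and>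
     (\<forall>A\<in>R. card A = 2 \<or> card A = 3)"

lemma ex_star_config: "\<exists>u R. star_config u R"
proof -
  obtain \<P> where P: "config \<P>" "card \<P> = r" "card (\<Union>\<P>) = 2 * r - 1" "\<forall>A\<in>\<P>. card A \<le> 2"
  proof -
    have "r \<le> 2 * r - 1" "2 * r - 1 < 2 * r" using r2 by auto
    from ex_pair_config[OF this] that show thesis by blast
  qed
  have fin: "finite \<P>" by (rule config_finite[OF P(1)])
  have c12: "card A = 1 \<or> card A = 2" if "A \<in> \<P>" for A
    using P(4) config_part_card[OF P(1) that] that by force
  let ?D = "{A\<in>\<P>. card A = 1}"
  have "(\<Sum>A\<in>\<P>. 2 - card A) = (\<Sum>A\<in>?D. 1)"
  proof (intro sum.mono_neutral_cong_right ballI)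
    show "2 - card A = 0" if "A \<in> \<P> - ?D" for A using that c12[of A] by auto
  qed (use fin in auto)
  moreover have "(\<Sum>A\<in>\<P>. 2 - card A) + (\<Sum>A\<in>\<P>. card A) = (\<Sum>A\<in>\<P>. 2)"
    unfolding sum.distrib[symmetric] using P(4) by (intro sum.cong) auto
  ultimately have "card ?D + (2 * r - 1) = 2 * r"
    using config_card_Union[OF P(1)] P(2,3) by simp
  then have "card ?D = 1" using r2 by simp
  then obtain U where U: "?D = {U}" by (auto simp: card_1_singleton_iff)
  then have "card U = 1" "U \<in> \<P>" by auto
  then obtain u where u: "U = {u}" by (auto simp: card_1_singleton_iff)
  let ?R = "\<P> - {{u}}"
  have "insert {u} ?R = \<P>" using \<open>U \<in> \<P>\<close> u by auto
  moreover have "card ?R = r - 1" using \<open>U \<in> \<P>\<close> u P(2) fin by simp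
  moreover have "card A = 2 \<or> card A = 3" if "A \<in> ?R" for A
  proof -
    have "A \<notin> ?D" using that U u by blast
    then show ?thesis using c12[of A] that by auto
  qed
  ultimately have "star_config u ?R" unfolding star_config_def using P(1) by simp
  then show ?thesis by blast
qed

lemma sum_mean_cost_ge:
  assumes "finite R" "\<Union>R \<subseteq> V" "v \<in> V - \<Union>R" "\<Q> \<subseteq> R"
  shows "(\<Sum>A\<in>\<Q>. mean_cost v A) \<le> (\<Sum>A\<in>R. mean_cost v A)"
  using assms by (intro sum_mono2) (auto intro!: mean_cost_nonneg)

text \<open>
Give weight $1$ to \<open>u\<close> and \<open>\<gamma>\<close> to each part. A vertex of cost below \<open>\<gamma>\<close> is not red to a vertex of
every part, and missing a part of \<open>R\<close> entirely, or \<open>d < 0\<close> at \<open>u\<close>, costs at least \<open>\<gamma>\<close>; hence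
\<open>d = 0\<close> at \<open>u\<close>. By \<open>doubled_config_false\<close> it then has at most one red neighbour in some part. For a
triple this costs at least $1 + 2\gamma/3$, which is not below \<open>\<gamma>\<close> because \<open>\<gamma>\<close> is at most $3$. So the part is a pair, and the
remaining budget allows no further defect.
\<close>
lemma star_branch:
  assumes "star_config u R"
  shows "\<exists>v A s s'. v \<in> V \<and> v \<noteq> u \<and> v \<notin> \<Union>R \<and> A \<in> R \<and> A = {s, s'} \<and> s \<noteq> s' \<and> d {v, u} = 0 \<and>
     d {v, s} = 0 \<and> d {v, s'} = 1 \<and> (\<forall>B\<in>R - {A}. \<forall>x\<in>B. d {v, x} = 1)"
proof -
  have cfg: "config (insert {u} R)" and uR: "{u} \<notin> R" and cardR: "card R = r - 1"
    and c23: "\<And>A. A \<in> R \<Longrightarrow> card A = 2 \<or> card A = 3"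
    using assms unfolding star_config_def by auto
  have finR: "finite R" using config_finite[OF cfg] by simp
  have cR: "config R" by (rule config_subset[OF cfg]) auto
  have UR: "\<Union>R \<subseteq> V" by (rule config_Union[OF cR])
  have uV: "u \<in> V" using config_Union[OF cfg] by auto
  have u_notin: "u \<notin> \<Union>R"
  proof
    assume "u \<in> \<Union>R"
    then obtain A where "A \<in> R" "u \<in> A" by auto
    then show False using config_Int[OF cfg, of "{u}" A] uR by auto
  qed
  have "card (\<Union>R) = (\<Sum>A\<in>R. card A)" by (rule config_card_Union[OF cR])
  also have "\<dots> \<le> (\<Sum>A\<in>R. 3)" using c23 by (intro sum_mono) fastforce
  finally have "card (\<Union>R) \<le> 3 * (r - 1)" using cardR by simp
  moreover have "card ({u} \<union> \<Union>R) \<le> card {u} + card (\<Union>R)" by (rule card_Un_le)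
  ultimately have "card ({u} \<union> \<Union>R) \<le> 3 * r" using r2 by simp
  then obtain v where v: "v \<in> V - ({u} \<union> \<Union>R)"
      "mean_cost v {u} + \<gamma> * (\<Sum>A\<in>R. mean_cost v A) < \<gamma>"
    using extend_family[of "{u}" R] uV finR cardR config_empty[OF cR] UR uR by auto
  have vR: "v \<in> V - \<Union>R" and vu: "v \<noteq> u" and vV: "v \<in> V" using v by auto
  have mu: "mean_cost v {u} = cost {v, u}" by (simp add: mean_cost_def)
  have vuV: "{v, u} \<in> nsets V 2" using vV uV vu by (rule pair_in)
  have sum0: "0 \<le> (\<Sum>A\<in>R. mean_cost v A)"
    using sum_mean_cost_ge[OF finR UR vR, of "{}"] by simp
  have gs0: "0 \<le> \<gamma> * (\<Sum>A\<in>R. mean_cost v A)" using sum0 gamma by simp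
  have part: "mean_cost v A < 1" if A: "A \<in> R" for A
  proof -
    have "mean_cost v A \<le> (\<Sum>A\<in>R. mean_cost v A)"
      using sum_mean_cost_ge[OF finR UR vR, of "{A}"] A by simp
    then have "\<gamma> * mean_cost v A \<le> \<gamma> * (\<Sum>A\<in>R. mean_cost v A)"
      using gamma by (intro mult_left_mono) auto
    then have "\<gamma> * mean_cost v A < \<gamma> * 1"
      using v(2) cost_nonneg[OF vuV] mu by linarith
    then show ?thesis using gamma by (simp only: mult_less_cancel_left_pos)
  qed
  have "\<exists>A\<in>insert {u} R. \<forall>x\<in>A. d {v, x} \<noteq> 1"
    using v uR finR cardR r2 by (intro nonred_part[OF cfg]) auto
  then have "d {v, u} \<noteq> 1"
  proof
    fix A assume A: "A \<in> insert {u} R" "\<forall>x\<in>A. d {v, x} \<noteq> 1"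
    have "A \<notin> R"
    proof
      assume AR: "A \<in> R"
      have "card A / card A \<le> mean_cost v A"
        using A AR vR UR by (intro mean_cost_nonred) auto
      then show False using part[OF AR] config_part_card[OF cR AR] by (auto split: if_splits)
    qed
    then show ?thesis using A by auto
  qed
  then have cu: "1 \<le> cost {v, u}" by (rule cost_ge_1[OF vuV])
  have du: "d {v, u} = 0"
  proof (rule ccontr)
    assume "d {v, u} \<noteq> 0"
    with \<open>d {v, u} \<noteq> 1\<close> have "d {v, u} < 0" using excess_le_1[OF vuV] by linarith
    then show False using cost_neg[OF vuV] v(2) gs0 mu by linarith
  qed
  have budget: "1 + \<gamma> * (\<Sum>A\<in>\<Q>. mean_cost v A) < \<gamma>" if "\<Q> \<subseteq> R" for \<Q>
  proof -
    have "\<gamma> * (\<Sum>A\<in>\<Q>. mean_cost v A) \<le> \<gamma> * (\<Sum>A\<in>R. mean_cost v A)"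
      using sum_mean_cost_ge[OF finR UR vR that] gamma by (intro mult_left_mono) auto
    then show ?thesis using v(2) cu mu by linarith
  qed
  have "\<exists>A\<in>R. \<not> (\<exists>x\<in>A. \<exists>z\<in>A. x \<noteq> z \<and> d {v, x} = 1 \<and> d {v, z} = 1)"
  proof (rule ccontr)
    assume "\<not> ?thesis"
    then have ex: "\<exists>x\<in>A. \<exists>z\<in>A. x \<noteq> z \<and> d {v, x} = 1 \<and> d {v, z} = 1" if "A \<in> R" for A
      using that by blast
    have ured: "d {u, x} = 1" if "A \<in> R" "x \<in> A" for A x
      using config_red[OF cfg, of "{u}" A u x] that uR by auto
    show False
    proof (rule doubled_config_false[OF cR cardR vR _ vu du])
      show "u \<in> V - \<Union>R" using uV u_notin by auto
      show "\<exists>x\<in>A. \<exists>z\<in>A. x \<noteq> z \<and> d {v, x} = 1 \<and> d {v, z} = 1 \<and> d {u, x} = 1 \<and> d {u, z} = 1"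
        if "A \<in> R" for A using ex[OF that] ured[OF that] by metis
    qed
  qed
  then obtain A where A: "A \<in> R" and few: "\<And>x z. x \<in> A \<Longrightarrow> z \<in> A \<Longrightarrow> x \<noteq> z \<Longrightarrow> d {v, x} = 1 \<Longrightarrow> d {v, z} \<noteq> 1"
    by auto
  have finA: "finite A" and AV: "A \<subseteq> V" using config_part_card[OF cR A] by auto
  have vA: "v \<in> V - A" using vR A by auto
  let ?N = "{x\<in>A. d {v, x} \<noteq> 1}"
  have "card (A - ?N) \<le> 1"
  proof (rule card_le_Suc0_iff_eq[THEN iffD2, folded One_nat_def])
    show "\<forall>x\<in>A - ?N. \<forall>z\<in>A - ?N. x = z" using few by blast
  qed (use finA in auto)
  then have N: "card ?N \<ge> card A - 1" using finA by (simp add: card_Diff_subset)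
  have mA: "card ?N / card A \<le> mean_cost v A"
    using vA AV by (intro mean_cost_nonred) auto
  have gA: "1 + \<gamma> * mean_cost v A < \<gamma>" using budget[of "{A}"] A by simp
  have "card A = 2"
  proof (rule ccontr)
    assume "card A \<noteq> 2"
    then have c3: "card A = 3" using c23[OF A] by auto
    then have "2 / 3 \<le> mean_cost v A" using N mA by simp
    then have "\<gamma> * (2 / 3) \<le> \<gamma> * mean_cost v A" using gamma by (intro mult_left_mono) auto
    then show False using gA gamma by linarith
  qed
  have "?N \<noteq> A"
  proof
    assume "?N = A"
    then have "1 \<le> mean_cost v A" using mA \<open>card A = 2\<close> by simp
    then show False using part[OF A] by simp
  qed
  then obtain s' where s': "s' \<in> A" "d {v, s'} = 1" by auto
  obtain s where s: "A = {s, s'}" "s \<noteq> s'"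
    using \<open>card A = 2\<close> s'(1) by (auto simp: card_2_iff)
  have sV: "{v, s} \<in> nsets V 2" using s vA AV by (intro pair_in) auto
  have ds1: "d {v, s} \<noteq> 1" using few[of s s'] s s' by auto
  have ds: "d {v, s} = 0"
  proof (rule ccontr)
    assume "d {v, s} \<noteq> 0"
    then have "d {v, s} < 0" using ds1 excess_le_1[OF sV] by linarith
    then have "\<gamma> \<le> cost {v, s}" by (rule cost_neg[OF sV])
    then have "(\<Sum>x\<in>{s}. \<gamma>) / card A \<le> mean_cost v A"
      using vA AV s by (intro mean_cost_ge) auto
    then have "\<gamma> / 2 \<le> mean_cost v A" using \<open>card A = 2\<close> by simp
    then have "\<gamma> * (\<gamma> / 2) \<le> \<gamma> * mean_cost v A" using gamma by (intro mult_left_mono) auto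
    then have "1 + \<gamma> * (\<gamma> / 2) < \<gamma>" using gA by linarith
    moreover have "0 \<le> (\<gamma> - 1)\<^sup>2" by simp
    ultimately show False by (simp add: power2_eq_square algebra_simps)
  qed
  have half: "1 / 2 \<le> mean_cost v A"
  proof -
    have "(\<Sum>x\<in>{s}. (1::real)) / card A \<le> mean_cost v A"
      using vA AV s cost_ge_1[OF sV ds1] by (intro mean_cost_ge) auto
    then show ?thesis using \<open>card A = 2\<close> by simp
  qed
  have "d {v, x} = 1" if B: "B \<in> R - {A}" "x \<in> B" for B x
  proof (rule ccontr)
    assume nr: "d {v, x} \<noteq> 1"
    have BR: "B \<in> R" using B by auto
    have BV: "B \<subseteq> V" "finite B" using config_part_card[OF cR BR] by auto
    have "card {x} / card B \<le> mean_cost v B"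
      using vR BR BV nr B by (intro mean_cost_nonred) auto
    moreover have "1 / 3 \<le> card {x} / card B" using c23[OF BR] by auto
    ultimately have "1 / 3 \<le> mean_cost v B" by linarith
    then have "5 / 6 \<le> (\<Sum>C\<in>{A, B}. mean_cost v C)" using half B(1) by (subst sum.insert) auto
    then have "\<gamma> * (5 / 6) \<le> \<gamma> * (\<Sum>C\<in>{A, B}. mean_cost v C)" using gamma by (intro mult_left_mono) auto
    then have "1 + \<gamma> * (5 / 6) < \<gamma>" using budget[of "{A, B}"] A BR by auto
    then show False using gamma by linarith
  qed
  then show ?thesis using vV vu vR A s ds du s' by (intro exI[of _ v] exI[of _ A] exI[of _ s] exI[of _ s']) auto
qed

text \<open>
The pairs \<open>ab\<close>, \<open>bc\<close>, \<open>ce\<close> form a red path and \<open>d = 0\<close> on the other three pairs of its vertices. Each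
inner vertex together with its two neighbours looks like \<open>u\<close> with a pair. The weights, $1$ spread over
the two ends and \<open>\<gamma>\<close> over the two inner vertices, are chosen such that a vertex red to \<open>b\<close> can only stay within the budget if
it has \<open>d = 0\<close> at \<open>a\<close>, \<open>c\<close> and \<open>e\<close> and is red to all of \<open>R\<close>; it then joins \<open>a\<close> and \<open>c\<close> in a triple of
vertices red to \<open>b\<close>.
\<close>
lemma path_extend:
  assumes cR: "config R" and cardR: "card R = r - 2"
    and c23: "\<And>A. A \<in> R \<Longrightarrow> card A = 2 \<or> card A = 3"
    and path: "{a, b, c, e} \<subseteq> V - \<Union>R" "distinct [a, b, c, e]"
    and red: "d {a, b} = 1" "d {b, c} = 1" "d {c, e} = 1"
    and zero: "d {a, c} = 0" "d {a, e} = 0" "d {b, e} = 0"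
    and redR: "\<And>A x z. A \<in> R \<Longrightarrow> x \<in> A \<Longrightarrow> z \<in> {a, b, c, e} \<Longrightarrow> d {z, x} = 1"
    and w: "w \<in> V - \<Union>R" "w \<notin> {a, b, c, e}"
    and wcost: "mean_cost w {a, e} + \<gamma> * mean_cost w {b, c} + \<gamma> * (\<Sum>A\<in>R. mean_cost w A) < \<gamma>"
    and wb: "d {w, b} = 1"
  shows "star_config b (insert {a, c, w} R)"
proof -
  have finR: "finite R" by (rule config_finite[OF cR])
  have UR: "\<Union>R \<subseteq> V" by (rule config_Union[OF cR])
  have wV: "{w, a} \<in> nsets V 2" "{w, b} \<in> nsets V 2" "{w, c} \<in> nsets V 2" "{w, e} \<in> nsets V 2"
    using w path by (auto intro!: pair_in)
  have mae: "mean_cost w {a, e} = (cost {w, a} + cost {w, e}) / 2"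
    and mbc: "mean_cost w {b, c} = (cost {w, b} + cost {w, c}) / 2"
    using path(2) by (simp_all add: mean_cost_def)
  have cb: "cost {w, b} = 0" by (rule cost1[OF wV(2) wb])
  define T where "T = (cost {w, a} + cost {w, e}) / 2 + \<gamma> * (cost {w, c} / 2)"
  have budget: "T + \<gamma> * (\<Sum>A\<in>\<Q>. mean_cost w A) < \<gamma>" if "\<Q> \<subseteq> R" for \<Q>
  proof -
    have "\<gamma> * (\<Sum>A\<in>\<Q>. mean_cost w A) \<le> \<gamma> * (\<Sum>A\<in>R. mean_cost w A)"
      using sum_mean_cost_ge[OF finR UR w(1) that] gamma by (intro mult_left_mono) auto
    then show ?thesis using wcost unfolding mae mbc cb T_def by simp
  qed
  have T0: "0 \<le> T" unfolding T_def
    using cost_nonneg[OF wV(1)] cost_nonneg[OF wV(3)] cost_nonneg[OF wV(4)] gamma by simp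
  have TG: "T < \<gamma>" using budget[of "{}"] by simp
  have part: "T + \<gamma> * t < \<gamma>" if "A \<in> R" "t \<le> mean_cost w A" for A t
  proof -
    have "\<gamma> * t \<le> \<gamma> * mean_cost w A" using that gamma by (intro mult_left_mono) auto
    then show ?thesis using budget[of "{A}"] that by simp
  qed
  have nonred: "T + \<gamma> * (card N / card A) < \<gamma>" if "A \<in> R" "N \<subseteq> A" "\<And>x. x \<in> N \<Longrightarrow> d {w, x} \<noteq> 1" for A N
    using that w UR by (intro part[OF that(1)] mean_cost_nonred) auto
  have hasred: "\<exists>x\<in>A. d {w, x} = 1" if A: "A \<in> R" for A
  proof (rule ccontr)
    assume "\<not> ?thesis"
    then have "T + \<gamma> * (card A / card A) < \<gamma>" using A by (intro nonred) auto
    then show False using T0 config_part_card[OF cR A] by (auto split: if_splits)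
  qed
  have no_edge: "d {w, z} \<noteq> 1" if z: "z \<in> {a, c}" for z
  proof
    assume wz: "d {w, z} = 1"
    have bz: "d {b, z} = 1" using z red(1,2) by (auto simp: insert_commute)
    have ne: "w \<noteq> b" "w \<noteq> z" "b \<noteq> z" using w z path(2) by auto
    show False
    proof (rule red_transversal_false[OF cR])
      show "{w, b, z} \<subseteq> V" "{w, b, z} \<inter> \<Union>R = {}" using w path z by auto
      show "card {w, b, z} + card R = Suc r" using ne cardR r2 by (simp add: card_insert_if)
      show "d f = 1" if "f \<in> nsets {w, b, z} 2" for f
      proof -
        obtain x y where "f = {x, y}" "x \<noteq> y" "x \<in> {w, b, z}" "y \<in> {w, b, z}"
          using \<open>f \<in> nsets {w, b, z} 2\<close> unfolding nsets_def by (auto simp: card_2_iff)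
        then show ?thesis using wb wz bz by (auto simp: insert_commute)
      qed
      show "\<exists>x\<in>A. \<forall>v\<in>{w, b, z}. d {v, x} = 1" if "A \<in> R" for A
      proof -
        obtain x where "x \<in> A" "d {w, x} = 1" using hasred[OF \<open>A \<in> R\<close>] by blast
        moreover have "d {b, x} = 1" "d {z, x} = 1" using redR[OF that \<open>x \<in> A\<close>] z by auto
        ultimately show ?thesis by blast
      qed
    qed
  qed
  have na: "d {w, a} \<noteq> 1" and nc: "d {w, c} \<noteq> 1" using no_edge by auto
  have ca: "1 \<le> cost {w, a}" and cc: "1 \<le> cost {w, c}" using cost_ge_1[OF wV(1) na] cost_ge_1[OF wV(3) nc] by auto
  have ce: "0 \<le> cost {w, e}" by (rule cost_nonneg[OF wV(4)])
  have "(cost {w, a} + cost {w, e}) / 2 + \<gamma> * (1 / 2) \<le> T"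
    unfolding T_def using cc gamma by (intro add_left_mono mult_left_mono) auto
  then have T1: "cost {w, a} + cost {w, e} + \<gamma> \<le> 2 * T" by argo
  have dc: "d {w, c} = 0"
  proof (rule ccontr)
    assume "d {w, c} \<noteq> 0"
    then have "\<gamma> \<le> cost {w, c}" using nc excess_le_1[OF wV(3)] by (intro cost_neg[OF wV(3)]) linarith
    then have "\<gamma> * (\<gamma> / 2) \<le> \<gamma> * (cost {w, c} / 2)" using gamma by (intro mult_left_mono) auto
    then have "1 / 2 + \<gamma> * (\<gamma> / 2) \<le> T" unfolding T_def using ca ce by (intro add_mono) auto
    then have "1 / 2 + \<gamma> * (\<gamma> / 2) < \<gamma>" using TG by (rule le_less_trans)
    moreover have "0 \<le> (\<gamma> - 1)\<^sup>2" by simp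
    ultimately show False by (simp add: power2_eq_square algebra_simps)
  qed
  have da: "d {w, a} = 0"
  proof (rule ccontr)
    assume "d {w, a} \<noteq> 0"
    then have "\<gamma> \<le> cost {w, a}" using na excess_le_1[OF wV(1)] by (intro cost_neg[OF wV(1)]) linarith
    then show False using TG ce T1 by linarith
  qed
  have we: "d {w, e} \<noteq> 1"
  proof
    assume we: "d {w, e} = 1"
    let ?R = "insert {b, e} R"
    have be: "{b, e} \<notin> R" using path by auto
    have "config ?R"
    proof (rule config_insert[OF cR])
      show "{b, e} \<noteq> {}" "{b, e} \<subseteq> V" "\<And>B. B \<in> R \<Longrightarrow> {b, e} \<inter> B = {}" using path by auto
      show "d {x, z} = 0" if "x \<in> {b, e}" "z \<in> {b, e}" "x \<noteq> z" for x z
        using that zero by (auto simp: insert_commute)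
      show "d {x, z} = 1" if "x \<in> {b, e}" "B \<in> R" "z \<in> B" for x z B
        using redR[OF that(2,3), of x] that by auto
    qed
    moreover have "card ?R = r - 1" using be finR cardR r2 by simp
    moreover have "w \<in> V - \<Union>?R" "c \<in> V - \<Union>?R" "w \<noteq> c" using w path by auto
    moreover have "\<exists>x\<in>A. \<exists>z\<in>A. x \<noteq> z \<and> d {w, x} = 1 \<and> d {w, z} = 1 \<and> d {c, x} = 1 \<and> d {c, z} = 1"
      if A: "A \<in> ?R" for A
    proof (cases "A = {b, e}")
      case True
      then show ?thesis using wb we red path(2)
        by (intro bexI[of _ b] bexI[of _ e]) (auto simp: insert_commute)
    next
      case False
      with A have AR: "A \<in> R" by simp
      have finA: "finite A" using config_part_card[OF cR AR] by simp
      let ?N = "{x\<in>A. d {w, x} \<noteq> 1}"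
      \<comment> \<open>With at most one red neighbour in A, at least half of the weight of A would be lost.\<close>
      have "\<not> card (A - ?N) \<le> Suc 0"
      proof
        assume "card (A - ?N) \<le> Suc 0"
        then have "card A \<le> 2 * card ?N"
          using c23[OF AR] finA by (auto simp: card_Diff_subset)
        then have "1 / 2 \<le> card ?N / card A" using c23[OF AR] by auto
        then have "\<gamma> * (1 / 2) \<le> \<gamma> * (card ?N / card A)" using gamma by (intro mult_left_mono) auto
        moreover have "T + \<gamma> * (card ?N / card A) < \<gamma>" using AR by (intro nonred) auto
        ultimately show False using ca ce T1 by linarith
      qed
      then obtain x z where xz: "x \<in> A - ?N" "z \<in> A - ?N" "x \<noteq> z"
        using card_le_Suc0_iff_eq[of "A - ?N"] finA by auto
      then have "d {c, x} = 1" "d {c, z} = 1" using redR[OF AR] by auto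
      then show ?thesis using xz by blast
    qed
    ultimately show False using doubled_config_false[of ?R w c] dc by blast
  qed
  then have ce1: "1 \<le> cost {w, e}" by (rule cost_ge_1[OF wV(4)])
  have wR: "d {w, x} = 1" if A: "A \<in> R" and x: "x \<in> A" for A x
  proof (rule ccontr)
    assume "d {w, x} \<noteq> 1"
    then have "T + \<gamma> * (card {x} / card A) < \<gamma>" using A x by (intro nonred) auto
    moreover have "\<gamma> * (1 / 3) \<le> \<gamma> * (card {x} / card A)"
      using gamma c23[OF A] by (intro mult_left_mono) auto
    ultimately show False using T1 ca ce1 gamma by linarith
  qed
  let ?A = "{a, c, w}"
  have "config (insert ?A R)"
  proof (rule config_insert[OF cR])
    show "?A \<noteq> {}" "?A \<subseteq> V" "\<And>B. B \<in> R \<Longrightarrow> ?A \<inter> B = {}" using path w by auto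
    show "d {x, z} = 0" if "x \<in> ?A" "z \<in> ?A" "x \<noteq> z" for x z
      using that zero da dc by (auto simp: insert_commute)
    show "d {x, z} = 1" if "x \<in> ?A" "B \<in> R" "z \<in> B" for x z B
      using that wR[OF that(2,3)] redR[OF that(2,3)] by auto
  qed
  then have "config (insert {b} (insert ?A R))"
  proof (rule config_insert)
    show "{b} \<noteq> {}" "{b} \<subseteq> V" "\<And>B. B \<in> insert ?A R \<Longrightarrow> {b} \<inter> B = {}" using path w by auto
    show "d {x, z} = 1" if "x \<in> {b}" "B \<in> insert ?A R" "z \<in> B" for x z B
      using that redR[of B z b] wb red by (auto simp: insert_commute)
  qed auto
  moreover have "?A \<notin> R" "{b} \<notin> insert ?A R" using path w by auto
  moreover have "card ?A = 3" using path(2) w by (auto simp: card_insert_if)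
  ultimately show ?thesis unfolding star_config_def using finR cardR r2 c23 by auto
qed

text \<open>
The vertex from \<open>star_branch\<close> completes \<open>u\<close> and the pair that it hits to the path of \<open>path_extend\<close>.
A vertex that is cheap for the path must be red to an inner vertex, since otherwise the inner pair
alone costs \<open>\<gamma>\<close>; the two inner vertices are exchanged by reversing the path.
\<close>
lemma star_grow:
  assumes "star_config u R"
  shows "\<exists>u' R'. star_config u' R' \<and> card (\<Union>R') = Suc (card (\<Union>R))"
proof -
  obtain v A s s' where v: "v \<in> V" "v \<noteq> u" "v \<notin> \<Union>R" and A: "A \<in> R" "A = {s, s'}" "s \<noteq> s'"
    and dv: "d {v, u} = 0" "d {v, s} = 0" "d {v, s'} = 1" and dvR: "\<forall>B\<in>R - {A}. \<forall>x\<in>B. d {v, x} = 1"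
    using star_branch[OF assms] by blast
  have cfg: "config (insert {u} R)" and uR: "{u} \<notin> R" and cardR: "card R = r - 1"
    and c23: "\<And>A. A \<in> R \<Longrightarrow> card A = 2 \<or> card A = 3"
    using assms unfolding star_config_def by auto
  have finR: "finite R" using config_finite[OF cfg] by simp
  let ?R = "R - {A}"
  have cR': "config ?R" by (rule config_subset[OF cfg]) auto
  have cR: "config R" by (rule config_subset[OF cfg]) auto
  have UR: "\<Union>R \<subseteq> V" "finite (\<Union>R)" using config_Union[OF cR] finite_subset[OF _ finV] by auto
  have uV: "u \<in> V" using config_Union[OF cfg] by auto
  have u_notin: "u \<notin> \<Union>R"
  proof
    assume "u \<in> \<Union>R"
    then obtain B where "B \<in> R" "u \<in> B" by auto
    then show False using config_Int[OF cfg, of "{u}" B] uR by auto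
  qed
  have us: "d {u, x} = 1" if "B \<in> R" "x \<in> B" for B x
    using config_red[OF cfg, of "{u}" B u x] that uR by auto
  have cardR': "card ?R = r - 2" using A finR cardR by simp
  have AU: "A \<inter> \<Union>?R = {}" using config_Int[OF cR A(1)] by auto
  have path: "{v, s', u, s} \<subseteq> V - \<Union>?R" "distinct [v, s', u, s]"
    using v uV u_notin A UR AU by auto
  have zero: "d {s', s} = 0" using config_zero[OF cR A(1), of s' s] A by auto
  have redR: "d {z, x} = 1" if "B \<in> ?R" "x \<in> B" "z \<in> {v, s', u, s}" for B x z
    using that dvR us[of B x] config_red[OF cR A(1), of B z x] A by auto
  have bound: "card ({v, s} \<union> \<Union>(insert {s', u} ?R)) \<le> 3 * r"
  proof -
    have "card (\<Union>?R) = (\<Sum>A\<in>?R. card A)" by (rule config_card_Union[OF cR'])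
    also have "\<dots> \<le> (\<Sum>A\<in>?R. 3)" using c23 by (intro sum_mono) fastforce
    finally have "card (\<Union>?R) \<le> 3 * (r - 2)" using cardR' by simp
    moreover have "{v, s} \<union> \<Union>(insert {s', u} ?R) = {v, s', u, s} \<union> \<Union>?R" by auto
    moreover have "card ({v, s', u, s} \<union> \<Union>?R) \<le> card {v, s', u, s} + card (\<Union>?R)" by (rule card_Un_le)
    moreover have "card {v, s', u, s} = 4" using path(2) by simp
    ultimately show ?thesis using r2 by simp
  qed
  have su: "{s', u} \<notin> ?R" using u_notin by auto
  have "\<exists>w\<in>V - ({v, s} \<union> \<Union>(insert {s', u} ?R)).
      mean_cost w {v, s} + \<gamma> * (\<Sum>A\<in>insert {s', u} ?R. mean_cost w A) < \<gamma>"
  proof (rule extend_family)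
    show "{v, s} \<subseteq> V" "\<Union>(insert {s', u} ?R) \<subseteq> V" using path(1) config_Union[OF cR'] by auto
    show "card (insert {s', u} ?R) = r - 1" using su finR cardR' r2 by simp
    show "{v, s} \<notin> insert {s', u} ?R" using path v by auto
    show "{} \<notin> insert {s', u} ?R" using config_empty[OF cR'] by auto
  qed (use finR bound in auto)
  then obtain w where w: "w \<in> V - ({v, s} \<union> \<Union>(insert {s', u} ?R))"
    and wc: "mean_cost w {v, s} + \<gamma> * (\<Sum>A\<in>insert {s', u} ?R. mean_cost w A) < \<gamma>" by blast
  have wcost: "mean_cost w {v, s} + \<gamma> * mean_cost w {s', u} + \<gamma> * (\<Sum>A\<in>?R. mean_cost w A) < \<gamma>"
    using wc su finR by (simp add: algebra_simps)
  have w': "w \<in> V - \<Union>?R" "w \<notin> {v, s', u, s}" using w by auto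
  have card_new: "card (\<Union>(insert B ?R)) = Suc (card (\<Union>R))"
    if "config (insert B ?R)" "B \<notin> ?R" "card B = 3" for B
  proof -
    have "card (\<Union>(insert B ?R)) = 3 + (\<Sum>A\<in>?R. card A)"
      using config_card_Union[OF that(1)] that finR by simp
    moreover have "card (\<Union>R) = 2 + (\<Sum>A\<in>?R. card A)"
      using config_card_Union[OF cR] A finR by (simp add: sum.remove[of R A])
    ultimately show ?thesis by simp
  qed
  have finish: "?thesis"
    if star: "star_config b (insert {x, z, w} ?R)" and xz: "x \<noteq> w" "z \<noteq> w" "x \<noteq> z" for b x z
  proof -
    have "config (insert {b} (insert {x, z, w} ?R))" using star by (simp only: star_config_def)
    then have "config (insert {x, z, w} ?R)" by (rule config_subset) (rule subset_insertI)
    moreover have "{x, z, w} \<notin> ?R" using w'(1) by blast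
    moreover have "card {x, z, w} = 3" using xz by simp
    ultimately have "card (\<Union>(insert {x, z, w} ?R)) = Suc (card (\<Union>R))" by (rule card_new)
    with star show ?thesis by (intro exI conjI)
  qed
  have "d {w, s'} = 1 \<or> d {w, u} = 1"
  proof (rule ccontr)
    assume n: "\<not> ?thesis"
    have "card {s', u} / card {s', u} \<le> mean_cost w {s', u}"
      using n w' path by (intro mean_cost_nonred) auto
    then have "1 \<le> mean_cost w {s', u}" using path(2) by simp
    then have "\<gamma> * 1 \<le> \<gamma> * mean_cost w {s', u}" using gamma by (intro mult_left_mono) auto
    moreover have "0 \<le> mean_cost w {v, s}" using w' path by (intro mean_cost_nonneg) auto
    moreover have "0 \<le> (\<Sum>A\<in>?R. mean_cost w A)"
      using sum_mean_cost_ge[of ?R w "{}"] finR config_Union[OF cR'] w' by simp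
    then have "0 \<le> \<gamma> * (\<Sum>A\<in>?R. mean_cost w A)" using gamma by simp
    ultimately show False using wcost by linarith
  qed
  then show ?thesis
  proof
    assume ws: "d {w, s'} = 1"
    have "star_config s' (insert {v, u, w} ?R)"
    proof (rule path_extend[OF cR' cardR' _ path(1) path(2) _ _ _ _ _ _ redR w' wcost ws])
      show "d {v, s'} = 1" "d {s', u} = 1" "d {u, s} = 1" "d {v, u} = 0" "d {v, s} = 0" "d {s', s} = 0"
        using dv zero us[OF A(1)] A by (auto simp: insert_commute)
    qed (use c23 in auto)
    then show ?thesis by (rule finish) (use path(2) w'(2) in auto)
  next
    assume wu: "d {w, u} = 1"
    have perm: "{s, u, s', v} = {v, s', u, s}" "{s, v} = {v, s}" "{u, s'} = {s', u}" by auto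
    have "star_config u (insert {s, s', w} ?R)"
    proof (rule path_extend[OF cR' cardR', where e = v])
      show "{s, u, s', v} \<subseteq> V - \<Union>?R" "distinct [s, u, s', v]" using path by auto
      show "d {s, u} = 1" "d {u, s'} = 1" "d {s', v} = 1" "d {s, s'} = 0" "d {s, v} = 0" "d {u, v} = 0"
        using dv zero us[OF A(1)] A by (auto simp: insert_commute)
      show "w \<in> V - \<Union>?R" "w \<notin> {s, u, s', v}" "d {w, u} = 1" using w' wu by auto
      show "mean_cost w {s, v} + \<gamma> * mean_cost w {u, s'} + \<gamma> * (\<Sum>A\<in>?R. mean_cost w A) < \<gamma>"
        unfolding perm(2,3) by (rule wcost)
      show "d {z, x} = 1" if "B \<in> ?R" "x \<in> B" "z \<in> {s, u, s', v}" for B x z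
        using redR[OF that(1,2), of z] that(3) by auto
    qed (use c23 in auto)
    then show ?thesis by (rule finish) (use path(2) w'(2) in auto)
  qed
qed

lemma impossible: False
proof -
  have "\<exists>u R. star_config u R \<and> j \<le> card (\<Union>R)" for j
  proof (induction j)
    case 0
    then show ?case using ex_star_config by blast
  next
    case (Suc j)
    then obtain u R where "star_config u R" "j \<le> card (\<Union>R)" by blast
    with star_grow[of u R] show ?case by (metis Suc_le_mono)
  qed
  then obtain u R where "star_config u R" "Suc (card V) \<le> card (\<Union>R)" by blast
  moreover have "\<Union>R \<subseteq> V"
    using config_Union[of "insert {u} R"] calculation(1) by (simp add: star_config_def)
  then have "card (\<Union>R) \<le> card V" by (rule card_mono[OF finV])
  ultimately show False by simp
qed

end
section \<open>The logarithmic constants\<close>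

text \<open>
The unit in which logarithms are measured: the loss from lowering the number of choices from $a+1$ to $a$.
\<close>
definition log_step :: "nat \<Rightarrow> real" where
  "log_step a = ln ((real a + 1) / real a)"

text \<open>
The loss from lowering the number of choices from $a+1$ to $a-1$, in units of \<open>log_step\<close>.
\<close>
definition log_ratio :: "nat \<Rightarrow> real" where
  "log_ratio a = ln ((real a + 1) / (real a - 1)) / log_step a"

text \<open>
The logarithm of the base in the theorem.
\<close>
definition growth :: "nat \<Rightarrow> nat \<Rightarrow> real" where
  "growth a r = (1 - x_star a r) / (real r - 1) * ln (real a)
     + (real r - 2 + x_star a r) / (real r - 1) * ln (real a + 1)"

lemma log_step_pos: "a \<ge> 2 \<Longrightarrow> 0 < log_step a"
  unfolding log_step_def by (intro ln_gt_zero) auto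

lemma log_step_eq: "a \<ge> 2 \<Longrightarrow> log_step a = ln (real a + 1) - ln (real a)"
  unfolding log_step_def by (simp add: ln_div)

lemma log_ratio_step: "a \<ge> 2 \<Longrightarrow> log_ratio a * log_step a = ln (real a + 1) - ln (real a - 1)"
  unfolding log_ratio_def using log_step_pos[of a] by (simp add: ln_div)

text \<open>
The upper bound amounts to $a^3 \le (a+1)^2(a-1)$, which holds from $a = 2$ on.
\<close>
lemma log_ratio_bounds:
  assumes "a \<ge> 2"
  shows "1 \<le> log_ratio a" "log_ratio a \<le> 3"
proof -
  have a: "real a \<ge> 2" using assms by simp
  have "log_step a \<le> log_ratio a * log_step a"
    unfolding log_ratio_step[OF assms] unfolding log_step_eq[OF assms] using a by simp
  then show "1 \<le> log_ratio a" using log_step_pos[OF assms] by simp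
  have "real a * (real a - 1) \<ge> 2 * (2 - 1)" using a by (intro mult_mono) auto
  then have "(real a) ^ 3 \<le> (real a + 1)\<^sup>2 * (real a - 1)"
    by (simp add: power2_eq_square power3_eq_cube algebra_simps)
  then have "ln ((real a) ^ 3) \<le> ln ((real a + 1)\<^sup>2 * (real a - 1))"
    using a by (intro ln_mono) auto
  then have "3 * ln (real a) \<le> 2 * ln (real a + 1) + ln (real a - 1)"
    using a by (simp add: ln_mult ln_realpow)
  then have "log_ratio a * log_step a \<le> 3 * log_step a"
    unfolding log_ratio_step[OF assms] unfolding log_step_eq[OF assms] by simp
  then show "log_ratio a \<le> 3" using log_step_pos[OF assms] by simp
qed

lemma x_star_eq:
  assumes "a \<ge> 2" "r \<ge> 2"
  shows "x_star a r * (1 + (real r - 1) * log_ratio a) = 1" "0 < x_star a r" "x_star a r < 1"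
proof -
  have a: "real a \<ge> 2" using assms by simp
  have r: "real r \<ge> 2" using assms by simp
  have "ln ((real a + 1) ^ r / ((real a - 1) ^ (r - 1) * real a))
      = real r * ln (real a + 1) - (real (r - 1) * ln (real a - 1) + ln (real a))"
    using a by (simp add: ln_div ln_mult ln_realpow)
  also have "real (r - 1) = real r - 1" using assms by (simp add: of_nat_diff)
  also have "real r * ln (real a + 1) - ((real r - 1) * ln (real a - 1) + ln (real a))
      = log_step a * (1 + (real r - 1) * log_ratio a)"
  proof -
    have "log_step a * (1 + (real r - 1) * log_ratio a) = log_step a + (real r - 1) * (log_ratio a * log_step a)"
      by (simp add: algebra_simps)
    then show ?thesis
      unfolding log_ratio_step[OF assms(1)] unfolding log_step_eq[OF assms(1)] by (simp add: algebra_simps)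
  qed
  finally have x: "x_star a r = log_step a / (log_step a * (1 + (real r - 1) * log_ratio a))"
    unfolding x_star_def log_step_def by simp
  have pos: "1 + (real r - 1) * log_ratio a > 1"
    using log_ratio_bounds(1)[OF assms(1)] r by simp
  then have x': "x_star a r = 1 / (1 + (real r - 1) * log_ratio a)"
    unfolding x using log_step_pos[OF assms(1)] by simp
  show "x_star a r * (1 + (real r - 1) * log_ratio a) = 1" "0 < x_star a r" "x_star a r < 1"
    unfolding x' using pos by simp_all
qed

text \<open>
The two right-hand sides are the mean logarithms of the number of choices at a vertex of class $0$ and at a vertex
of any other class of the extremal pattern; \<open>x_star\<close> is the proportion that makes them agree.
\<close>
lemma growth_eq:
  assumes "a \<ge> 2" "r \<ge> 2"
  shows "growth a r = ln (real a + 1) - x_star a r * log_ratio a * log_step a"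
    "growth a r = ln (real a + 1) - (1 - x_star a r) / (real r - 1) * log_step a"
proof -
  have r: "real r - 1 > 0" using assms by simp
  have eq: "growth a r * (real r - 1) = (1 - x_star a r) * ln (real a) + (real r - 2 + x_star a r) * ln (real a + 1)"
  proof -
    have "growth a r = ((1 - x_star a r) * ln (real a) + (real r - 2 + x_star a r) * ln (real a + 1)) / (real r - 1)"
      unfolding growth_def times_divide_eq_left by (rule add_divide_distrib[symmetric])
    then show ?thesis using r by simp
  qed
  have "growth a r * (real r - 1) = (ln (real a + 1) - (1 - x_star a r) / (real r - 1) * log_step a) * (real r - 1)"
    unfolding eq log_step_eq[OF assms(1)] using r by (simp add: field_simps)
  then show 1: "growth a r = ln (real a + 1) - (1 - x_star a r) / (real r - 1) * log_step a" using r by simp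
  have "x_star a r * log_ratio a = (1 - x_star a r) / (real r - 1)"
    using x_star_eq(1)[OF assms] r by (simp add: field_simps)
  then show "growth a r = ln (real a + 1) - x_star a r * log_ratio a * log_step a" using 1 by simp
qed

lemma growth_pos:
  assumes "a \<ge> 2" "r \<ge> 2"
  shows "0 < growth a r"
proof -
  have "(1 - x_star a r) / (real r - 1) * ln (real a) > 0"
    using assms x_star_eq[OF assms] by (intro mult_pos_pos divide_pos_pos) auto
  moreover have "(real r - 2 + x_star a r) / (real r - 1) * ln (real a + 1) > 0"
    using assms x_star_eq[OF assms] by (intro mult_pos_pos divide_pos_pos) auto
  ultimately show ?thesis unfolding growth_def by simp
qed

text \<open>
By concavity the logarithm lies below its chord from $a$ to $a+1$ at all integers, since none of
them is inside the interval.
\<close>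
lemma ln_below_chord:
  assumes a: "a \<ge> 2" and u: "u \<ge> 1"
  shows "ln (real u) \<le> ln (real a) + (real u - real a) * log_step a"
proof (cases "a \<le> u")
  case True
  then show ?thesis
  proof (induction u rule: dec_induct)
    case (step k)
    have "(real k + 1) / real k \<le> (real a + 1) / real a"
      using step a by (simp add: field_simps)
    then have "ln ((real k + 1) / real k) \<le> log_step a"
      unfolding log_step_def using step a by (intro ln_mono) auto
    then have "ln (real k + 1) - ln (real k) \<le> log_step a" using step a by (simp add: ln_div)
    then show ?case using step.IH by (simp add: algebra_simps)
  qed simp
next
  case False
  then have "u \<le> a" by simp
  from this u show ?thesis
  proof (induction u rule: inc_induct)
    case (step k)
    have "(real a + 1) / real a \<le> (real k + 1) / real k"
      using step a by (simp add: field_simps)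
    then have "log_step a \<le> ln ((real k + 1) / real k)"
      unfolding log_step_def using step a by (intro ln_mono) auto
    then have "log_step a \<le> ln (real k + 1) - ln (real k)" using step by (simp add: ln_div)
    moreover have "ln (real (Suc k)) \<le> ln (real a) + (real (Suc k) - real a) * log_step a"
      using step by simp
    ultimately show ?case by (simp add: algebra_simps)
  qed simp
qed

section \<open>The largest product of a graph in the family\<close>

text \<open>
The bound of the theorem with the Turan number evaluated by \<open>turan_number_double\<close>.
\<close>
abbreviation sum_bound :: "nat \<Rightarrow> nat \<Rightarrow> nat" where
  "sum_bound a r \<equiv> (a - 1) * (2 * r choose 2) + 2 * r * (r - 1) - 1"

abbreviation log_degree :: "('a set \<Rightarrow> nat) \<Rightarrow> 'a set \<Rightarrow> 'a \<Rightarrow> real" where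
  "log_degree w V v \<equiv> (\<Sum>x\<in>V - {v}. ln (real (w {v, x}) + 1))"

text \<open>
If all logarithmic degrees are larger, then weighting the vertices of \<open>S\<close> and averaging over the
vertices outside gives one whose weighted logarithm exceeds \<open>growth a r\<close>; this is the condition
\<open>extend\<close> of \<open>dense_excess\<close>, because $\ln(a+1)$ exceeds \<open>growth a r\<close> by the product of \<open>x_star\<close>, \<open>log_ratio\<close>
and \<open>log_step\<close>. The additive constant pays for the pairs inside \<open>S\<close>, which has at most $3r$ vertices.
\<close>
lemma ex_small_log_degree:
  fixes V :: "'a set"
  assumes ar: "a \<ge> 2" "r \<ge> 2" and V: "finite V" "2 * r \<le> card V"
    and sq: "sq_graph (2 * r) (sum_bound a r) V w"
  shows "\<exists>v\<in>V. log_degree w V v \<le> growth a r * card V + 3 * real r * ln (real (sum_bound a r) + 1)"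
proof (rule ccontr)
  assume "\<not> ?thesis"
  then have deg: "log_degree w V v > growth a r * card V + 3 * real r * ln (real (sum_bound a r) + 1)" if "v \<in> V" for v
    using that by force
  let ?U = "ln (real (sum_bound a r) + 1)"
  let ?L = "log_step a" and ?g = "log_ratio a" and ?\<Lambda> = "growth a r" and ?x = "x_star a r"
  have L0: "?L > 0" by (rule log_step_pos[OF ar(1)])
  define d where "d e = int (w e) - (int a - 1)" for e
  define cost where "cost e = (ln (real a + 1) - ln (real (w e) + 1)) / ?L" for e
  have ln_le: "ln (real (w e) + 1) \<le> ?U" if "e \<in> nsets V 2" for e
    using sq_graph_le[OF sq _ V(1,2) that] ar by (intro ln_mono) auto
  have lin: "1 - real_of_int (d e) \<le> cost e" for e
  proof -
    have "ln (real (w e + 1)) \<le> ln (real a) + (real (w e + 1) - real a) * ?L"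
      by (intro ln_below_chord ar) auto
    then have "(1 - real_of_int (d e)) * ?L \<le> ln (real a + 1) - ln (real (w e) + 1)"
      unfolding d_def log_step_eq[OF ar(1)] by (simp add: algebra_simps)
    then show ?thesis unfolding cost_def using L0 by (simp add: pos_le_divide_eq)
  qed
  have "dense_excess V d cost r ?g"
  proof
    show "2 \<le> r" "finite V" "V \<noteq> {}" "1 \<le> ?g" "?g \<le> 3" using ar V log_ratio_bounds[OF ar(1)] by auto
  next
    fix X assume X: "X \<in> nsets V (2 * r)"
    then have cX: "card X = 2 * r" "finite X" by (auto simp: nsets_def)
    have "(\<Sum>e\<in>nsets X 2. w e) \<le> sum_bound a r" using sq X unfolding sq_graph_def by auto
    moreover have "2 * r * (r - 1) > 0" using ar by simp
    ultimately have "(\<Sum>e\<in>nsets X 2. w e) < (a - 1) * (2 * r choose 2) + 2 * r * (r - 1)" by linarith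
    then have "int (\<Sum>e\<in>nsets X 2. w e) < int ((a - 1) * (2 * r choose 2) + 2 * r * (r - 1))"
      by (simp only: of_nat_less_iff)
    also have "\<dots> = (int a - 1) * int (2 * r choose 2) + 2 * int r * (int r - 1)"
      using ar by (simp add: of_nat_diff)
    finally show "(\<Sum>e\<in>nsets X 2. d e) < 2 * int r * (int r - 1)"
      unfolding d_def using cX by (simp add: sum_subtractf card_nsets2 mult.commute)
  next
    fix e assume "d e = 1"
    then have "w e = a" unfolding d_def by simp
    then show "cost e = 0" unfolding cost_def by simp
  next
    fix e assume "d e = 0"
    then have "real (w e) + 1 = real a" unfolding d_def by linarith
    then show "cost e = 1" unfolding cost_def using L0 log_step_eq[OF ar(1)] by simp
  next
    fix e assume "d e < 0"
    then have "real (w e) + 1 \<le> real a - 1" unfolding d_def by linarith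
    then have "ln (real (w e) + 1) \<le> ln (real a - 1)" by (intro ln_mono) auto
    then have "?g * ?L \<le> ln (real a + 1) - ln (real (w e) + 1)" unfolding log_ratio_step[OF ar(1)] by simp
    then show "?g \<le> cost e" unfolding cost_def using L0 by (simp add: pos_le_divide_eq)
  next
    fix e show "1 - real_of_int (d e) \<le> cost e" by (rule lin)
  next
    fix S :: "'a set" and c :: "'a \<Rightarrow> real"
    assume S: "S \<subseteq> V" "card S \<le> 3 * r" and c0: "\<And>x. x \<in> S \<Longrightarrow> 0 \<le> c x"
      and c1: "(\<Sum>x\<in>S. c x) = 1 + (real r - 1) * ?g"
    let ?W = "1 + (real r - 1) * ?g"
    have xW: "?x * ?W = 1" by (rule x_star_eq(1)[OF ar])
    have W0: "?W > 0" using log_ratio_bounds(1)[OF ar(1)] ar by (intro add_pos_nonneg) auto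
    have finS: "finite S" using S V finite_subset by blast
    let ?f = "\<lambda>v x. ln (real (w {v, x}) + 1)"
    have out: "(\<Sum>v\<in>V - S. ?f v x) > ?\<Lambda> * card V" if x: "x \<in> S" for x
    proof -
      have "V - {x} = (V - S) \<union> (S - {x})" using S x by auto
      then have "log_degree w V x = (\<Sum>v\<in>V - S. ?f x v) + (\<Sum>v\<in>S - {x}. ?f x v)"
        using V(1) finS by (simp only:) (intro sum.union_disjoint, auto)
      moreover have "(\<Sum>v\<in>S - {x}. ?f x v) \<le> (\<Sum>v\<in>S - {x}. ?U)"
        using x S V(1) by (intro sum_mono ln_le) (auto simp: nsets_def card_insert_if)
      moreover have "(\<Sum>v\<in>S - {x}. ?U) \<le> 3 * real r * ?U"
      proof -
        have "card (S - {x}) \<le> 3 * r" using S(2) card_mono[OF finS, of "S - {x}"] by auto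
        then have "real (card (S - {x})) \<le> real (3 * r)" by (simp only: of_nat_le_iff)
        then have "real (card (S - {x})) * ?U \<le> real (3 * r) * ?U" by (intro mult_right_mono) auto
        then show ?thesis by simp
      qed
      ultimately have "(\<Sum>v\<in>V - S. ?f x v) > ?\<Lambda> * card V" using deg[of x] x S by force
      then show ?thesis by (simp add: insert_commute)
    qed
    have Sne: "S \<noteq> {}" using c1 W0 by auto
    have "\<exists>x\<in>S. c x > 0"
    proof (rule ccontr)
      assume "\<not> ?thesis"
      then have "(\<Sum>x\<in>S. c x) \<le> 0" by (intro sum_nonpos) force
      then show False using c1 W0 by simp
    qed
    then obtain x0 where x0: "x0 \<in> S" "c x0 > 0" by blast
    have "(\<Sum>x\<in>S. c x * (?\<Lambda> * card V)) < (\<Sum>x\<in>S. c x * (\<Sum>v\<in>V - S. ?f v x))"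
    proof (rule sum_strict_mono_ex1[OF finS])
      show "\<forall>x\<in>S. c x * (?\<Lambda> * card V) \<le> c x * (\<Sum>v\<in>V - S. ?f v x)"
        by (intro ballI mult_left_mono less_imp_le[OF out] c0)
      show "\<exists>x\<in>S. c x * (?\<Lambda> * card V) < c x * (\<Sum>v\<in>V - S. ?f v x)"
        using x0 out by (auto intro!: mult_strict_left_mono)
    qed
    also have "\<dots> = (\<Sum>v\<in>V - S. \<Sum>x\<in>S. c x * ?f v x)"
      by (simp only: sum_distrib_left) (rule sum.swap)
    finally have big: "?W * (?\<Lambda> * card V) < (\<Sum>v\<in>V - S. \<Sum>x\<in>S. c x * ?f v x)"
      by (simp add: sum_distrib_right[symmetric] c1)
    have "\<exists>v\<in>V - S. (\<Sum>x\<in>S. c x * ?f v x) > ?W * ?\<Lambda>"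
    proof (rule ccontr)
      assume "\<not> ?thesis"
      then have "(\<Sum>v\<in>V - S. \<Sum>x\<in>S. c x * ?f v x) \<le> (\<Sum>v\<in>V - S. ?W * ?\<Lambda>)"
        by (intro sum_mono) force
      also have "\<dots> = real (card (V - S)) * (?W * ?\<Lambda>)" by simp
      also have "\<dots> \<le> real (card V) * (?W * ?\<Lambda>)"
        using W0 growth_pos[OF ar] V(1) by (intro mult_right_mono) (auto simp: card_mono)
      finally show False using big by (simp add: mult_ac)
    qed
    then obtain v where v: "v \<in> V - S" "(\<Sum>x\<in>S. c x * ?f v x) > ?W * ?\<Lambda>" by blast
    have "(\<Sum>x\<in>S. c x * cost {v, x}) * ?L = (\<Sum>x\<in>S. c x * (ln (real a + 1) - ?f v x))"
      unfolding sum_distrib_right cost_def using L0 by simp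
    also have "\<dots> = ?W * ln (real a + 1) - (\<Sum>x\<in>S. c x * ?f v x)"
      by (simp add: right_diff_distrib sum_subtractf sum_distrib_right[symmetric] c1)
    also have "\<dots> < ?W * (ln (real a + 1) - ?\<Lambda>)" using v(2) by (simp add: right_diff_distrib)
    also have "\<dots> = (?x * ?W) * ?g * ?L" unfolding growth_eq(1)[OF ar] by (simp add: mult_ac)
    finally have "(\<Sum>x\<in>S. c x * cost {v, x}) * ?L < ?g * ?L" unfolding xW by simp
    then have "(\<Sum>x\<in>S. c x * cost {v, x}) < ?g" using L0 by (simp add: mult_less_cancel_right_pos)
    then show "\<exists>v\<in>V - S. (\<Sum>x\<in>S. c x * cost {v, x}) < ?g" using v by blast
  qed
  then show False by (rule dense_excess.impossible)
qed

lemma log_product_bound: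
  fixes V :: "'a set"
  assumes ar: "a \<ge> 2" "r \<ge> 2" and V: "finite V" "2 * r \<le> card V"
    and sq: "sq_graph (2 * r) (sum_bound a r) V w"
  shows "(\<Sum>e\<in>nsets V 2. ln (real (w e) + 1))
    \<le> growth a r * (card V choose 2) + (growth a r + 3 * real r * ln (real (sum_bound a r) + 1)) * card V"
proof -
  define u where "u = ln (real (sum_bound a r) + 1)"
  let ?C = "growth a r + 3 * real r * u"
  have "(\<Sum>e\<in>nsets V 2. ln (real (w e) + 1)) \<le> growth a r * (m choose 2) + ?C * m"
    if "2 * r \<le> m" "finite V" "card V = m" "sq_graph (2 * r) (sum_bound a r) V w" for m and V :: "'a set"
    using that
  proof (induction m arbitrary: V rule: dec_induct)
    case base
    have "(\<Sum>e\<in>nsets V 2. ln (real (w e) + 1)) \<le> (\<Sum>e\<in>nsets V 2. u)"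
      using sq_graph_le[OF base(3) _ base(1)] base ar unfolding u_def by (intro sum_mono ln_mono) auto
    also have "\<dots> = real (2 * r choose 2) * u"
      using base by (simp add: card_nsets2)
    also have "\<dots> \<le> real (3 * r * (2 * r)) * u"
    proof (rule mult_right_mono)
      have "2 * r choose 2 \<le> 2 * r * (2 * r - 1)" unfolding choose_two by (rule div_le_dividend)
      also have "\<dots> \<le> 3 * r * (2 * r)" by (intro mult_le_mono) auto
      finally show "real (2 * r choose 2) \<le> real (3 * r * (2 * r))" by (simp only: of_nat_le_iff)
    qed (simp add: u_def)
    also have "\<dots> \<le> growth a r * (2 * r choose 2) + ?C * real (2 * r)"
    proof -
      have "0 \<le> growth a r * (2 * r choose 2)" "0 \<le> growth a r * real (2 * r)"
        using growth_pos[OF ar] by simp_all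
      then show ?thesis by (simp add: algebra_simps)
    qed
    finally show ?case .
  next
    case (step m)
    obtain v where v: "v \<in> V" "log_degree w V v \<le> growth a r * card V + 3 * real r * u"
      using ex_small_log_degree[OF ar step.prems(1) _ step.prems(3)] step unfolding u_def by auto
    let ?V = "V - {v}"
    have IH: "(\<Sum>e\<in>nsets ?V 2. ln (real (w e) + 1)) \<le> growth a r * (m choose 2) + ?C * m"
      using step.prems v by (intro step.IH sq_graph_mono[OF step.prems(3)]) auto
    have ins: "insert v ?V = V" using v by auto
    have "(\<Sum>e\<in>nsets V 2. ln (real (w e) + 1)) = (\<Sum>e\<in>nsets ?V 2. ln (real (w e) + 1)) + log_degree w V v"
      using sum_nsets_insert[of ?V v "\<lambda>e. ln (real (w e) + 1)"] step.prems(1) unfolding ins by simp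
    also have "\<dots> \<le> growth a r * (m choose 2) + ?C * m + (growth a r * Suc m + 3 * real r * u)"
      using IH v(2) step.prems(2) by simp
    also have "\<dots> = growth a r * (Suc m choose 2) + ?C * Suc m"
    proof -
      have "Suc m choose 2 = m + (m choose 2)" by (simp add: numeral_2_eq_2)
      then show ?thesis by (simp add: algebra_simps)
    qed
    finally show ?case .
  qed
  from this[OF V(2,1) refl sq] show ?thesis unfolding u_def .
qed
section \<open>Strong concavity of the entropy function\<close>

definition entropy_term :: "real \<Rightarrow> real" where
  "entropy_term p = - p * ln p"

lemma entropy_term_0 [simp]: "entropy_term 0 = 0" by (simp add: entropy_term_def)

text \<open>
The function $-x \ln x + x^2/2$ is concave on the unit interval, so the tangent at \<open>x\<close> lies above the entropy
function with a quadratic gap. The gap turns a small loss of entropy into closeness of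
conditional probabilities.
\<close>
lemma entropy_term_strong_concave:
  assumes "0 < x" "x \<le> 1" "0 \<le> z" "z \<le> 1"
  shows "entropy_term z + (z - x)\<^sup>2 / 2 \<le> entropy_term x - (ln x + 1) * (z - x)"
proof -
  define f where "f s = - s * ln s + (s - x)\<^sup>2 / 2 + (ln x + 1) * (s - x)" for s :: real
  have deriv: "(f has_real_derivative (ln x - ln s + (s - x))) (at s)" if "0 < s" for s
    unfolding f_def using that by (auto intro!: derivative_eq_intros simp: field_simps)
  have lnd: "ln v - ln u \<ge> v - u" if "0 < u" "u \<le> v" "v \<le> 1" for u v :: real
  proof -
    have "ln (u / v) \<le> u / v - 1" using that by (intro ln_le_minus_one) auto
    then have "ln v - ln u \<ge> (v - u) / v" using that by (simp add: ln_div field_simps)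
    moreover have "(v - u) / v \<ge> v - u" using that by (simp add: pos_le_divide_eq mult_left_le)
    ultimately show ?thesis by simp
  qed
  have main: "f z \<le> f x" if z: "0 < z"
  proof (cases "z \<le> x")
    case True
    show ?thesis
    proof (rule DERIV_nonneg_imp_nondecreasing[OF True])
      fix s assume s: "z \<le> s" "s \<le> x"
      then show "\<exists>y. (f has_real_derivative y) (at s) \<and> 0 \<le> y"
        using deriv[of s] lnd[of s x] z assms by (intro exI[of _ "ln x - ln s + (s - x)"]) auto
    qed
  next
    case False
    then have "x \<le> z" by simp
    then show ?thesis
    proof (rule DERIV_nonpos_imp_nonincreasing)
      fix s assume s: "x \<le> s" "s \<le> z"
      then show "\<exists>y. (f has_real_derivative y) (at s) \<and> y \<le> 0"
        using deriv[of s] lnd[of x s] assms by (intro exI[of _ "ln x - ln s + (s - x)"]) auto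
    qed
  qed
  have "f z \<le> f x"
  proof (cases "z = 0")
    case True
    have "x\<^sup>2 \<le> x * 2" using assms by (simp add: power2_eq_square)
    then show ?thesis using True unfolding f_def by (simp add: algebra_simps power2_eq_square)
  qed (use main assms in auto)
  then show ?thesis unfolding f_def entropy_term_def by (simp add: algebra_simps)
qed

text \<open>
Summed over \<open>c\<close> values, the right-hand side gives the bound by the logarithm of the number of values,
also when only part of the probability is spent on them.
\<close>
lemma entropy_term_le:
  assumes "0 \<le> p" "0 < c"
  shows "entropy_term p \<le> p * ln c + 1 / c - p"
proof (cases "p = 0")
  case False
  then have p: "p > 0" using assms by simp
  have "ln (1 / (p * c)) \<le> 1 / (p * c) - 1" using p assms by (intro ln_le_minus_one) auto
  then have "p * ln (1 / (p * c)) \<le> p * (1 / (p * c) - 1)" using p by (intro mult_left_mono) auto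
  also have "p * (1 / (p * c) - 1) = 1 / c - p" using p assms by (simp add: right_diff_distrib)
  finally show ?thesis unfolding entropy_term_def using p assms by (simp add: ln_div ln_mult algebra_simps)
qed (use assms in auto)

lemma entropy_term_le_sqrt:
  assumes "0 \<le> p"
  shows "entropy_term p \<le> 2 * sqrt p"
proof (cases "p = 0")
  case False
  then have p: "p > 0" using assms by simp
  have "ln (1 / sqrt p) \<le> 1 / sqrt p - 1" using p by (intro ln_le_minus_one) auto
  then have "- ln p \<le> 2 / sqrt p" using p by (simp add: ln_div ln_sqrt)
  then have "p * (- ln p) \<le> p * (2 / sqrt p)" using p by (intro mult_left_mono) auto
  also have "p * (2 / sqrt p) = 2 * sqrt p" using p by (simp add: field_simps)
  finally show ?thesis unfolding entropy_term_def by simp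
qed auto

section \<open>Conditional entropy in a finite family of assignments\<close>

text \<open>
A finite family of assignments of numbers up to \<open>q\<close> to the elements of \<open>U\<close>, regarded as a uniformly
random assignment. Conditioning on the values on \<open>E\<close> is done through the class of all members that
agree with a given one on \<open>E\<close>.
\<close>
locale finite_assignments =
  fixes F :: "('e \<Rightarrow> nat) set" and U :: "'e set" and q :: nat
  assumes finF: "finite F" and F_ne: "F \<noteq> {}" and finU: "finite U"
    and bounded: "w \<in> F \<Longrightarrow> e \<in> U \<Longrightarrow> w e \<le> q"
    and determined: "w \<in> F \<Longrightarrow> w' \<in> F \<Longrightarrow> (\<And>e. e \<in> U \<Longrightarrow> w e = w' e) \<Longrightarrow> w = w'"
begin

definition cls :: "'e set \<Rightarrow> ('e \<Rightarrow> nat) \<Rightarrow> ('e \<Rightarrow> nat) set" where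
  "cls E w = {w' \<in> F. \<forall>e\<in>E. w' e = w e}"

definition prob :: "'e set \<Rightarrow> 'e \<Rightarrow> nat \<Rightarrow> ('e \<Rightarrow> nat) \<Rightarrow> real" where
  "prob E e v w = card {w' \<in> cls E w. w' e = v} / card (cls E w)"

definition entropy :: "'e set \<Rightarrow> 'e \<Rightarrow> real" where
  "entropy E e = (\<Sum>w\<in>F. \<Sum>v\<le>q. entropy_term (prob E e v w)) / card F"

lemma cls_refl: "w \<in> F \<Longrightarrow> w \<in> cls E w"
  by (simp add: cls_def)

lemma cls_subset: "cls E w \<subseteq> F"
  by (auto simp: cls_def)

lemma finite_cls [simp]: "finite (cls E w)"
  using finite_subset[OF cls_subset finF] .

lemma cls_pos: "w \<in> F \<Longrightarrow> 0 < card (cls E w)"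
  using cls_refl by (auto simp: card_gt_0_iff)

lemma cls_eq: "w' \<in> cls E w \<Longrightarrow> cls E w' = cls E w"
  unfolding cls_def by auto

lemma cls_sym: "w \<in> F \<Longrightarrow> w' \<in> cls E w \<Longrightarrow> w \<in> cls E w'"
  unfolding cls_def by auto

lemma cls_mono: "E \<subseteq> E' \<Longrightarrow> cls E' w \<subseteq> cls E w"
  unfolding cls_def by auto

lemma prob_cong: "w' \<in> cls E w \<Longrightarrow> prob E e v w' = prob E e v w"
  unfolding prob_def by (simp add: cls_eq)

lemma prob_nonneg: "0 \<le> prob E e v w"
  unfolding prob_def by simp

lemma prob_le_1: "prob E e v w \<le> 1"
proof (cases "card (cls E w) = 0")
  case False
  moreover have "card {w' \<in> cls E w. w' e = v} \<le> card (cls E w)" by (intro card_mono) auto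
  ultimately show ?thesis unfolding prob_def by (simp add: divide_le_eq)
qed (simp add: prob_def)

lemma cardF: "0 < card F"
  using F_ne finF by (simp add: card_gt_0_iff)

lemma sum_prob:
  assumes "w \<in> F" "e \<in> U"
  shows "(\<Sum>v\<le>q. prob E e v w) = 1"
proof -
  have "(\<Sum>v\<le>q. card {w' \<in> cls E w. w' e = v}) = card (\<Union>v\<le>q. {w' \<in> cls E w. w' e = v})"
    by (subst card_UN_disjoint) auto
  also have "(\<Union>v\<le>q. {w' \<in> cls E w. w' e = v}) = cls E w"
    using bounded[OF subsetD[OF cls_subset] assms(2)] by auto
  finally have "(\<Sum>v\<le>q. real (card {w' \<in> cls E w. w' e = v})) = card (cls E w)"
    by (simp flip: of_nat_sum)
  then show ?thesis
    unfolding prob_def using cls_pos[OF assms(1), of E]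
    by (auto simp: sum_divide_distrib[symmetric] card_gt_0_iff)
qed

text \<open>
The law of total expectation: every member is counted in its own class with total weight one.
\<close>
lemma sum_cond_mean:
  fixes \<phi> :: "('e \<Rightarrow> nat) \<Rightarrow> real"
  shows "(\<Sum>w\<in>F. (\<Sum>w'\<in>cls E w. \<phi> w') / card (cls E w)) = (\<Sum>w\<in>F. \<phi> w)"
proof -
  have "(\<Sum>w\<in>F. (\<Sum>w'\<in>cls E w. \<phi> w') / card (cls E w))
      = (\<Sum>w\<in>F. \<Sum>w'\<in>F. if w' \<in> cls E w then \<phi> w' / card (cls E w) else 0)"
  proof (rule sum.cong[OF refl])
    fix w
    have "F \<inter> {w'. w' \<in> cls E w} = cls E w" using cls_subset by auto
    then show "(\<Sum>w'\<in>cls E w. \<phi> w') / card (cls E w)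
      = (\<Sum>w'\<in>F. if w' \<in> cls E w then \<phi> w' / card (cls E w) else 0)"
      using finF by (simp add: sum.If_cases sum_divide_distrib)
  qed
  also have "\<dots> = (\<Sum>w'\<in>F. \<Sum>w\<in>F. if w' \<in> cls E w then \<phi> w' / card (cls E w) else 0)"
    by (rule sum.swap)
  also have "\<dots> = (\<Sum>w'\<in>F. \<Sum>w\<in>F. if w \<in> cls E w' then \<phi> w' / card (cls E w') else 0)"
  proof (intro sum.cong refl if_cong)
    fix w w' assume "w' \<in> F" "w \<in> F"
    then show "(w' \<in> cls E w) = (w \<in> cls E w')" using cls_sym by blast
  next
    fix w w' assume "w \<in> cls E w'"
    then show "\<phi> w' / card (cls E w) = \<phi> w' / card (cls E w')" by (simp add: cls_eq)
  qed
  also have "\<dots> = (\<Sum>w'\<in>F. \<phi> w')"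
  proof (rule sum.cong[OF refl])
    fix w' assume w': "w' \<in> F"
    have "F \<inter> {w. w \<in> cls E w'} = cls E w'" using cls_subset by auto
    then show "(\<Sum>w\<in>F. if w \<in> cls E w' then \<phi> w' / card (cls E w') else 0) = \<phi> w'"
      using finF cls_pos[OF w', of E] by (auto simp: sum.If_cases card_gt_0_iff)
  qed
  finally show ?thesis .
qed

lemma sum_prob_class:
  assumes "w \<in> F" "E \<subseteq> E'"
  shows "(\<Sum>w'\<in>cls E w. prob E' e v w') = card {w' \<in> cls E w. w' e = v}"
proof -
  let ?\<phi> = "\<lambda>w'. if w' e = v \<and> w' \<in> cls E w then (1::real) else 0"
  have eq: "(\<Sum>w''\<in>cls E' w'. ?\<phi> w'') / card (cls E' w') = (if w' \<in> cls E w then prob E' e v w' else 0)"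
    if w': "w' \<in> F" for w'
  proof (cases "w' \<in> cls E w")
    case True
    then have sub: "cls E' w' \<subseteq> cls E w" using cls_mono[OF assms(2)] cls_eq by blast
    have "(\<Sum>w''\<in>cls E' w'. ?\<phi> w'') = (\<Sum>w''\<in>cls E' w'. if w'' e = v then 1 else 0)"
      using sub by (intro sum.cong) auto
    also have "\<dots> = card {w'' \<in> cls E' w'. w'' e = v}"
      by (simp add: sum.If_cases Int_def)
    finally show ?thesis using True by (simp add: prob_def)
  next
    case False
    have "w'' \<notin> cls E w" if "w'' \<in> cls E' w'" for w''
    proof
      assume "w'' \<in> cls E w"
      then have "cls E w'' = cls E w" by (rule cls_eq)
      moreover have "w' \<in> cls E w''" using that cls_sym[OF w' that] cls_mono[OF assms(2)] by blast
      ultimately show False using False by simp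
    qed
    then have "(\<Sum>w''\<in>cls E' w'. ?\<phi> w'') = 0" by (intro sum.neutral) auto
    then show ?thesis using False by simp
  qed
  have "(\<Sum>w'\<in>cls E w. prob E' e v w') = (\<Sum>w'\<in>F. if w' \<in> cls E w then prob E' e v w' else 0)"
    using finF cls_subset by (simp add: sum.If_cases Int_absorb1)
  also have "\<dots> = (\<Sum>w'\<in>F. (\<Sum>w''\<in>cls E' w'. ?\<phi> w'') / card (cls E' w'))"
    using eq by (intro sum.cong) auto
  also have "\<dots> = (\<Sum>w'\<in>F. ?\<phi> w')" by (rule sum_cond_mean)
  also have "\<dots> = card {w' \<in> cls E w. w' e = v}"
  proof -
    have "F \<inter> {w'. w' e = v \<and> w' \<in> cls E w} = {w' \<in> cls E w. w' e = v}" using cls_subset by auto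
    then show ?thesis using finF by (simp add: sum.If_cases)
  qed
  finally show ?thesis .
qed

text \<open>
Conditional probabilities given more values average to those given fewer, so in the sum of
\<open>entropy_term_strong_concave\<close> the linear terms cancel and the quadratic gap remains.
\<close>
lemma entropy_drop:
  assumes "E \<subseteq> E'"
  shows "entropy E' e + (\<Sum>w\<in>F. \<Sum>v\<le>q. (prob E' e v w - prob E e v w)\<^sup>2) / (2 * card F) \<le> entropy E e"
proof -
  let ?p = "\<lambda>v w. prob E e v w" and ?p' = "\<lambda>v w. prob E' e v w"
  have pt: "entropy_term (?p' v w) + (?p' v w - ?p v w)\<^sup>2 / 2
      \<le> entropy_term (?p v w) - (ln (?p v w) + 1) * (?p' v w - ?p v w)" if w: "w \<in> F" for v w
  proof (cases "?p v w = 0")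
    case True
    then have "{w' \<in> cls E w. w' e = v} = {}"
      using cls_pos[OF w, of E] by (auto simp: prob_def)
    then have "{w' \<in> cls E' w. w' e = v} = {}" using cls_mono[OF assms, of w] by blast
    then have "?p' v w = 0" unfolding prob_def by simp
    then show ?thesis using True by simp
  next
    case False
    then have "0 < ?p v w" using prob_nonneg[of E e v w] by simp
    then show ?thesis by (intro entropy_term_strong_concave prob_nonneg prob_le_1)
  qed
  \<comment> \<open>The first factor is constant on the classes of E, and the second has mean 0 there.\<close>
  have zero: "(\<Sum>w\<in>F. (ln (?p v w) + 1) * (?p' v w - ?p v w)) = 0" for v
  proof -
    let ?\<phi> = "\<lambda>w. (ln (?p v w) + 1) * (?p' v w - ?p v w)"
    have "(\<Sum>w'\<in>cls E w. ?\<phi> w') = 0" if w: "w \<in> F" for w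
    proof -
      have "(\<Sum>w'\<in>cls E w. ?\<phi> w') = (\<Sum>w'\<in>cls E w. (ln (?p v w) + 1) * (?p' v w' - ?p v w))"
        by (intro sum.cong refl) (simp add: prob_cong)
      also have "\<dots> = (ln (?p v w) + 1) * ((\<Sum>w'\<in>cls E w. ?p' v w') - card (cls E w) * ?p v w)"
        by (simp add: sum_distrib_left[symmetric] sum_subtractf)
      also have "(\<Sum>w'\<in>cls E w. ?p' v w') - card (cls E w) * ?p v w = 0"
        unfolding sum_prob_class[OF w assms] using cls_pos[OF w, of E] by (simp add: prob_def)
      finally show ?thesis by simp
    qed
    then show ?thesis using sum_cond_mean[of ?\<phi> E] by simp
  qed
  have "(\<Sum>w\<in>F. \<Sum>v\<le>q. entropy_term (?p' v w) + (?p' v w - ?p v w)\<^sup>2 / 2)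
      \<le> (\<Sum>w\<in>F. \<Sum>v\<le>q. entropy_term (?p v w) - (ln (?p v w) + 1) * (?p' v w - ?p v w))"
    using pt by (intro sum_mono)
  also have "\<dots> = (\<Sum>w\<in>F. \<Sum>v\<le>q. entropy_term (?p v w)) -
      (\<Sum>w\<in>F. \<Sum>v\<le>q. (ln (?p v w) + 1) * (?p' v w - ?p v w))"
    by (simp only: sum_subtractf)
  also have "(\<Sum>w\<in>F. \<Sum>v\<le>q. (ln (?p v w) + 1) * (?p' v w - ?p v w)) = 0"
  proof -
    have "(\<Sum>w\<in>F. \<Sum>v\<le>q. (ln (?p v w) + 1) * (?p' v w - ?p v w)) =
        (\<Sum>v\<le>q. \<Sum>w\<in>F. (ln (?p v w) + 1) * (?p' v w - ?p v w))" by (rule sum.swap)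
    then show ?thesis by (simp only: zero sum.neutral_const)
  qed
  finally have "(\<Sum>w\<in>F. \<Sum>v\<le>q. entropy_term (?p' v w)) + (\<Sum>w\<in>F. \<Sum>v\<le>q. (?p' v w - ?p v w)\<^sup>2) / 2
      \<le> (\<Sum>w\<in>F. \<Sum>v\<le>q. entropy_term (?p v w))"
    by (simp add: sum.distrib sum_divide_distrib)
  then have "((\<Sum>w\<in>F. \<Sum>v\<le>q. entropy_term (?p' v w)) + (\<Sum>w\<in>F. \<Sum>v\<le>q. (?p' v w - ?p v w)\<^sup>2) / 2) / card F
      \<le> (\<Sum>w\<in>F. \<Sum>v\<le>q. entropy_term (?p v w)) / card F"
    by (rule divide_right_mono) simp
  then show ?thesis unfolding entropy_def by (simp add: add_divide_distrib)
qed

lemma entropy_antimono: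
  assumes "E \<subseteq> E'"
  shows "entropy E' e \<le> entropy E e"
proof -
  have "0 \<le> (\<Sum>w\<in>F. \<Sum>v\<le>q. (prob E' e v w - prob E e v w)\<^sup>2) / (2 * card F)"
    by (intro divide_nonneg_nonneg sum_nonneg) auto
  then show ?thesis using entropy_drop[OF assms, of e] by linarith
qed

lemma entropy_nonneg: "0 \<le> entropy E e"
proof -
  have "0 \<le> entropy_term (prob E e v w)" for v w
  proof (cases "prob E e v w = 0")
    case False
    then have "ln (prob E e v w) \<le> 0" using prob_nonneg[of E e v w] prob_le_1[of E e v w] by simp
    then show ?thesis unfolding entropy_term_def using prob_nonneg[of E e v w] by (simp add: mult_nonneg_nonpos)
  qed simp
  then show ?thesis unfolding entropy_def by (intro divide_nonneg_nonneg sum_nonneg) auto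
qed

text \<open>
Values up to \<open>W\<close> contribute at most the logarithm of their number. Each of the others has
probability at most \<open>\<delta>\<close>, and so contributes little.
\<close>
lemma local_entropy_le:
  assumes "w \<in> F" "e \<in> U" "W \<le> q" "0 \<le> \<delta>" "\<And>v. W < v \<Longrightarrow> v \<le> q \<Longrightarrow> prob E e v w \<le> \<delta>"
    and "\<delta> \<le> 1"
  shows "(\<Sum>v\<le>q. entropy_term (prob E e v w)) \<le> ln (real W + 1) + 3 * (real q + 1) * sqrt \<delta>"
proof -
  let ?p = "\<lambda>v. prob E e v w"
  have split: "{..q} = {..W} \<union> {W<..q}" using assms(3) by auto
  have s: "(\<Sum>v\<le>q. f v) = (\<Sum>v\<le>W. f v) + (\<Sum>v\<in>{W<..q}. f v)" for f :: "nat \<Rightarrow> real"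
    unfolding split by (rule sum.union_disjoint) auto
  have cnt: "real (card {W<..q}) \<le> real q + 1" by simp
  let ?P = "\<Sum>v\<le>W. ?p v"
  have "(\<Sum>v\<in>{W<..q}. ?p v) \<le> (\<Sum>v\<in>{W<..q}. \<delta>)" using assms(5) by (intro sum_mono) auto
  also have "\<dots> \<le> (real q + 1) * \<delta>" using cnt assms(4) by (simp add: mult_right_mono)
  finally have tail: "1 - ?P \<le> (real q + 1) * \<delta>" using s[of ?p] sum_prob[OF assms(1,2), of E] by linarith
  have P0: "0 \<le> 1 - ?P" using s[of ?p] sum_prob[OF assms(1,2), of E] sum_nonneg[of "{W<..q}" ?p]
    by (simp add: prob_nonneg)
  have "(\<Sum>v\<le>W. entropy_term (?p v)) \<le> (\<Sum>v\<le>W. ?p v * ln (real W + 1) + 1 / (real W + 1) - ?p v)"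
    by (intro sum_mono entropy_term_le prob_nonneg) auto
  also have "\<dots> = ?P * ln (real W + 1) + 1 - ?P"
    by (simp add: sum.distrib sum_subtractf sum_distrib_right[symmetric])
  also have "\<dots> \<le> ln (real W + 1) + (1 - ?P)"
  proof -
    have "?P * ln (real W + 1) \<le> 1 * ln (real W + 1)" using P0 by (intro mult_right_mono) auto
    then show ?thesis by simp
  qed
  finally have A: "(\<Sum>v\<le>W. entropy_term (?p v)) \<le> ln (real W + 1) + (real q + 1) * \<delta>" using tail by simp
  have "(\<Sum>v\<in>{W<..q}. entropy_term (?p v)) \<le> (\<Sum>v\<in>{W<..q}. 2 * sqrt \<delta>)"
  proof (rule sum_mono)
    fix v assume "v \<in> {W<..q}"
    then have "sqrt (?p v) \<le> sqrt \<delta>" using assms(5) by simp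
    moreover have "entropy_term (?p v) \<le> 2 * sqrt (?p v)" by (rule entropy_term_le_sqrt[OF prob_nonneg])
    ultimately show "entropy_term (?p v) \<le> 2 * sqrt \<delta>" by linarith
  qed
  also have "\<dots> \<le> (real q + 1) * (2 * sqrt \<delta>)" using cnt assms(4) by (simp add: mult_right_mono del: mult_2)
  finally have B: "(\<Sum>v\<in>{W<..q}. entropy_term (?p v)) \<le> (real q + 1) * (2 * sqrt \<delta>)" .
  have "\<delta> \<le> sqrt \<delta>" using assms(4,6) by (intro real_le_rsqrt) (simp add: power2_eq_square mult_left_le)
  then have "(real q + 1) * \<delta> \<le> (real q + 1) * sqrt \<delta>" by (intro mult_left_mono) auto
  then show ?thesis using A B s[of "\<lambda>v. entropy_term (?p v)"] by linarith
qed

lemma entropy_le: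
  assumes "e \<in> U"
  shows "entropy E e \<le> ln (real q + 1)"
proof -
  have "(\<Sum>w\<in>F. \<Sum>v\<le>q. entropy_term (prob E e v w)) \<le> (\<Sum>w\<in>F. ln (real q + 1))"
    using local_entropy_le[of _ e q 0 E] assms by (intro sum_mono) auto
  then show ?thesis unfolding entropy_def using cardF by (simp add: divide_le_eq mult.commute)
qed

text \<open>
Averaging the negative logarithm of the conditional probability of the true value yields the
entropy; this probability is the quotient of two class sizes.
\<close>
lemma entropy_log:
  assumes "e \<in> U"
  shows "entropy E e * card F = (\<Sum>w\<in>F. ln (card (cls E w))) - (\<Sum>w\<in>F. ln (card (cls (insert e E) w)))"
proof -
  have ins: "cls (insert e E) w = {w' \<in> cls E w. w' e = w e}" for w
    unfolding cls_def by auto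
  let ?\<phi> = "\<lambda>w. - ln (prob E e (w e) w)"
  have "(\<Sum>w'\<in>cls E w. ?\<phi> w') / card (cls E w) = (\<Sum>v\<le>q. entropy_term (prob E e v w))" if w: "w \<in> F" for w
  proof -
    have "(\<Sum>w'\<in>cls E w. ?\<phi> w') = (\<Sum>w'\<in>cls E w. - ln (prob E e (w' e) w))"
      by (intro sum.cong refl) (simp add: prob_cong)
    also have "\<dots> = (\<Sum>v\<le>q. \<Sum>w'\<in>{w'\<in>cls E w. w' e = v}. - ln (prob E e (w' e) w))"
      using bounded[OF subsetD[OF cls_subset] assms] by (intro sum.group[symmetric]) auto
    also have "\<dots> = (\<Sum>v\<le>q. card {w'\<in>cls E w. w' e = v} * (- ln (prob E e v w)))"
      by (intro sum.cong refl) simp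
    finally show ?thesis
      by (simp add: sum_divide_distrib entropy_term_def prob_def)
  qed
  then have "(\<Sum>w\<in>F. \<Sum>v\<le>q. entropy_term (prob E e v w)) = (\<Sum>w\<in>F. ?\<phi> w)"
    using sum_cond_mean[of ?\<phi> E] by simp
  also have "\<dots> = (\<Sum>w\<in>F. ln (card (cls E w)) - ln (card (cls (insert e E) w)))"
  proof (rule sum.cong[OF refl])
    fix w assume w: "w \<in> F"
    show "?\<phi> w = ln (card (cls E w)) - ln (card (cls (insert e E) w))"
    proof -
      have "- ln (real m / real n) = ln n - ln m" if "0 < m" "0 < n" for m n :: nat
        using that by (simp add: ln_div)
      from this[OF cls_pos[OF w, of "insert e E"] cls_pos[OF w, of E]]
      show ?thesis unfolding prob_def ins .
    qed
  qed
  finally show ?thesis unfolding entropy_def using cardF by (simp add: sum_subtractf)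
qed

lemma log_class_le:
  assumes "finite D" "D \<subseteq> U"
  shows "(\<Sum>w\<in>F. ln (card (cls E w))) \<le> (\<Sum>w\<in>F. ln (card (cls (E \<union> D) w))) + (\<Sum>e\<in>D. entropy E e) * card F"
  using assms
proof (induction D rule: finite_induct)
  case (insert e D)
  have "entropy (E \<union> D) e * card F \<le> entropy E e * card F"
    by (intro mult_right_mono entropy_antimono) auto
  moreover have "E \<union> insert e D = insert e (E \<union> D)" by auto
  ultimately show ?case
    using insert entropy_log[of e "E \<union> D"] by (simp add: distrib_right)
qed simp

text \<open>
The chain rule from no conditioning to \<open>B\<close> to all of \<open>U\<close>: reveal the values on \<open>B\<close> at full price, then the
others, each at no more than its price given \<open>B\<close> alone.
\<close>
lemma ln_card_le:
  assumes "B \<subseteq> U"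
  shows "ln (card F) \<le> card B * ln (real q + 1) + (\<Sum>e\<in>U - B. entropy B e)"
proof -
  have finB: "finite B" using assms finU finite_subset by blast
  have "(\<Sum>w\<in>F. ln (card (cls {} w))) \<le> (\<Sum>w\<in>F. ln (card (cls B w))) + (\<Sum>e\<in>B. entropy {} e) * card F"
    using log_class_le[OF finB assms, of "{}"] by simp
  also have "(\<Sum>w\<in>F. ln (card (cls B w))) \<le> (\<Sum>w\<in>F. ln (card (cls U w))) + (\<Sum>e\<in>U - B. entropy B e) * card F"
    using log_class_le[of "U - B" B] finU assms by (simp add: Un_absorb1)
  also have "(\<Sum>w\<in>F. ln (card (cls U w))) = (\<Sum>w\<in>F. ln (card {w}))"
  proof (intro sum.cong refl arg_cong[of _ _ "\<lambda>S. ln (real (card S))"])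
    fix w assume w: "w \<in> F"
    show "cls U w = {w}" using w determined unfolding cls_def by auto
  qed
  also have "(\<Sum>w\<in>F. ln (card (cls {} w))) = card F * ln (card F)"
    by (simp add: cls_def)
  finally have "card F * ln (card F) \<le> ((\<Sum>e\<in>U - B. entropy B e) + (\<Sum>e\<in>B. entropy {} e)) * card F"
    by (simp add: distrib_right)
  then have "ln (card F) \<le> (\<Sum>e\<in>U - B. entropy B e) + (\<Sum>e\<in>B. entropy {} e)"
    using cardF by (simp add: mult.commute)
  also have "(\<Sum>e\<in>B. entropy {} e) \<le> (\<Sum>e\<in>B. ln (real q + 1))"
    using assms by (intro sum_mono entropy_le) auto
  finally show ?thesis by simp
qed

lemma ex_likely_value:
  assumes "w \<in> F" "e \<in> U" "0 < \<delta>" "\<delta> * (real q + 1) \<le> 1"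
  shows "\<exists>v\<le>q. \<delta> \<le> prob E e v w"
proof (rule ccontr)
  assume "\<not> ?thesis"
  then have "(\<Sum>v\<le>q. prob E e v w) < (\<Sum>v\<le>q. \<delta>)" by (intro sum_strict_mono) auto
  then show False using assms sum_prob[OF assms(1,2), of E] by (simp add: algebra_simps)
qed

text \<open>
Larger values are so rare that they hardly affect the entropy, whereas this one can be imposed
without shrinking the class too much.
\<close>
definition top_value :: "real \<Rightarrow> 'e set \<Rightarrow> 'e \<Rightarrow> ('e \<Rightarrow> nat) \<Rightarrow> nat" where
  "top_value \<delta> E e w = Max {v. v \<le> q \<and> \<delta> \<le> prob E e v w}"

lemma top_value:
  assumes "w \<in> F" "e \<in> U" "0 < \<delta>" "\<delta> * (real q + 1) \<le> 1"
  shows "top_value \<delta> E e w \<le> q" "\<delta> \<le> prob E e (top_value \<delta> E e w) w"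
    "\<And>v. top_value \<delta> E e w < v \<Longrightarrow> v \<le> q \<Longrightarrow> prob E e v w \<le> \<delta>"
proof -
  let ?S = "{v. v \<le> q \<and> \<delta> \<le> prob E e v w}"
  have fin: "finite ?S" by simp
  have "?S \<noteq> {}" using ex_likely_value[OF assms, of E] by auto
  with Max_in[OF fin] show "top_value \<delta> E e w \<le> q" "\<delta> \<le> prob E e (top_value \<delta> E e w) w"
    unfolding top_value_def by auto
  fix v assume v: "top_value \<delta> E e w < v" "v \<le> q"
  have "v \<notin> ?S"
  proof
    assume "v \<in> ?S"
    then have "v \<le> top_value \<delta> E e w" unfolding top_value_def by (rule Max_ge[OF fin])
    then show False using v(1) by simp
  qed
  then show "prob E e v w \<le> \<delta>" using v by auto
qed

text \<open>
Impose the likely values on \<open>D\<close> one after another. Each should cut the class by a factor not below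
$\delta/2$, as its probability was at least \<open>\<delta>\<close> to begin with. If it cuts more, then a fixed fraction of
the class sees the probability of this value drop by at least $\delta/2$ on account of the values
imposed before; by \<open>entropy_drop\<close> and near independence this happens for few members only.
\<close>
lemma few_atypical:
  assumes D: "finite D" "D \<subseteq> U" and \<delta>: "0 < \<delta>" "\<delta> * (real q + 1) \<le> 1" and \<epsilon>: "0 \<le> \<epsilon>"
    and indep: "\<And>e D'. e \<in> D \<Longrightarrow> D' \<subseteq> D - {e} \<Longrightarrow> entropy E e \<le> entropy (E \<union> D') e + \<epsilon>"
    and D': "D' \<subseteq> D"
  shows "real (card {w\<in>F. card {w'\<in>cls E w. \<forall>e\<in>D'. w' e = top_value \<delta> E e w} < (\<delta> / 2) ^ card D' * card (cls E w)})
    \<le> card D' * (2 * \<epsilon> * (2 / \<delta>) ^ (card D + 1)) * card F"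
proof -
  let ?W = "top_value \<delta> E"
  define A where "A D' w = {w'\<in>cls E w. \<forall>e\<in>D'. w' e = ?W e w}" for D' w
  define bad where "bad D' = {w\<in>F. card (A D' w) < (\<delta> / 2) ^ card D' * card (cls E w)}" for D'
  let ?c = "2 * \<epsilon> * (2 / \<delta>) ^ (card D + 1)"
  have "\<delta> \<le> \<delta> * (real q + 1)" using \<delta>(1) by simp
  then have \<delta>1: "\<delta> \<le> 1" using \<delta>(2) by simp
  have "finite D'" using D' D finite_subset by blast
  then have "real (card (bad D')) \<le> card D' * ?c * card F" using D'
  proof (induction D' rule: finite_induct)
    case empty
    have "bad {} = {}" unfolding bad_def A_def by auto
    then show ?case by simp
  next
    case (insert e D')
    have e: "e \<in> D" "e \<in> U" "D' \<subseteq> D - {e}" using insert D by auto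
    have finB: "finite (bad X)" for X unfolding bad_def using finF by simp
    define new where "new = bad (insert e D') - bad D'"
    define \<psi> where "\<psi> w = (\<Sum>v\<le>q. (prob (E \<union> D') e v w - prob E e v w)\<^sup>2)" for w
    have \<psi>0: "0 \<le> \<psi> w" for w unfolding \<psi>_def by (intro sum_nonneg) auto
    have large: "(\<delta> / 2) ^ (card D' + 2) \<le> (\<Sum>w'\<in>cls E w. \<psi> w') / card (cls E w)" if w: "w \<in> new" for w
    proof -
      have wF: "w \<in> F" using w unfolding new_def bad_def by auto
      have c0: "0 < card (cls E w)" by (rule cls_pos[OF wF])
      have h1: "(\<delta> / 2) ^ card D' * card (cls E w) \<le> card (A D' w)"
        using w wF unfolding new_def bad_def by auto
      have h2: "card (A (insert e D') w) < (\<delta> / 2) ^ Suc (card D') * card (cls E w)"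
        using w insert.hyps unfolding new_def bad_def by auto
      have "card (A (insert e D') w) < (\<delta> / 2) * ((\<delta> / 2) ^ card D' * card (cls E w))"
        using h2 by (simp add: mult_ac)
      also have "\<dots> \<le> (\<delta> / 2) * card (A D' w)" using h1 \<delta>(1) by (intro mult_left_mono) auto
      finally have h3: "card (A (insert e D') w) < (\<delta> / 2) * card (A D' w)" .
      have A0: "0 < card (A D' w)"
      proof -
        have "0 < (\<delta> / 2) ^ card D' * card (cls E w)" using c0 \<delta>(1) by simp
        then show ?thesis using h1 by linarith
      qed
      have sq: "(\<delta> / 2)\<^sup>2 \<le> \<psi> w'" if w': "w' \<in> A D' w" for w'
      proof -
        have w'c: "w' \<in> cls E w" using w' unfolding A_def by auto
        have "cls (E \<union> D') w' = A D' w" using w' unfolding A_def cls_def by auto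
        moreover have "{w'' \<in> A D' w. w'' e = ?W e w} = A (insert e D') w" unfolding A_def by auto
        ultimately have "prob (E \<union> D') e (?W e w) w' = card (A (insert e D') w) / card (A D' w)"
          unfolding prob_def by simp
        then have lt: "prob (E \<union> D') e (?W e w) w' < \<delta> / 2" using h3 A0 by (simp add: pos_divide_less_eq)
        have ge: "\<delta> \<le> prob E e (?W e w) w'" using top_value(2)[OF wF e(2) \<delta>, of E] prob_cong[OF w'c] by simp
        have "(\<delta> / 2)\<^sup>2 \<le> (prob E e (?W e w) w' - prob (E \<union> D') e (?W e w) w')\<^sup>2"
          using lt ge \<delta>(1) by (intro power_mono) auto
        also have "\<dots> = (prob (E \<union> D') e (?W e w) w' - prob E e (?W e w) w')\<^sup>2" by (rule power2_commute)
        also have "\<dots> \<le> \<psi> w'" unfolding \<psi>_def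
          using top_value(1)[OF wF e(2) \<delta>, of E]
          by (intro member_le_sum[where f = "\<lambda>v. (prob (E \<union> D') e v w' - prob E e v w')\<^sup>2"]) auto
        finally show ?thesis .
      qed
      have "card (A D' w) * (\<delta> / 2)\<^sup>2 = (\<Sum>w'\<in>A D' w. (\<delta> / 2)\<^sup>2)" by simp
      also have "\<dots> \<le> (\<Sum>w'\<in>A D' w. \<psi> w')" using sq by (intro sum_mono)
      also have "\<dots> \<le> (\<Sum>w'\<in>cls E w. \<psi> w')" unfolding A_def using \<psi>0 by (intro sum_mono2) auto
      finally have "card (A D' w) * (\<delta> / 2)\<^sup>2 \<le> (\<Sum>w'\<in>cls E w. \<psi> w')" .
      moreover have "(\<delta> / 2) ^ card D' * card (cls E w) * (\<delta> / 2)\<^sup>2 \<le> card (A D' w) * (\<delta> / 2)\<^sup>2"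
        using h1 by (intro mult_right_mono) auto
      moreover have "(\<delta> / 2) ^ (card D' + 2) * card (cls E w) = (\<delta> / 2) ^ card D' * card (cls E w) * (\<delta> / 2)\<^sup>2"
        by (simp only: power_add mult_ac)
      ultimately have "(\<delta> / 2) ^ (card D' + 2) * card (cls E w) \<le> (\<Sum>w'\<in>cls E w. \<psi> w')"
        by linarith
      then show ?thesis using c0 by (simp add: pos_le_divide_eq)
    qed
    have newF: "new \<subseteq> F" unfolding new_def bad_def by auto
    have finN: "finite new" using newF finF finite_subset by blast
    have "card new * (\<delta> / 2) ^ (card D' + 2) = (\<Sum>w\<in>new. (\<delta> / 2) ^ (card D' + 2))" by simp
    also have "\<dots> \<le> (\<Sum>w\<in>new. (\<Sum>w'\<in>cls E w. \<psi> w') / card (cls E w))" using large by (intro sum_mono)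
    also have "\<dots> \<le> (\<Sum>w\<in>F. (\<Sum>w'\<in>cls E w. \<psi> w') / card (cls E w))"
      using newF finF \<psi>0 by (intro sum_mono2 divide_nonneg_nonneg sum_nonneg) auto
    also have "\<dots> = (\<Sum>w\<in>F. \<psi> w)" by (rule sum_cond_mean)
    also have "\<dots> \<le> 2 * \<epsilon> * card F"
    proof -
      have "(\<Sum>w\<in>F. \<psi> w) / (2 * card F) \<le> \<epsilon>"
        using entropy_drop[of E "E \<union> D'" e] indep[OF e(1,3)] unfolding \<psi>_def by simp
      then show ?thesis using cardF by (simp add: pos_divide_le_eq mult_ac)
    qed
    finally have N: "card new * (\<delta> / 2) ^ (card D' + 2) \<le> 2 * \<epsilon> * card F" .
    have cD: "card D' + 2 \<le> card D + 1"
      using card_mono[OF D(1) insert.prems] insert.hyps by simp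
    have "(\<delta> / 2) ^ (card D + 1) \<le> (\<delta> / 2) ^ (card D' + 2)"
      using \<delta>(1) \<delta>1 cD by (intro power_decreasing) auto
    then have "card new * (\<delta> / 2) ^ (card D + 1) \<le> card new * (\<delta> / 2) ^ (card D' + 2)"
      by (intro mult_left_mono) auto
    then have "card new * (\<delta> / 2) ^ (card D + 1) \<le> 2 * \<epsilon> * card F" using N by linarith
    then have "card new \<le> 2 * \<epsilon> * card F / (\<delta> / 2) ^ (card D + 1)" using \<delta>(1) by (simp add: pos_le_divide_eq)
    then have newc: "card new \<le> ?c * card F" by (simp add: power_divide field_simps)
    have "card (bad (insert e D')) \<le> card (bad D' \<union> new)"
      using finB finN by (intro card_mono) (auto simp: new_def)
    also have "\<dots> \<le> card (bad D') + card new" by (rule card_Un_le)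
    finally have "real (card (bad (insert e D'))) \<le> card (bad D') + card new" by linarith
    also have "\<dots> \<le> card D' * ?c * card F + ?c * card F"
      using newc insert.IH insert.prems by auto
    also have "\<dots> = card (insert e D') * ?c * card F"
    proof -
      have "m * c * N + c * N = (1 + m) * c * N" for m c N :: real by (simp add: algebra_simps)
      moreover have "real (card (insert e D')) = 1 + real (card D')" using insert.hyps by simp
      ultimately show ?thesis by (simp only:)
    qed
    finally show ?case .
  qed
  then show ?thesis unfolding bad_def A_def .
qed

text \<open>
For all but the atypical members the likely values on \<open>D\<close> are taken simultaneously by some member
of the family, so that \<open>B\<close> bounds the sum of their logarithms. For the atypical ones each
logarithm is bounded trivially.
\<close>
lemma entropy_sum_le:
  assumes D: "finite D" "D \<subseteq> U" and \<delta>: "0 < \<delta>" "\<delta> * (real q + 1) \<le> 1" and \<epsilon>: "0 \<le> \<epsilon>"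
    and indep: "\<And>e D'. e \<in> D \<Longrightarrow> D' \<subseteq> D - {e} \<Longrightarrow> entropy E e \<le> entropy (E \<union> D') e + \<epsilon>"
    and B: "\<And>w. w \<in> F \<Longrightarrow> (\<Sum>e\<in>D. ln (real (w e) + 1)) \<le> B"
  shows "(\<Sum>e\<in>D. entropy E e) \<le> B + card D * (3 * (real q + 1) * sqrt \<delta>)
    + card D * ln (real q + 1) * (card D * (2 * \<epsilon> * (2 / \<delta>) ^ (card D + 1)))"
proof -
  let ?W = "top_value \<delta> E"
  let ?c = "card D * (2 * \<epsilon> * (2 / \<delta>) ^ (card D + 1))"
  let ?K = "card D * (3 * (real q + 1) * sqrt \<delta>)"
  define bad where "bad = {w\<in>F. card {w'\<in>cls E w. \<forall>e\<in>D. w' e = ?W e w} < (\<delta> / 2) ^ card D * card (cls E w)}"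
  have badc: "real (card bad) \<le> ?c * card F"
    unfolding bad_def by (rule few_atypical[OF D \<delta> \<epsilon> indep]) auto
  have "\<delta> \<le> \<delta> * (real q + 1)" using \<delta>(1) by simp
  then have \<delta>1: "\<delta> \<le> 1" using \<delta>(2) by simp
  have B0: "0 \<le> B"
  proof -
    obtain w where "w \<in> F" using F_ne by auto
    from B[OF this] show ?thesis using sum_nonneg[of D "\<lambda>e. ln (real (w e) + 1)"] by force
  qed
  have pt: "(\<Sum>e\<in>D. ln (real (?W e w) + 1)) \<le> B + (if w \<in> bad then card D * ln (real q + 1) else 0)" if w: "w \<in> F" for w
  proof (cases "w \<in> bad")
    case True
    have "(\<Sum>e\<in>D. ln (real (?W e w) + 1)) \<le> (\<Sum>e\<in>D. ln (real q + 1))"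
      using top_value(1)[OF w _ \<delta>] D by (intro sum_mono ln_mono) auto
    then show ?thesis using True B0 by simp
  next
    case False
    then have "0 < card {w'\<in>cls E w. \<forall>e\<in>D. w' e = ?W e w}"
    proof -
      have "0 < (\<delta> / 2) ^ card D * card (cls E w)" using cls_pos[OF w, of E] \<delta>(1) by simp
      also have "\<dots> \<le> card {w'\<in>cls E w. \<forall>e\<in>D. w' e = ?W e w}" using False w unfolding bad_def by auto
      finally show ?thesis by simp
    qed
    then obtain w' where w': "w' \<in> cls E w" "\<And>e. e \<in> D \<Longrightarrow> w' e = ?W e w"
      by (auto simp: card_gt_0_iff)
    have "(\<Sum>e\<in>D. ln (real (?W e w) + 1)) = (\<Sum>e\<in>D. ln (real (w' e) + 1))"
      using w' by (intro sum.cong) auto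
    also have "\<dots> \<le> B" using B w'(1) cls_subset by blast
    finally show ?thesis using False by simp
  qed
  have "(\<Sum>e\<in>D. entropy E e) * card F = (\<Sum>e\<in>D. \<Sum>w\<in>F. \<Sum>v\<le>q. entropy_term (prob E e v w))"
    unfolding entropy_def sum_distrib_right using cardF by simp
  also have "\<dots> = (\<Sum>w\<in>F. \<Sum>e\<in>D. \<Sum>v\<le>q. entropy_term (prob E e v w))" by (rule sum.swap)
  also have "\<dots> \<le> (\<Sum>w\<in>F. \<Sum>e\<in>D. (ln (real (?W e w) + 1) + 3 * (real q + 1) * sqrt \<delta>))"
  proof (intro sum_mono)
    fix w e assume we: "w \<in> F" "e \<in> D"
    then have eU: "e \<in> U" using D by auto
    show "(\<Sum>v\<le>q. entropy_term (prob E e v w)) \<le> ln (real (?W e w) + 1) + 3 * (real q + 1) * sqrt \<delta>"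
      by (rule local_entropy_le[OF we(1) eU top_value(1)[OF we(1) eU \<delta>] less_imp_le[OF \<delta>(1)]
            top_value(3)[OF we(1) eU \<delta>] \<delta>1])
  qed
  also have "\<dots> = (\<Sum>w\<in>F. (\<Sum>e\<in>D. ln (real (?W e w) + 1)) + ?K)"
    by (simp add: sum.distrib)
  also have "\<dots> \<le> (\<Sum>w\<in>F. B + (if w \<in> bad then card D * ln (real q + 1) else 0) + ?K)"
    using pt by (intro sum_mono add_right_mono)
  also have "\<dots> = card F * (B + ?K) + card bad * (card D * ln (real q + 1))"
  proof -
    have "F \<inter> {w. w \<in> bad} = bad" unfolding bad_def by auto
    then have "(\<Sum>w\<in>F. if w \<in> bad then card D * ln (real q + 1) else 0) = card bad * (card D * ln (real q + 1))"
      using finF by (simp add: sum.If_cases)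
    then show ?thesis by (simp add: sum.distrib algebra_simps)
  qed
  also have "\<dots> \<le> card F * (B + ?K) + ?c * card F * (card D * ln (real q + 1))"
    using badc by (intro add_left_mono mult_right_mono) auto
  also have "\<dots> = (B + ?K + card D * ln (real q + 1) * ?c) * card F" by (simp add: algebra_simps)
  finally show ?thesis using cardF by simp
qed

end
section \<open>Entropy of a pair in the family of graphs\<close>

lemma ex_permutation_pair:
  assumes V: "finite V" and A: "A \<subseteq> V" "B \<subseteq> V" "A \<inter> B = {}"
    and A': "A' \<subseteq> V" "B' \<subseteq> V" "A' \<inter> B' = {}"
    and card: "card A = card A'" "card B = card B'"
  obtains \<sigma> where "\<sigma> permutes V" "\<sigma> ` A = A'" "\<sigma> ` B = B'"
proof -
  have fin: "finite A" "finite B" "finite A'" "finite B'" using A A' V by (auto intro: finite_subset)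
  let ?C = "V - (A \<union> B)" and ?C' = "V - (A' \<union> B')"
  have "card ?C = card ?C'"
    using A A' card fin by (simp add: card_Diff_subset card_Un_disjoint)
  then obtain h where h: "bij_betw h ?C ?C'" using V finite_same_card_bij[of ?C ?C'] by auto
  obtain f where f: "bij_betw f A A'" using finite_same_card_bij[OF fin(1,3) card(1)] by auto
  obtain g where g: "bij_betw g B B'" using finite_same_card_bij[OF fin(2,4) card(2)] by auto
  define \<sigma> where "\<sigma> x = (if x \<in> A then f x else if x \<in> B then g x else if x \<in> V then h x else x)" for x
  have 1: "bij_betw \<sigma> A A'" using f by (rule bij_betw_cong[THEN iffD1, rotated]) (simp add: \<sigma>_def)
  have 2: "bij_betw \<sigma> B B'" using g A(3) by (subst bij_betw_cong[of _ _ g]) (auto simp: \<sigma>_def)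
  have 3: "bij_betw \<sigma> ?C ?C'" using h by (subst bij_betw_cong[of _ _ h]) (auto simp: \<sigma>_def)
  have "bij_betw \<sigma> (A \<union> B) (A' \<union> B')" using A' by (intro bij_betw_combine[OF 1 2])
  then have "bij_betw \<sigma> ((A \<union> B) \<union> ?C) ((A' \<union> B') \<union> ?C')" by (intro bij_betw_combine[OF _ 3]) auto
  moreover have "(A \<union> B) \<union> ?C = V" "(A' \<union> B') \<union> ?C' = V" using A A' by auto
  ultimately have "bij_betw \<sigma> V V" by simp
  then have "\<sigma> permutes V" using A by (intro bij_imp_permutes) (auto simp: \<sigma>_def)
  then show thesis using that 1 2 by (auto simp: bij_betw_def)
qed

lemma permutes_nsets:
  assumes "\<sigma> permutes V"
  shows "(image \<sigma> e \<in> nsets V k) = (e \<in> nsets V k)"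
proof -
  have inj: "inj_on \<sigma> e" using permutes_inj[OF assms] inj_on_subset by blast
  have "\<sigma> ` e \<subseteq> V \<longleftrightarrow> e \<subseteq> V" using permutes_in_image[OF assms] by auto
  then show ?thesis unfolding nsets_def using inj by (simp add: card_image finite_image_iff)
qed

lemma inj_image: "inj \<sigma> \<Longrightarrow> inj (image \<sigma>)"
  by (rule injI) (simp add: inj_image_eq_iff)

locale sq_family =
  fixes n s q :: nat
  assumes s2: "2 \<le> s" and sn: "s \<le> n"
begin

abbreviation "V \<equiv> {1..n}"
abbreviation "U \<equiv> nsets V 2"
abbreviation "F \<equiv> sq_graphs n s q"

lemma zero_in: "(\<lambda>e. if e \<in> U then 0 else undefined) \<in> F"
proof -
  have "(\<Sum>e\<in>nsets X 2. (if e \<in> U then 0 else undefined :: nat)) \<le> q" if X: "X \<in> nsets V s" for X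
  proof -
    have "nsets X 2 \<subseteq> U" using X by (intro nsets_mono) (auto simp: nsets_def)
    then have "(\<Sum>e\<in>nsets X 2. (if e \<in> U then 0 else undefined :: nat)) = 0" by (intro sum.neutral) auto
    then show ?thesis by simp
  qed
  then show ?thesis unfolding sq_graphs_def sq_graph_def by (auto simp: PiE_def extensional_def)
qed

sublocale finite_assignments F U q
proof
  show "finite F" by (rule finite_sq_graphs[OF s2 sn])
  show "F \<noteq> {}" using zero_in by blast
  show "finite U" by (intro finite_imp_finite_nsets) simp
  show "w e \<le> q" if "w \<in> F" "e \<in> U" for w e
    using that sq_graph_le[of s q V w e] s2 sn by (auto simp: sq_graphs_def)
  show "w = w'" if "w \<in> F" "w' \<in> F" "\<And>e. e \<in> U \<Longrightarrow> w e = w' e" for w w'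
    using that by (intro PiE_ext[of w U "\<lambda>_. UNIV" w']) (auto simp: sq_graphs_def)
qed

text \<open>
The family is closed under permutations of the vertices, so the entropy of a pair depends only on
the isomorphism type of what is given.
\<close>
definition relabel :: "(nat \<Rightarrow> nat) \<Rightarrow> (nat set \<Rightarrow> nat) \<Rightarrow> nat set \<Rightarrow> nat" where
  "relabel \<sigma> w = (\<lambda>e. w (\<sigma> ` e))"

lemma relabel_in:
  assumes \<sigma>: "\<sigma> permutes V" and w: "w \<in> F"
  shows "relabel \<sigma> w \<in> F"
proof -
  have "relabel \<sigma> w e = undefined" if "e \<notin> U" for e
    using that w permutes_nsets[OF \<sigma>, of e 2] unfolding relabel_def sq_graphs_def
    by (auto simp: PiE_def extensional_def)
  moreover have "(\<Sum>e\<in>nsets X 2. relabel \<sigma> w e) \<le> q" if X: "X \<in> nsets V s" for X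
  proof -
    have inj: "inj_on (image \<sigma>) (nsets X 2)"
      using inj_image[OF permutes_inj[OF \<sigma>]] by (rule inj_on_subset) simp
    have "nsets (\<sigma> ` X) 2 = image \<sigma> ` nsets X 2"
    proof -
      have "bij_betw \<sigma> X (\<sigma> ` X)" using permutes_inj[OF \<sigma>] by (auto simp: bij_betw_def intro: inj_on_subset)
      then show ?thesis using bij_betw_nsets[of \<sigma> X "\<sigma> ` X" 2] by (simp add: bij_betw_def)
    qed
    then have "(\<Sum>e\<in>nsets X 2. relabel \<sigma> w e) = (\<Sum>e\<in>nsets (\<sigma> ` X) 2. w e)"
      unfolding relabel_def by (simp add: sum.reindex[OF inj])
    also have "\<dots> \<le> q"
      using w X permutes_nsets[OF \<sigma>, of X s] by (auto simp: sq_graphs_def sq_graph_def)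
    finally show ?thesis .
  qed
  ultimately show ?thesis unfolding sq_graphs_def sq_graph_def by (auto simp: PiE_def extensional_def)
qed

lemma relabel_bij:
  assumes \<sigma>: "\<sigma> permutes V"
  shows "bij_betw (relabel \<sigma>) F F"
proof -
  have inj: "inj_on (relabel \<sigma>) F"
  proof (rule inj_onI)
    fix w w' assume eq: "relabel \<sigma> w = relabel \<sigma> w'"
    show "w = w'"
    proof
      fix e
      have "\<sigma> ` (inv \<sigma> ` e) = e" using permutes_surj[OF \<sigma>] by (simp add: image_f_inv_f)
      then show "w e = w' e" using fun_cong[OF eq, of "inv \<sigma> ` e"] by (simp add: relabel_def)
    qed
  qed
  moreover have "relabel \<sigma> ` F \<subseteq> F" using relabel_in[OF \<sigma>] by auto
  ultimately have "relabel \<sigma> ` F = F" using finF by (simp add: endo_inj_surj)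
  then show ?thesis using inj by (simp add: bij_betw_def)
qed

lemma cls_relabel:
  assumes \<sigma>: "\<sigma> permutes V" and w: "w \<in> F"
  shows "cls E (relabel \<sigma> w) = relabel \<sigma> ` cls (image \<sigma> ` E) w"
proof (intro equalityI subsetI)
  fix w' assume w': "w' \<in> cls E (relabel \<sigma> w)"
  then have "w' \<in> F" unfolding cls_def by auto
  then obtain u where u: "u \<in> F" "w' = relabel \<sigma> u" using relabel_bij[OF \<sigma>] unfolding bij_betw_def by blast
  then show "w' \<in> relabel \<sigma> ` cls (image \<sigma> ` E) w" using w' unfolding cls_def relabel_def by auto
next
  fix w' assume "w' \<in> relabel \<sigma> ` cls (image \<sigma> ` E) w"
  then show "w' \<in> cls E (relabel \<sigma> w)" using relabel_in[OF \<sigma>] unfolding cls_def relabel_def by auto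
qed

lemma entropy_relabel:
  assumes \<sigma>: "\<sigma> permutes V"
  shows "entropy (image \<sigma> ` E) (\<sigma> ` e) = entropy E e"
proof -
  have p: "prob E e v (relabel \<sigma> w) = prob (image \<sigma> ` E) (\<sigma> ` e) v w" if w: "w \<in> F" for v w
  proof -
    have injF: "inj_on (relabel \<sigma>) S" if "S \<subseteq> F" for S
      using relabel_bij[OF \<sigma>] that inj_on_subset by (auto simp: bij_betw_def)
    let ?C = "cls (image \<sigma> ` E) w"
    have "{w' \<in> cls E (relabel \<sigma> w). w' e = v} = relabel \<sigma> ` {w' \<in> ?C. w' (\<sigma> ` e) = v}"
      unfolding cls_relabel[OF \<sigma> w] by (auto simp: relabel_def)
    then have "card {w' \<in> cls E (relabel \<sigma> w). w' e = v} = card {w' \<in> ?C. w' (\<sigma> ` e) = v}"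
    proof -
      have "{w' \<in> ?C. w' (\<sigma> ` e) = v} \<subseteq> F" using cls_subset by auto
      from card_image[OF injF[OF this]] show ?thesis
        using \<open>{w' \<in> cls E (relabel \<sigma> w). w' e = v} = relabel \<sigma> ` {w' \<in> ?C. w' (\<sigma> ` e) = v}\<close> by simp
    qed
    moreover have "card (cls E (relabel \<sigma> w)) = card ?C"
      unfolding cls_relabel[OF \<sigma> w] by (rule card_image[OF injF[OF cls_subset]])
    ultimately show ?thesis unfolding prob_def by simp
  qed
  have "(\<Sum>w\<in>F. \<Sum>v\<le>q. entropy_term (prob E e v w)) = (\<Sum>w\<in>F. \<Sum>v\<le>q. entropy_term (prob E e v (relabel \<sigma> w)))"
    by (rule sum.reindex_bij_betw[OF relabel_bij[OF \<sigma>], symmetric])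
  also have "\<dots> = (\<Sum>w\<in>F. \<Sum>v\<le>q. entropy_term (prob (image \<sigma> ` E) (\<sigma> ` e) v w))"
    using p by (intro sum.cong refl) auto
  finally show ?thesis unfolding entropy_def by simp
qed

definition frame :: "nat set \<Rightarrow> nat set \<Rightarrow> nat set set" where
  "frame T e = nsets (T \<union> e) 2 - {e}"

text \<open>
The entropy of a pair given its frame over \<open>t\<close> vertices. The concrete choice of the vertices is
immaterial by \<open>frame_entropy\<close>.
\<close>
definition pair_entropy :: "nat \<Rightarrow> real" where
  "pair_entropy t = entropy (frame {3..t + 2} {1, 2}) {1, 2}"

lemma frame_entropy:
  assumes "T \<subseteq> V" "e \<in> U" "T \<inter> e = {}"
  shows "entropy (frame T e) e = pair_entropy (card T)"
proof -
  let ?t = "card T"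
  have e: "e \<subseteq> V" "card e = 2" "finite e" using assms(2) by (auto simp: nsets_def)
  have finT: "finite T" using assms(1) finite_subset by blast
  have "card (T \<union> e) \<le> card V" using assms(1) e(1) by (intro card_mono) auto
  then have tn: "?t + 2 \<le> n" using card_Un_disjoint[OF finT e(3) assms(3)] e by simp
  obtain \<sigma> where \<sigma>: "\<sigma> permutes V" "\<sigma> ` {3..?t + 2} = T" "\<sigma> ` {1, 2} = e"
    by (rule ex_permutation_pair[of V "{3..?t + 2}" "{1, 2}" T e]) (use tn assms e in auto)
  have inj: "inj \<sigma>" by (rule permutes_inj[OF \<sigma>(1)])
  have "image \<sigma> ` nsets ({3..?t + 2} \<union> {1, 2}) 2 = nsets (\<sigma> ` ({3..?t + 2} \<union> {1, 2})) 2"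
  proof -
    have "bij_betw \<sigma> X (\<sigma> ` X)" for X using inj by (auto simp: bij_betw_def intro: inj_on_subset)
    then show ?thesis using bij_betw_nsets by (metis bij_betw_def)
  qed
  moreover have "\<sigma> ` ({3..?t + 2} \<union> {1, 2}) = T \<union> e" by (simp only: image_Un \<sigma>(2,3))
  moreover have "image \<sigma> ` {{1, 2}} = {e}" by (subst \<sigma>(3)[symmetric]) simp
  ultimately have "image \<sigma> ` frame {3..?t + 2} {1, 2} = frame T e"
    unfolding frame_def image_set_diff[OF inj_image[OF inj]] by (simp only:)
  then show ?thesis unfolding pair_entropy_def using entropy_relabel[OF \<sigma>(1), of "frame {3..?t + 2} {1, 2}" "{1, 2}"] \<sigma>(3)
    by simp
qed

text \<open>
Reveal first all pairs that meet a set of \<open>t\<close> vertices; there are at most $tn$ of these. They contain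
the frame of every other pair.
\<close>
lemma ln_card_le_pair_entropy:
  assumes "t \<le> n"
  shows "ln (card F) \<le> (t * n) * ln (real q + 1) + (n choose 2) * pair_entropy t"
proof -
  let ?T = "{1..t}"
  define B where "B = {e \<in> U. e \<inter> ?T \<noteq> {}}"
  have "B \<subseteq> (\<lambda>(x, y). {x, y}) ` (?T \<times> V)"
  proof
    fix e assume e: "e \<in> B"
    then have "e \<inter> ?T \<noteq> {}" by (simp add: B_def)
    then obtain x where x: "x \<in> e" "x \<in> ?T" by blast
    have "card e = 2" "e \<subseteq> V" using e unfolding B_def nsets_def by auto
    then obtain y where "e = {x, y}" using x by (auto simp: card_2_iff)
    then show "e \<in> (\<lambda>(x, y). {x, y}) ` (?T \<times> V)" using x \<open>e \<subseteq> V\<close> by auto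
  qed
  then have "card B \<le> card ((\<lambda>(x, y). {x, y}) ` (?T \<times> V))" by (intro card_mono) auto
  also have "\<dots> \<le> card (?T \<times> V)" by (rule card_image_le) auto
  finally have cB: "card B \<le> t * n" by (simp add: card_cartesian_product)
  have BU: "B \<subseteq> U" unfolding B_def by auto
  have "entropy B e \<le> pair_entropy t" if e: "e \<in> U - B" for e
  proof -
    have d: "?T \<inter> e = {}" using e unfolding B_def by auto
    have "frame ?T e \<subseteq> B"
    proof
      fix f assume f: "f \<in> frame ?T e"
      have eV: "e \<subseteq> V" "card e = 2" "finite e" using e by (auto simp: nsets_def)
      have "f \<inter> ?T \<noteq> {}"
      proof
        assume "f \<inter> ?T = {}"
        then have "f \<subseteq> e" "card f = card e" using f eV unfolding frame_def nsets_def by auto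
        then have "f = e" using card_subset_eq[OF eV(3)] by blast
        then show False using f unfolding frame_def by simp
      qed
      moreover have "f \<in> U" using f eV assms unfolding frame_def nsets_def by auto
      ultimately show "f \<in> B" unfolding B_def by simp
    qed
    then have "entropy B e \<le> entropy (frame ?T e) e" by (rule entropy_antimono)
    also have "\<dots> = pair_entropy t" using frame_entropy[of ?T e] e d assms by simp
    finally show ?thesis .
  qed
  then have "(\<Sum>e\<in>U - B. entropy B e) \<le> (\<Sum>e\<in>U - B. pair_entropy t)" by (rule sum_mono)
  also have "\<dots> = card (U - B) * pair_entropy t" by simp
  also have "\<dots> \<le> card U * pair_entropy t"
  proof (rule mult_right_mono)
    have "card (U - B) \<le> card U" by (rule card_mono[OF finU]) auto
    then show "real (card (U - B)) \<le> real (card U)" by (simp only: of_nat_le_iff)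
  qed (simp add: pair_entropy_def entropy_nonneg)
  also have "card U = n choose 2" by (simp add: card_nsets)
  finally have 1: "(\<Sum>e\<in>U - B. entropy B e) \<le> (n choose 2) * pair_entropy t" .
  have "real (card B) \<le> real (t * n)" using cB by (simp only: of_nat_le_iff)
  then have 2: "card B * ln (real q + 1) \<le> (t * n) * ln (real q + 1)" by (intro mult_right_mono) auto
  show ?thesis using ln_card_le[OF BU] 1 2 by simp
qed

lemma pair_entropy_antimono:
  assumes "t \<le> t'"
  shows "pair_entropy t' \<le> pair_entropy t"
proof -
  have "{3..t + 2} \<union> {1, 2} \<subseteq> {3..t' + 2} \<union> {1, 2}" using assms by auto
  from nsets_mono[OF this, of 2] have "frame {3..t + 2} {1, 2} \<subseteq> frame {3..t' + 2} {1, 2}"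
    unfolding frame_def by blast
  then show ?thesis unfolding pair_entropy_def by (rule entropy_antimono)
qed

lemma pair_entropy_nonneg: "0 \<le> pair_entropy t"
  unfolding pair_entropy_def by (rule entropy_nonneg)

lemma pair_entropy_le: "pair_entropy t \<le> ln (real q + 1)"
  unfolding pair_entropy_def using s2 sn by (intro entropy_le) (auto simp: nsets_def)

text \<open>
Otherwise the entropy would drop by more than \<open>\<epsilon>\<close> in each of \<open>J\<close> consecutive steps of length \<open>m\<close>.
\<close>
lemma ex_stable:
  assumes "ln (real q + 1) \<le> real J * \<epsilon>" "0 < J"
  shows "\<exists>t \<le> J * m. pair_entropy t \<le> pair_entropy (t + m) + \<epsilon>"
proof (rule ccontr)
  assume neg: "\<not> ?thesis"
  have drop: "pair_entropy (j * m + m) < pair_entropy (j * m) - \<epsilon>" if "j < J" for j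
  proof -
    have "j * m \<le> J * m" using that by simp
    with neg have "\<not> pair_entropy (j * m) \<le> pair_entropy (j * m + m) + \<epsilon>" by blast
    then show ?thesis by simp
  qed
  have "j \<le> J \<Longrightarrow> pair_entropy (j * m) \<le> ln (real q + 1) - real j * \<epsilon> \<and> (0 < j \<longrightarrow> pair_entropy (j * m) < ln (real q + 1) - real j * \<epsilon>)" for j
  proof (induction j)
    case 0
    then show ?case using pair_entropy_le[of 0] by simp
  next
    case (Suc j)
    then show ?case using drop[of j] by (simp add: algebra_simps)
  qed
  from this[of J] assms show False using pair_entropy_nonneg[of "J * m"] by simp
qed

text \<open>
Condition on all pairs within \<open>M\<close> and \<open>T\<close> except those inside \<open>M\<close>. For a pair inside \<open>M\<close> this contains
its frame over \<open>T\<close>; and even together with all other pairs inside \<open>M\<close> it is contained in the frame over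
the remaining vertices of \<open>T\<close> and \<open>M\<close>. Stability of the entropy between \<open>t\<close> and $t+m$ is therefore near
independence of the pairs inside \<open>M\<close>.
\<close>
lemma pair_entropy_bound:
  assumes m: "2 \<le> m" "t + m \<le> n" and \<delta>: "0 < \<delta>" "\<delta> * (real q + 1) \<le> 1" and \<epsilon>: "0 \<le> \<epsilon>"
    and stable: "pair_entropy t \<le> pair_entropy (t + m) + \<epsilon>"
    and B: "\<And>M w. M \<subseteq> V \<Longrightarrow> card M = m \<Longrightarrow> w \<in> F \<Longrightarrow> (\<Sum>e\<in>nsets M 2. ln (real (w e) + 1)) \<le> B"
  defines "k \<equiv> real (m choose 2)"
  shows "k * pair_entropy t \<le> k * \<epsilon> + (B + k * (3 * (real q + 1) * sqrt \<delta>)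
    + k * ln (real q + 1) * (k * (2 * \<epsilon> * (2 / \<delta>) ^ ((m choose 2) + 1))))"
proof -
  let ?T = "{1..t}" and ?M = "{t + 1..t + m}"
  let ?D = "nsets ?M 2" and ?E = "nsets (?M \<union> ?T) 2 - nsets ?M 2"
  have cD: "card ?D = m choose 2" by (simp add: card_nsets)
  have MV: "?M \<subseteq> V" "?T \<subseteq> V" using m by auto
  have finD: "finite ?D" by (intro finite_imp_finite_nsets) simp
  have DU: "?D \<subseteq> U" using MV by (intro nsets_mono)
  have up: "entropy ?E e \<le> pair_entropy t" if e: "e \<in> ?D" for e
  proof -
    have "frame ?T e \<subseteq> ?E"
    proof
      fix f assume f: "f \<in> frame ?T e"
      have eM: "e \<subseteq> ?M" "card e = 2" "finite e" using e by (auto simp: nsets_def)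
      have "f \<notin> nsets ?M 2"
      proof
        assume "f \<in> nsets ?M 2"
        then have "f \<subseteq> ?M" "card f = card e" using eM by (auto simp: nsets_def)
        moreover have "f \<subseteq> ?T \<union> e" using f by (auto simp: frame_def nsets_def)
        moreover have "?M \<inter> ?T = {}" by auto
        ultimately have "f \<subseteq> e" "card f = card e" by blast+
        then have "f = e" using card_subset_eq[OF eM(3)] by blast
        then show False using f unfolding frame_def by simp
      qed
      moreover have "f \<in> nsets (?M \<union> ?T) 2" using f eM unfolding frame_def nsets_def by auto
      ultimately show "f \<in> ?E" by simp
    qed
    then have "entropy ?E e \<le> entropy (frame ?T e) e" by (rule entropy_antimono)
    also have "\<dots> = pair_entropy t"
    proof -
      have "?T \<inter> ?M = {}" by auto
      then have "?T \<inter> e = {}" using e by (auto simp only: nsets_def)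
      from frame_entropy[OF MV(2) subsetD[OF DU e] this] show ?thesis by simp
    qed
    finally show ?thesis .
  qed
  have low: "pair_entropy (t + m) \<le> entropy (?E \<union> D') e" if e: "e \<in> ?D" and D': "D' \<subseteq> ?D - {e}" for e D'
  proof -
    let ?T' = "?T \<union> (?M - e)"
    have eM: "e \<subseteq> ?M" "card e = 2" "finite e" using e by (auto simp: nsets_def)
    have "?E \<union> D' \<subseteq> frame ?T' e"
    proof
      fix f assume f: "f \<in> ?E \<union> D'"
      have "f \<noteq> e" using f e D' by auto
      moreover have "?T' \<union> e = ?M \<union> ?T" using eM by auto
      moreover have "f \<in> nsets (?M \<union> ?T) 2" using f D' nsets_mono[of ?M "?M \<union> ?T" 2] by auto
      ultimately show "f \<in> frame ?T' e" unfolding frame_def by simp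
    qed
    then have "entropy (frame ?T' e) e \<le> entropy (?E \<union> D') e" by (rule entropy_antimono)
    moreover have "entropy (frame ?T' e) e = pair_entropy (card ?T')"
      using e DU eM MV by (intro frame_entropy) auto
    moreover have "card ?T' \<le> t + m"
    proof -
      have "card ?T' \<le> card {1..t + m}" by (intro card_mono) auto
      then show ?thesis by simp
    qed
    then have "pair_entropy (t + m) \<le> pair_entropy (card ?T')" by (rule pair_entropy_antimono)
    ultimately show ?thesis by simp
  qed
  have "(\<Sum>e\<in>?D. entropy ?E e) \<le> B + card ?D * (3 * (real q + 1) * sqrt \<delta>)
    + card ?D * ln (real q + 1) * (card ?D * (2 * \<epsilon> * (2 / \<delta>) ^ (card ?D + 1)))"
  proof (rule entropy_sum_le[OF finD DU \<delta> \<epsilon>])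
    show "entropy ?E e \<le> entropy (?E \<union> D') e + \<epsilon>" if "e \<in> ?D" "D' \<subseteq> ?D - {e}" for e D'
      using up[OF that(1)] low[OF that] stable by linarith
    show "(\<Sum>e\<in>?D. ln (real (w e) + 1)) \<le> B" if "w \<in> F" for w
      using B[OF MV(1) _ that] by simp
  qed
  moreover have "(\<Sum>e\<in>?D. pair_entropy t - \<epsilon>) \<le> (\<Sum>e\<in>?D. entropy ?E e)"
  proof (rule sum_mono)
    fix e assume e: "e \<in> ?D"
    show "pair_entropy t - \<epsilon> \<le> entropy ?E e" using low[OF e, of "{}"] stable by simp
  qed
  ultimately show ?thesis unfolding k_def cD by (simp add: cD algebra_simps)
qed

end
section \<open>The Turan number\<close>

lemma choose_2r: "r \<ge> 1 \<Longrightarrow> 2 * r choose 2 = 2 * r * (r - 1) + r"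
proof -
  assume "r \<ge> 1"
  then obtain k where "r = Suc k" by (cases r) auto
  then show ?thesis by (simp add: choose_two algebra_simps)
qed

text \<open>
If more than $2r(r-1)$ pairs are present, then at most $r-1$ are missing, and removing a vertex from each missing
pair leaves a clique with at least $r+1$ vertices. The bound is attained by the complete $r$-partite graph with
parts $\{x, x+r\}$.
\<close>
lemma turan_number_double:
  assumes r: "r \<ge> 2"
  shows "turan_number (2 * r) (r + 1) = 2 * r * (r - 1)"
proof (rule antisym)
  let ?V = "{1..2 * r}"
  have cU: "card (nsets ?V 2) = 2 * r * (r - 1) + r"
    using r choose_2r[of r] by (simp add: card_nsets)
  have finU: "finite (nsets ?V 2)" by (intro finite_imp_finite_nsets) simp
  obtain E where E: "E \<subseteq> nsets ?V 2" "clique_free (r + 1) ?V E" "card E = turan_number (2 * r) (r + 1)"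
    using turan_number_attained(1)[of "r + 1" "2 * r"] r by auto
  have "card E \<le> 2 * r * (r - 1)"
  proof (rule ccontr)
    assume big: "\<not> ?thesis"
    let ?M = "nsets ?V 2 - E"
    have finE: "finite E" using E(1) finU finite_subset by blast
    have cM: "card ?M \<le> r - 1" using big cU E(1) finE by (simp add: card_Diff_subset)
    define f where "f e = (SOME x. x \<in> e)" for e :: "nat set"
    have f: "f e \<in> e" if "e \<in> ?M" for e
    proof -
      have "e \<noteq> {}" using that by (auto simp: nsets_def)
      then show ?thesis unfolding f_def by (simp add: some_in_eq)
    qed
    have finM: "finite ?M" using finU by simp
    have "card (f ` ?M) \<le> r - 1" using card_image_le[OF finM, of f] cM by linarith
    moreover have "card ?V - card (f ` ?M) \<le> card (?V - f ` ?M)"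
      using finM by (intro diff_card_le_card_Diff) auto
    ultimately have "r + 1 \<le> card (?V - f ` ?M)" using r by simp
    then obtain K where K: "K \<subseteq> ?V - f ` ?M" "card K = r + 1"
      by (meson obtain_subset_with_card_n)
    have finK: "finite K" using K(1) finite_subset by blast
    have "clique K E"
      unfolding clique_def
    proof (intro ballI impI)
      fix v w assume vw: "v \<in> K" "w \<in> K" "v \<noteq> w"
      show "{v, w} \<in> E"
      proof (rule ccontr)
        assume "{v, w} \<notin> E"
        then have M: "{v, w} \<in> ?M" using vw K(1) by (auto simp: nsets_def)
        then have "f {v, w} \<in> {v, w}" by (rule f)
        then have "f {v, w} \<in> K" using vw by auto
        then show False using K(1) M by blast
      qed
    qed
    moreover have "K \<in> nsets ?V (r + 1)" using K finK by (auto simp: nsets_def)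
    ultimately show False using E(2) unfolding clique_free_def by blast
  qed
  then show "turan_number (2 * r) (r + 1) \<le> 2 * r * (r - 1)" using E(3) by simp
  let ?mono = "{e \<in> nsets ?V 2. \<exists>x\<in>{1..r}. e = {x, x + r}}"
  let ?E = "nsets ?V 2 - ?mono"
  have "?mono \<subseteq> (\<lambda>x. {x, x + r}) ` {1..r}" by auto
  then have "card ?mono \<le> r"
    using card_mono[of "(\<lambda>x. {x, x + r}) ` {1..r}" ?mono] card_image_le[of "{1..r}" "\<lambda>x. {x, x + r}"] by simp
  moreover have "card ?E = card (nsets ?V 2) - card ?mono"
    using finU by (intro card_Diff_subset) (auto intro: finite_subset[of _ "nsets ?V 2"])
  ultimately have "2 * r * (r - 1) \<le> card ?E" using cU by simp
  moreover have "clique_free (r + 1) ?V ?E"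
    unfolding clique_free_def
  proof
    assume "\<exists>K\<in>nsets ?V (r + 1). clique K ?E"
    then obtain K where K: "K \<subseteq> ?V" "card K = r + 1" "clique K ?E" by (auto simp: nsets_def)
    let ?g = "\<lambda>x. x mod r"
    have "?g ` K \<subseteq> {..<r}" using r by auto
    then have "card (?g ` K) \<le> r" using card_mono[of "{..<r}" "?g ` K"] by simp
    then have "\<not> inj_on ?g K" using K(2) by (auto dest: card_image)
    then obtain x y where xy: "x \<in> K" "y \<in> K" "x < y" "x mod r = y mod r"
      unfolding inj_on_def by (metis linorder_neqE_nat)
    then have "r dvd y - x" by (metis mod_eq_dvd_iff_nat less_imp_le)
    then obtain k where k: "y - x = r * k" by (auto simp: dvd_def)
    have "y \<le> 2 * r" "1 \<le> x" using xy K(1) by auto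
    have "k = 1"
    proof -
      have "k \<noteq> 0" using k xy(3) by (intro notI) simp
      moreover have "k < 2"
      proof (rule ccontr)
        assume "\<not> k < 2"
        then have "r * 2 \<le> r * k" by (intro mult_left_mono) auto
        then have "r * 2 \<le> y - x" using k by simp
        then show False using \<open>y \<le> 2 * r\<close> \<open>1 \<le> x\<close> xy(3) by arith
      qed
      ultimately show ?thesis by simp
    qed
    then have "y = x + r" using k xy(3) by simp
    moreover have "{x, y} \<in> ?E" using K(3) xy unfolding clique_def by auto
    ultimately show False using \<open>y \<le> 2 * r\<close> \<open>1 \<le> x\<close> by auto
  qed
  ultimately show "2 * r * (r - 1) \<le> turan_number (2 * r) (r + 1)"
    using turan_number_attained(2)[of "r + 1" ?E "2 * r"] r by auto
qed

section \<open>The extremal pattern\<close>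

text \<open>
The largest weights in the extremal pattern, for a colouring \<open>\<kappa>\<close> of the vertices by classes: the image of a pair
is a singleton iff it lies inside a class.
\<close>
definition class_cap :: "nat \<Rightarrow> (nat \<Rightarrow> nat) \<Rightarrow> nat set \<Rightarrow> nat" where
  "class_cap a \<kappa> e = (if card (\<kappa> ` e) \<noteq> 1 then a else if \<kappa> ` e = {0} then a - 2 else a - 1)"

definition cap_log :: "nat \<Rightarrow> nat \<Rightarrow> nat \<Rightarrow> real" where
  "cap_log a i j = (if i \<noteq> j then ln (real a + 1) else if i = 0 then ln (real a - 1) else ln (real a))"

lemma ln_class_cap:
  assumes "a \<ge> 2" "u \<noteq> v"
  shows "ln (real (class_cap a \<kappa> {u, v}) + 1) = cap_log a (\<kappa> u) (\<kappa> v)"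
  using assms unfolding class_cap_def cap_log_def by (auto simp: of_nat_diff card_insert_if)

text \<open>
The proportions of the classes in the extremal pattern.
\<close>
definition class_weight :: "nat \<Rightarrow> nat \<Rightarrow> nat \<Rightarrow> real" where
  "class_weight a r i = (if i = 0 then x_star a r else (1 - x_star a r) / (real r - 1))"

lemma sum_class_weight:
  assumes "r \<ge> 2"
  shows "(\<Sum>i<r. class_weight a r i) = 1"
proof -
  have "{..<r} = insert 0 {1..<r}" using assms by auto
  then have "(\<Sum>i<r. class_weight a r i) = x_star a r + (\<Sum>i\<in>{1..<r}. class_weight a r i)"
    by (simp add: class_weight_def)
  also have "(\<Sum>i\<in>{1..<r}. class_weight a r i) = (\<Sum>i\<in>{1..<r}. (1 - x_star a r) / (real r - 1))"
    by (intro sum.cong) (auto simp: class_weight_def)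
  finally show ?thesis using assms by (simp add: of_nat_diff)
qed

lemma mean_cap_log:
  assumes ar: "a \<ge> 2" "r \<ge> 2" and j: "j < r"
  shows "(\<Sum>i<r. class_weight a r i * cap_log a i j) = growth a r"
proof -
  let ?p = "class_weight a r"
  let ?l = "\<lambda>i::nat. if i = 0 then log_ratio a * log_step a else log_step a"
  have "cap_log a i j = ln (real a + 1) - (if i = j then ?l j else 0)" for i
    unfolding cap_log_def using log_ratio_step[OF ar(1)] log_step_eq[OF ar(1)] by auto
  then have "(\<Sum>i<r. ?p i * cap_log a i j) = (\<Sum>i<r. ?p i) * ln (real a + 1) - (\<Sum>i<r. ?p i * (if i = j then ?l j else 0))"
    by (simp only: right_diff_distrib sum_subtractf sum_distrib_right)
  also have "(\<Sum>i<r. ?p i) * ln (real a + 1) = ln (real a + 1)" using sum_class_weight[OF ar(2)] by simp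
  also have "(\<Sum>i<r. ?p i * (if i = j then ?l j else 0)) = ?p j * ?l j"
  proof -
    have "(\<Sum>i<r. ?p i * (if i = j then ?l j else 0)) = (\<Sum>i<r. if i = j then ?p j * ?l j else 0)"
      by (intro sum.cong) auto
    then show ?thesis using j by simp
  qed
  also have "ln (real a + 1) - ?p j * ?l j = growth a r"
    using growth_eq[OF ar] by (cases "j = 0") (simp_all add: class_weight_def)
  finally show ?thesis .
qed

text \<open>
Colour the vertices one at a time. By \<open>mean_cap_log\<close> the average of the gain over the classes,
with weights \<open>class_weight\<close>, is \<open>growth a r\<close> per earlier vertex, whatever the earlier colours are; so some class
gains at least as much.
\<close>
lemma ex_good_colouring:
  fixes V :: "nat set"
  assumes ar: "a \<ge> 2" "r \<ge> 2" and V: "finite V"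
  shows "\<exists>\<kappa>. (\<forall>v. \<kappa> v < r) \<and>
    growth a r * (card V choose 2) \<le> (\<Sum>e\<in>nsets V 2. ln (real (class_cap a \<kappa> e) + 1))"
  using V
proof (induction V rule: finite_induct)
  case empty
  have "nsets ({} :: nat set) 2 = {}" by (rule nsets_eq_empty) simp_all
  then show ?case using ar by (intro exI[of _ "\<lambda>_. 0"]) (auto simp: binomial_eq_0)
next
  case (insert v V)
  then obtain \<kappa> where \<kappa>: "\<And>v. \<kappa> v < r"
    "growth a r * (card V choose 2) \<le> (\<Sum>e\<in>nsets V 2. ln (real (class_cap a \<kappa> e) + 1))" by auto
  let ?p = "class_weight a r"
  have p0: "0 < ?p i" for i using x_star_eq[OF ar] ar by (simp add: class_weight_def)
  have "\<exists>i<r. growth a r * card V \<le> (\<Sum>x\<in>V. cap_log a i (\<kappa> x))"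
  proof (rule ccontr)
    assume "\<not> ?thesis"
    then have less: "(\<Sum>x\<in>V. cap_log a i (\<kappa> x)) < growth a r * card V" if "i < r" for i using that by force
    have "{..<r} \<noteq> {}" using ar by (simp add: lessThan_empty_iff)
    then have "(\<Sum>i<r. ?p i * (\<Sum>x\<in>V. cap_log a i (\<kappa> x))) < (\<Sum>i<r. ?p i * (growth a r * card V))"
      using less p0 by (intro sum_strict_mono mult_strict_left_mono) auto
    also have "\<dots> = growth a r * card V"
      using sum_class_weight[OF ar(2)] by (simp only: sum_distrib_right[symmetric] mult_1)
    finally have lt: "(\<Sum>i<r. ?p i * (\<Sum>x\<in>V. cap_log a i (\<kappa> x))) < growth a r * card V" .
    have "(\<Sum>i<r. ?p i * (\<Sum>x\<in>V. cap_log a i (\<kappa> x))) = (\<Sum>x\<in>V. \<Sum>i<r. ?p i * cap_log a i (\<kappa> x))"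
      unfolding sum_distrib_left by (rule sum.swap)
    also have "\<dots> = (\<Sum>x\<in>V. growth a r)" using mean_cap_log[OF ar \<kappa>(1)] by (intro sum.cong) auto
    also have "\<dots> = growth a r * card V" by simp
    finally show False using lt by simp
  qed
  then obtain i where i: "i < r" "growth a r * card V \<le> (\<Sum>x\<in>V. cap_log a i (\<kappa> x))" by blast
  let ?\<kappa> = "\<kappa>(v := i)"
  have same: "class_cap a ?\<kappa> e = class_cap a \<kappa> e" if "e \<in> nsets V 2" for e
  proof -
    have "v \<notin> e" using that insert.hyps by (auto simp: nsets_def)
    then have "?\<kappa> ` e = \<kappa> ` e" by (auto simp: image_def)
    then show ?thesis unfolding class_cap_def by simp
  qed
  have "(\<Sum>e\<in>nsets (insert v V) 2. ln (real (class_cap a ?\<kappa> e) + 1))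
      = (\<Sum>e\<in>nsets V 2. ln (real (class_cap a ?\<kappa> e) + 1)) + (\<Sum>x\<in>V. ln (real (class_cap a ?\<kappa> {v, x}) + 1))"
    by (rule sum_nsets_insert) (use insert in auto)
  also have "(\<Sum>e\<in>nsets V 2. ln (real (class_cap a ?\<kappa> e) + 1)) = (\<Sum>e\<in>nsets V 2. ln (real (class_cap a \<kappa> e) + 1))"
    using same by (intro sum.cong) auto
  also have "(\<Sum>x\<in>V. ln (real (class_cap a ?\<kappa> {v, x}) + 1)) = (\<Sum>x\<in>V. cap_log a i (\<kappa> x))"
  proof (rule sum.cong[OF refl])
    fix x assume "x \<in> V"
    then have "x \<noteq> v" using insert.hyps by auto
    then show "ln (real (class_cap a ?\<kappa> {v, x}) + 1) = cap_log a i (\<kappa> x)"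
      using ln_class_cap[OF ar(1), of v x ?\<kappa>] by simp
  qed
  finally have "growth a r * (card V choose 2) + growth a r * card V
      \<le> (\<Sum>e\<in>nsets (insert v V) 2. ln (real (class_cap a ?\<kappa> e) + 1))" using \<kappa>(2) i(2) by linarith
  moreover have "card (insert v V) choose 2 = card V + (card V choose 2)"
    using insert.hyps by (simp add: numeral_2_eq_2)
  ultimately have "growth a r * (card (insert v V) choose 2)
      \<le> (\<Sum>e\<in>nsets (insert v V) 2. ln (real (class_cap a ?\<kappa> e) + 1))"
    by (simp add: algebra_simps del: fun_upd_apply)
  moreover have "\<forall>u. ?\<kappa> u < r" using \<kappa>(1) i(1) by simp
  ultimately show ?case by blast
qed

text \<open>
With $k_i$ vertices of the set in class $i$, the claim is that $\sum_i \binom{k_i}{2} + \binom{k_0}{2}$ is at least $r+1$. If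
$k_0 = 1$, use $\binom{k}{2} \ge 2k-3$ for the other classes, and $\binom{k}{2} \ge k-1$ otherwise.
\<close>
lemma sum_class_cap_le:
  assumes ar: "a \<ge> 2" "r \<ge> 2" and X: "finite X" "card X = 2 * r" and \<kappa>: "\<And>v. \<kappa> v < r"
  shows "(\<Sum>e\<in>nsets X 2. class_cap a \<kappa> e) \<le> sum_bound a r"
proof -
  let ?X = "\<lambda>i. {x\<in>X. \<kappa> x = i}"
  let ?mono = "{e\<in>nsets X 2. card (\<kappa> ` e) = 1}" and ?zero = "{e\<in>nsets X 2. \<kappa> ` e = {0}}"
  have finE: "finite (nsets X 2)" using X by (intro finite_imp_finite_nsets)
  have zero: "?zero = nsets (?X 0) 2"
  proof (intro equalityI subsetI)
    fix e assume e: "e \<in> nsets (?X 0) 2"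
    then have "e \<noteq> {}" by (auto simp: nsets_def)
    then show "e \<in> ?zero" using e by (auto simp: nsets_def)
  qed (auto simp: nsets_def)
  have mono: "?mono = (\<Union>i<r. nsets (?X i) 2)"
  proof (intro equalityI subsetI)
    fix e assume "e \<in> ?mono"
    then obtain i where e: "e \<in> nsets X 2" "\<kappa> ` e = {i}" by (auto simp: card_1_singleton_iff)
    then have "e \<in> nsets (?X i) 2" by (auto simp: nsets_def)
    moreover have "i \<in> \<kappa> ` e" using e by simp
    then have "i < r" using \<kappa> by auto
    ultimately show "e \<in> (\<Union>i<r. nsets (?X i) 2)" by auto
  next
    fix e assume "e \<in> (\<Union>i<r. nsets (?X i) 2)"
    then obtain i where e: "e \<in> nsets (?X i) 2" by auto
    then have "e \<noteq> {}" by (auto simp: nsets_def)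
    then have "\<kappa> ` e = {i}" using e by (auto simp: nsets_def)
    then show "e \<in> ?mono" using e by (auto simp: nsets_def)
  qed
  have "card ?mono = (\<Sum>i<r. card (nsets (?X i) 2))"
    unfolding mono
  proof (rule card_UN_disjoint)
    show "\<forall>i\<in>{..<r}. finite (nsets (?X i) 2)" using X by (auto intro!: finite_imp_finite_nsets)
    show "\<forall>i\<in>{..<r}. \<forall>j\<in>{..<r}. i \<noteq> j \<longrightarrow> nsets (?X i) 2 \<inter> nsets (?X j) 2 = {}"
    proof (intro ballI impI)
      fix i j :: nat assume "i \<noteq> j"
      then show "nsets (?X i) 2 \<inter> nsets (?X j) 2 = {}" by (fastforce simp: nsets_def card_2_iff)
    qed
  qed simp
  then have cmono: "card ?mono = (\<Sum>i<r. card (?X i) choose 2)" using X by (simp add: card_nsets2)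
  have czero: "card ?zero = card (?X 0) choose 2" unfolding zero using X by (simp add: card_nsets2)
  have sumX: "(\<Sum>i<r. card (?X i)) = 2 * r"
  proof -
    have "(\<Sum>i<r. card (?X i)) = card (\<Union>i<r. ?X i)" by (rule card_UN_disjoint[symmetric]) (use X in auto)
    also have "(\<Union>i<r. ?X i) = X" using \<kappa> by auto
    finally show ?thesis using X by simp
  qed
  have c1: "int k - 1 \<le> int (k choose 2)" and c2: "2 * int k - 3 \<le> int (k choose 2)" for k
  proof -
    have "int k - 1 \<le> int (k choose 2) \<and> 2 * int k - 3 \<le> int (k choose 2)"
    proof (induction k)
      case (Suc k)
      have "Suc k choose 2 = k + (k choose 2)" by (simp add: numeral_2_eq_2)
      then show ?case using Suc by (cases "k \<le> 1") (auto simp: le_Suc_eq)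
    qed simp
    then show "int k - 1 \<le> int (k choose 2)" "2 * int k - 3 \<le> int (k choose 2)" by auto
  qed
  have ins: "{..<r} = insert 0 {1..<r}" using ar by auto
  let ?k = "\<lambda>i. int (card (?X i))"
  have sumk: "(\<Sum>i\<in>{1..<r}. ?k i) = 2 * int r - ?k 0"
  proof -
    have "card (?X 0) + (\<Sum>i\<in>{1..<r}. card (?X i)) = 2 * r" using sumX unfolding ins by simp
    then have "?k 0 + (\<Sum>i\<in>{1..<r}. ?k i) = 2 * int r" by (simp flip: of_nat_sum of_nat_add)
    then show ?thesis by simp
  qed
  have r1: "int (r - 1) = int r - 1" using ar by simp
  have "int (r + 1) \<le> int (card ?mono + card ?zero)"
  proof -
    have eq: "int (card ?mono + card ?zero) = 2 * int (card (?X 0) choose 2) + (\<Sum>i\<in>{1..<r}. int (card (?X i) choose 2))"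
      unfolding cmono czero ins by simp
    show ?thesis
    proof (cases "card (?X 0) = 1")
      case True
      have "(\<Sum>i\<in>{1..<r}. 2 * ?k i - 3) \<le> (\<Sum>i\<in>{1..<r}. int (card (?X i) choose 2))" by (intro sum_mono c2)
      also have "(\<Sum>i\<in>{1..<r}. 2 * ?k i - 3) = 2 * (2 * int r - ?k 0) - 3 * (int r - 1)"
        by (simp only: sum_subtractf sum_distrib_left[symmetric] sumk sum_constant card_atLeastLessThan r1)
      finally show ?thesis unfolding eq using True by simp
    next
      case False
      have "(\<Sum>i\<in>{1..<r}. ?k i - 1) \<le> (\<Sum>i\<in>{1..<r}. int (card (?X i) choose 2))" by (intro sum_mono c1)
      also have "(\<Sum>i\<in>{1..<r}. ?k i - 1) = 2 * int r - ?k 0 - (int r - 1)"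
        by (simp only: sum_subtractf sumk sum_constant card_atLeastLessThan r1 mult_1_right)
      finally have "2 * int r - ?k 0 - (int r - 1) \<le> (\<Sum>i\<in>{1..<r}. int (card (?X i) choose 2))" .
      moreover have "?k 0 \<le> 2 * int (card (?X 0) choose 2)"
      proof (cases "card (?X 0)")
        case 0 then show ?thesis by simp
      next
        case (Suc l)
        then have "card (?X 0) \<ge> 2" using False by simp
        then show ?thesis using c1[of "card (?X 0)"] by linarith
      qed
      ultimately show ?thesis unfolding eq by simp
    qed
  qed
  then have m: "r + 1 \<le> card ?mono + card ?zero" by (simp only: of_nat_le_iff)
  have "class_cap a \<kappa> e + (if e \<in> ?mono then 1 else 0) + (if e \<in> ?zero then 1 else 0) = a" if "e \<in> nsets X 2" for e
    using that ar unfolding class_cap_def by auto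
  then have "(\<Sum>e\<in>nsets X 2. class_cap a \<kappa> e + (if e \<in> ?mono then 1 else 0) + (if e \<in> ?zero then 1 else 0)) = (\<Sum>e\<in>nsets X 2. a)"
    by (intro sum.cong) auto
  moreover have "(\<Sum>e\<in>nsets X 2. class_cap a \<kappa> e + (if e \<in> ?mono then 1 else 0) + (if e \<in> ?zero then 1 else 0))
     = (\<Sum>e\<in>nsets X 2. class_cap a \<kappa> e) + card ?mono + card ?zero"
  proof -
    have "(\<Sum>e\<in>nsets X 2. if e \<in> B then 1 else 0) = card B" if "B \<subseteq> nsets X 2" for B
      using finE that by (simp add: sum.If_cases Int_absorb1)
    from this[of ?mono] this[of ?zero] show ?thesis unfolding sum.distrib by simp
  qed
  moreover have "(\<Sum>e\<in>nsets X 2. a) = (2 * r choose 2) * a" using X by (simp add: card_nsets2)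
  ultimately have "(\<Sum>e\<in>nsets X 2. class_cap a \<kappa> e) + (r + 1) \<le> (2 * r choose 2) * a" using m by linarith
  also have "(2 * r choose 2) * a = (a - 1) * (2 * r choose 2) + (2 * r choose 2)"
    using ar by (simp add: algebra_simps flip: mult_Suc_right)
  finally show ?thesis using choose_2r[of r] ar by simp
qed

lemma card_sq_graphs_ge:
  assumes ar: "a \<ge> 2" "r \<ge> 2" and n: "2 * r \<le> n"
  shows "growth a r * (n choose 2) \<le> ln (card (sq_graphs n (2 * r) (sum_bound a r)))"
proof -
  let ?U = "nsets {1..n} 2" and ?F = "sq_graphs n (2 * r) (sum_bound a r)"
  obtain \<kappa> where \<kappa>: "\<And>v. \<kappa> v < r"
    "growth a r * (n choose 2) \<le> (\<Sum>e\<in>?U. ln (real (class_cap a \<kappa> e) + 1))"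
    using ex_good_colouring[OF ar, of "{1..n}"] by auto
  have finU: "finite ?U" by (intro finite_imp_finite_nsets) simp
  let ?G = "PiE ?U (\<lambda>e. {..class_cap a \<kappa> e})"
  have "?G \<subseteq> ?F"
  proof
    fix w assume w: "w \<in> ?G"
    have "(\<Sum>e\<in>nsets X 2. w e) \<le> sum_bound a r" if X: "X \<in> nsets {1..n} (2 * r)" for X
    proof -
      have "nsets X 2 \<subseteq> ?U" using X by (intro nsets_mono) (auto simp: nsets_def)
      then have "(\<Sum>e\<in>nsets X 2. w e) \<le> (\<Sum>e\<in>nsets X 2. class_cap a \<kappa> e)"
        using w by (intro sum_mono) (auto simp: PiE_iff)
      also have "\<dots> \<le> sum_bound a r" using X \<kappa> by (intro sum_class_cap_le[OF ar]) (auto simp: nsets_def)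
      finally show ?thesis .
    qed
    then show "w \<in> ?F" using w unfolding sq_graphs_def sq_graph_def by (auto simp: PiE_def)
  qed
  then have "card ?G \<le> card ?F"
    using finite_sq_graphs[of "2 * r" n] ar n by (intro card_mono) auto
  moreover have cG: "card ?G = (\<Prod>e\<in>?U. class_cap a \<kappa> e + 1)" using finU by (simp add: card_PiE)
  moreover have "0 < card ?G" unfolding cG by (rule prod_pos) simp
  ultimately have "0 < real (card ?G)" "real (card ?G) \<le> real (card ?F)"
    by (simp_all only: of_nat_0_less_iff of_nat_le_iff)
  then have "ln (card ?G) \<le> ln (card ?F)" by (intro ln_mono)
  moreover have "ln (card ?G) = (\<Sum>e\<in>?U. ln (real (class_cap a \<kappa> e) + 1))"
    unfolding cG of_nat_prod using finU by (subst ln_prod) (auto simp: add.commute)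
  ultimately show ?thesis using \<kappa>(2) by simp
qed

section \<open>The asymptotic count\<close>

text \<open>
Five errors of size $\eta/5$ are allowed: the linear term of \<open>log_product_bound\<close> (large \<open>m\<close>), the
unlikely values (small \<open>\<delta>\<close>), the atypical members and the instability of the entropy (small \<open>\<epsilon>\<close>,
depending on \<open>m\<close> and \<open>\<delta>\<close>), and the pairs meeting the set of \<open>t\<close> vertices (large \<open>n\<close>).
\<close>
lemma card_sq_graphs_le:
  assumes ar: "a \<ge> 2" "r \<ge> 2" and \<eta>: "0 < \<eta>"
  shows "\<forall>\<^sub>F n in sequentially. ln (card (sq_graphs n (2 * r) (sum_bound a r))) \<le> (growth a r + \<eta>) * (n choose 2)"
proof -
  define q where "q = sum_bound a r"
  define l where "l = ln (real q + 1)"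
  define C where "C = growth a r + 3 * r * l"
  have l0: "0 \<le> l" unfolding l_def by simp
  have C0: "0 \<le> C" unfolding C_def using growth_pos[OF ar] l0 by simp
  obtain m :: nat where m: "10 * C / \<eta> + 2 * r + 2 \<le> m" using real_arch_simple by blast
  have m2: "2 * r \<le> m" "2 \<le> m"
  proof -
    have "0 \<le> 10 * C / \<eta>" using C0 \<eta> by simp
    then have "real (2 * r) \<le> real m" "real 2 \<le> real m" using m by auto
    then show "2 * r \<le> m" "2 \<le> m" by (simp_all only: of_nat_le_iff)
  qed
  define k where "k = real (m choose 2)"
  have choose_real: "real (N choose 2) = real N * (real N - 1) / 2" if "1 \<le> N" for N
  proof -
    have "even (N * (N - 1))" by (cases N) auto
    then have "real (N choose 2) = real (N * (N - 1)) / 2"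
      unfolding choose_two by (simp add: real_of_nat_div)
    then show ?thesis using that by (simp add: of_nat_diff)
  qed
  have km: "k = real m * (real m - 1) / 2" unfolding k_def using m2 by (intro choose_real) simp
  have k0: "0 < k" unfolding km using m2 by simp
  have Cm: "C * m \<le> \<eta> / 5 * k"
  proof -
    have "10 * C / \<eta> \<le> real m - 1" using m by simp
    then have "10 * C \<le> \<eta> * (real m - 1)" using \<eta> by (simp add: pos_divide_le_eq mult.commute)
    then have "10 * C * m \<le> \<eta> * (real m - 1) * m" by (intro mult_right_mono) auto
    then show ?thesis unfolding km by (simp add: mult_ac)
  qed
  \<comment> \<open>The square root of \<delta>.\<close>
  define \<tau> where "\<tau> = min 1 (\<eta> / 15) / (real q + 1)"
  define \<delta> where "\<delta> = \<tau>\<^sup>2"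
  have \<tau>0: "0 < \<tau>" unfolding \<tau>_def using \<eta> by simp
  have \<tau>q: "\<tau> * (real q + 1) = min 1 (\<eta> / 15)" unfolding \<tau>_def by simp
  have \<tau>1: "\<tau> \<le> 1"
  proof -
    have "\<tau> * 1 \<le> \<tau> * (real q + 1)" using \<tau>0 by (intro mult_left_mono) auto
    then show ?thesis using \<tau>q by simp
  qed
  have \<delta>: "0 < \<delta>" "\<delta> * (real q + 1) \<le> 1"
  proof -
    show "0 < \<delta>" unfolding \<delta>_def using \<tau>0 by simp
    have "\<delta> * (real q + 1) = \<tau> * min 1 (\<eta> / 15)" unfolding \<delta>_def \<tau>q[symmetric] by (simp add: power2_eq_square)
    also have "\<dots> \<le> 1 * 1" using \<tau>0 \<tau>1 \<eta> by (intro mult_mono) auto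
    finally show "\<delta> * (real q + 1) \<le> 1" by simp
  qed
  have sq\<delta>: "3 * (real q + 1) * sqrt \<delta> \<le> \<eta> / 5"
  proof -
    have "sqrt \<delta> = \<tau>" unfolding \<delta>_def using \<tau>0 by simp
    then have "3 * (real q + 1) * sqrt \<delta> = 3 * (\<tau> * (real q + 1))" by (simp only: mult_ac)
    then have "3 * (real q + 1) * sqrt \<delta> = 3 * min 1 (\<eta> / 15)" by (simp only: \<tau>q)
    then show ?thesis by simp
  qed
  define P where "P = l * (k * (2 * (2 / \<delta>) ^ ((m choose 2) + 1)))"
  have P0: "0 \<le> P" unfolding P_def using l0 k0 \<delta>(1) by simp
  define \<epsilon> where "\<epsilon> = min (\<eta> / 5) (\<eta> / 5 / (P + 1))"
  have \<epsilon>: "0 < \<epsilon>" "\<epsilon> \<le> \<eta> / 5"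
    using \<eta> P0 by (simp add: \<epsilon>_def) (simp only: \<epsilon>_def min.cobounded1)
  have P\<epsilon>: "P * \<epsilon> \<le> \<eta> / 5"
  proof -
    have "P * \<epsilon> \<le> (P + 1) * \<epsilon>" using \<epsilon> by (intro mult_right_mono) auto
    also have "\<dots> \<le> (P + 1) * (\<eta> / 5 / (P + 1))" using P0 by (intro mult_left_mono) (auto simp: \<epsilon>_def)
    also have "\<dots> = \<eta> / 5"
    proof -
      have "D * (x / D) = x" if "0 < D" for D x :: real using that by simp
      from this[of "P + 1" "\<eta> / 5"] P0 show ?thesis by linarith
    qed
    finally show ?thesis .
  qed
  obtain J :: nat where J: "l / \<epsilon> + 1 \<le> J" using real_arch_simple by blast
  have J0: "0 < J" and Jl: "l \<le> real J * \<epsilon>"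
  proof -
    have "0 \<le> l / \<epsilon>" using l0 \<epsilon> by simp
    then have "0 < real J" using J by linarith
    then show "0 < J" by simp
    have "l / \<epsilon> \<le> J" using J by simp
    then show "l \<le> real J * \<epsilon>" using \<epsilon> by (simp add: pos_divide_le_eq)
  qed
  obtain N :: nat where N: "10 * (J * m) * l / \<eta> + 1 \<le> N" using real_arch_simple by blast
  have "ln (card (sq_graphs n (2 * r) q)) \<le> (growth a r + \<eta>) * (n choose 2)"
    if n: "N \<le> n" "J * m + m \<le> n" for n
  proof -
    interpret sq_family n "2 * r" q
      using ar m2 n by unfold_locales auto
    obtain t where t: "t \<le> J * m" "pair_entropy t \<le> pair_entropy (t + m) + \<epsilon>"
      using ex_stable[OF Jl[unfolded l_def] J0, of m] by blast
    have n1: "1 \<le> n" using n m2 by simp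
    have B: "(\<Sum>e\<in>nsets M 2. ln (real (w e) + 1)) \<le> growth a r * k + C * m"
      if M: "M \<subseteq> {1..n}" "card M = m" and w: "w \<in> sq_graphs n (2 * r) q" for M w
    proof -
      have "finite M" using M(1) finite_subset by blast
      moreover have "sq_graph (2 * r) (sum_bound a r) M w"
        using w M(1) sq_graph_mono unfolding sq_graphs_def q_def by blast
      ultimately show ?thesis
        using log_product_bound[OF ar, of M w] M m2 unfolding k_def C_def l_def q_def by simp
    qed
    have "k * pair_entropy t \<le> k * \<epsilon> + ((growth a r * k + C * m) + k * (3 * (real q + 1) * sqrt \<delta>)
      + k * l * (k * (2 * \<epsilon> * (2 / \<delta>) ^ ((m choose 2) + 1))))"
      unfolding k_def l_def
      by (rule pair_entropy_bound[OF m2(2) _ \<delta> less_imp_le[OF \<epsilon>(1)] t(2)])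
        (use t(1) n(2) B in \<open>auto simp: k_def\<close>)
    also have "k * l * (k * (2 * \<epsilon> * (2 / \<delta>) ^ ((m choose 2) + 1))) = k * (P * \<epsilon>)"
      unfolding P_def by (simp only: mult_ac)
    also have "k * \<epsilon> + ((growth a r * k + C * m) + k * (3 * (real q + 1) * sqrt \<delta>) + k * (P * \<epsilon>))
      \<le> k * (\<eta> / 5) + ((growth a r * k + \<eta> / 5 * k) + k * (\<eta> / 5) + k * (\<eta> / 5))"
      using k0 \<epsilon> sq\<delta> P\<epsilon> Cm less_imp_le[OF growth_pos[OF ar]] by (intro add_mono mult_left_mono) auto
    also have "\<dots> = k * (growth a r + 4 / 5 * \<eta>)" by (simp add: algebra_simps)
    finally have h: "pair_entropy t \<le> growth a r + 4 / 5 * \<eta>" using k0 by simp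
    have "(t * n) * l \<le> \<eta> / 5 * (n choose 2)"
    proof -
      have "10 * (J * m) * l / \<eta> \<le> real n - 1" using N n(1) by linarith
      then have *: "10 * (J * m) * l \<le> \<eta> * (real n - 1)" using \<eta> by (simp add: pos_divide_le_eq mult.commute)
      have "real t \<le> real (J * m)" using t(1) by (simp only: of_nat_le_iff)
      then have "10 * real t * l \<le> 10 * (J * m) * l" using l0 by (intro mult_right_mono) auto
      then have "10 * real t * l \<le> \<eta> * (real n - 1)" using * by linarith
      then have "10 * real t * l * n \<le> \<eta> * (real n - 1) * n" by (intro mult_right_mono) auto
      then show ?thesis unfolding choose_real[OF n1] by (simp add: mult_ac)
    qed
    moreover have "(n choose 2) * pair_entropy t \<le> (n choose 2) * (growth a r + 4 / 5 * \<eta>)"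
      using h by (intro mult_left_mono) auto
    moreover have "t \<le> n" using t(1) n(2) by simp
    ultimately have "ln (card (sq_graphs n (2 * r) q)) \<le> \<eta> / 5 * (n choose 2) + (n choose 2) * (growth a r + 4 / 5 * \<eta>)"
      using ln_card_le_pair_entropy[of t] unfolding l_def by linarith
    then show ?thesis by (simp add: algebra_simps)
  qed
  then show ?thesis
    unfolding q_def eventually_sequentially by (intro exI[of _ "max N (J * m + m)"]) auto
qed

theorem theorem1p7:
  fixes a r :: nat
  assumes "a \<ge> 2" and "r \<ge> 2"
  shows "\<exists>\<epsilon> :: nat \<Rightarrow> real. \<epsilon> \<longlonglongrightarrow> 0 \<and>
    (\<forall>\<^sub>F n in sequentially.
      real (card (sq_graphs n (2 * r) ((a - 1) * (2 * r choose 2) + turan_number (2 * r) (r + 1) - 1)))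
      = (real a powr ((1 - x_star a r) / (real r - 1))
          * (real a + 1) powr ((real r - 2 + x_star a r) / (real r - 1)))
        powr ((1 + \<epsilon> n) * real (n choose 2)))"
proof -
  let ?F = "\<lambda>n. sq_graphs n (2 * r) (sum_bound a r)"
  let ?\<Lambda> = "growth a r"
  let ?b = "real a powr ((1 - x_star a r) / (real r - 1)) * (real a + 1) powr ((real r - 2 + x_star a r) / (real r - 1))"
  have \<Lambda>0: "0 < ?\<Lambda>" by (rule growth_pos[OF assms])
  have b: "?b = exp ?\<Lambda>" using assms by (simp add: growth_def powr_def exp_add)
  define \<epsilon> where "\<epsilon> n = ln (card (?F n)) / (?\<Lambda> * (n choose 2)) - 1" for n
  have pos: "0 < ?\<Lambda> * real (n choose 2)" if "2 * r \<le> n" for n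
    using that assms \<Lambda>0 by (intro mult_pos_pos) auto
  have eq: "real (card (?F n)) = ?b powr ((1 + \<epsilon> n) * real (n choose 2))" if n: "2 * r \<le> n" for n
  proof -
    interpret sq_family n "2 * r" "sum_bound a r" using assms n by unfold_locales auto
    have "(1 + \<epsilon> n) * real (n choose 2) * ?\<Lambda> = ln (card (?F n))"
    proof -
      have "(1 + (L / D - 1)) * D = L" if "0 < D" for L D :: real using that by simp
      from this[OF pos[OF n]] show ?thesis unfolding \<epsilon>_def by (simp only: mult_ac)
    qed
    then show ?thesis unfolding b using cardF by (simp add: powr_def)
  qed
  have "\<epsilon> \<longlonglongrightarrow> 0"
  proof (rule LIMSEQ_I, goal_cases)
    case (1 e)
    have "\<forall>\<^sub>F n in sequentially. ln (card (?F n)) \<le> (?\<Lambda> + ?\<Lambda> * (e / 2)) * (n choose 2)"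
      using 1 \<Lambda>0 by (intro card_sq_graphs_le[OF assms]) auto
    moreover have "\<forall>\<^sub>F n in sequentially. 2 * r \<le> n" by (rule eventually_ge_at_top)
    ultimately have "\<forall>\<^sub>F n in sequentially. norm (\<epsilon> n - 0) < e"
    proof eventually_elim
      case (elim n)
      have "ln (card (?F n)) \<le> (1 + e / 2) * (?\<Lambda> * (n choose 2))" using elim(1) by (simp add: algebra_simps)
      then have "ln (card (?F n)) / (?\<Lambda> * (n choose 2)) \<le> 1 + e / 2"
        using pos[OF elim(2)] by (simp only: pos_divide_le_eq)
      then have "\<epsilon> n \<le> e / 2" unfolding \<epsilon>_def by linarith
      moreover have "?\<Lambda> * (n choose 2) \<le> ln (card (?F n))" by (rule card_sq_graphs_ge[OF assms elim(2)])
      then have "0 \<le> \<epsilon> n" unfolding \<epsilon>_def using pos[OF elim(2)] by (simp add: pos_le_divide_eq)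
      ultimately show ?case using 1 by simp
    qed
    then show ?case by (simp add: eventually_sequentially)
  qed
  moreover have "\<forall>\<^sub>F n in sequentially. real (card (?F n)) = ?b powr ((1 + \<epsilon> n) * real (n choose 2))"
    using eventually_ge_at_top[of "2 * r"] by (rule eventually_mono) (rule eq)
  ultimately show ?thesis unfolding turan_number_double[OF assms(2)] by blast
qed

end
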